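(* Let $H\in(1/2,1)$, let $X=(X_t)_{t\ge 0}$ be the solution of $dX_t=\sigma(X_t)\circ dB^H_t+b(X_t)\,dt$ with $X_0$ independent of $B^H$, and let $L_N(t)$ be the empirical spectral measure of the $N\times N$ symmetric matrix $Y^N(t)$ built from i.i.d. copies of $X$ (see context). Suppose that for some $\varepsilon\in(0,H-\frac12)$ the functions $\sigma,b:\mathbb{R}\to\mathbb{R}$ have bounded derivatives which are Hölder continuous of order greater than $\frac1{H-\varepsilon}-1$, and that one of the following holds: (H1) $\sigma$ and $b$ are bounded; (H2) $\|\sigma'\|_\infty+\|b'\|_\infty>0$ and $\mathbb{E}[|X_0|^4]<\infty$. Assume that there exist a positive function $\varphi\in C^1(\mathbb{R})$ with bounded derivative and $\lim_{|x|\to\infty}\varphi(x)=\infty$, and a positive constant $C_0$, such that almost surely $\sup_{N\in\mathbb{N}}\langle\varphi,L_N(0)\rangle\le C_0$. Then for any $T>0$, almost surely, the sequence $\{L_N(t),t\in[0,T]\}_{N\in\mathbb{N}}$ is relatively compact in $C([0,T],\mathbf{P}(\mathbb{R}))$.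
   Context: $B^H$ is a one-dimensional fractional Brownian motion with Hurst parameter $H$; the stochastic differential equation is understood in the Stratonovich sense, which for $H>1/2$ means that $\int\sigma(X_r)\circ dB^H_r$ is the pathwise Riemann–Stieltjes (Young) integral, and under the stated regularity it has a unique solution. $\{X_{ij}(t)\}_{i,j\ge1}$ are i.i.d. copies of the process $X$, all on one probability space. $Y^N(t)=(Y^N_{ij}(t))_{1\le i,j\le N}$ is the real symmetric matrix with $Y^N_{ij}(t)=\frac1{\sqrt N}X_{ij}(t)$ for $1\le i<j\le N$ and $Y^N_{ii}(t)=\frac{\sqrt2}{\sqrt N}X_{ii}(t)$. With $\lambda^N_1(t)\le\dots\le\lambda^N_N(t)$ its eigenvalues, $L_N(t)=\frac1N\sum_{i=1}^N\delta_{\lambda^N_i(t)}$. $\mathbf{P}(\mathbb{R})$ is the space of Borel probability measures on $\mathbb{R}$ with the weak topology (a Polish space) and $C([0,T],\mathbf{P}(\mathbb{R}))$ is the space of continuous maps $[0,T]\to\mathbf{P}(\mathbb{R})$ with the topology of uniform convergence. $\langle f,\mu\rangle=\int f\,d\mu$. $\|\cdot\|_\infty$ is the supremum norm. *)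

theory Defs
  imports "HOL-Probability.Probability" "Jordan_Normal_Form.Char_Poly"
begin

text \<open>A process is a function \<open>X :: real \<Rightarrow> 'a \<Rightarrow> real\<close>, of which only the values at times
  \<open>t \<ge> 0\<close> are meaningful. It is viewed as a random element of the product space
  \<open>\<real>\<^bsup>[0,\<infinity>)\<^esup>\<close>.\<close>

abbreviation path_space :: "(real \<Rightarrow> real) measure" where
  "path_space \<equiv> PiM {0..} (\<lambda>_. borel)"

definition sample_path :: "(real \<Rightarrow> 'a \<Rightarrow> real) \<Rightarrow> 'a \<Rightarrow> real \<Rightarrow> real" where
  "sample_path X \<omega> = (\<lambda>t\<in>{0..}. X t \<omega>)"

text \<open>The constant \<open>prob_space.indep_var\<close> needs both variables to take values in the same type.\<close>

definition independent_variables ::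
    "'a measure \<Rightarrow> 'b measure \<Rightarrow> ('a \<Rightarrow> 'b) \<Rightarrow> 'c measure \<Rightarrow> ('a \<Rightarrow> 'c) \<Rightarrow> bool" where
  "independent_variables M S Z S' W \<longleftrightarrow>
     Z \<in> measurable M S \<and> W \<in> measurable M S' \<and>
     prob_space.indep_set M {Z -` A \<inter> space M | A. A \<in> sets S} {W -` A \<inter> space M | A. A \<in> sets S'}"

text \<open>Point masses count as Gaussian laws.\<close>

definition gaussian :: "'a measure \<Rightarrow> ('a \<Rightarrow> real) \<Rightarrow> bool" where
  "gaussian M Z \<longleftrightarrow> Z \<in> borel_measurable M \<and>
     ((\<exists>m. AE \<omega> in M. Z \<omega> = m) \<or> (\<exists>m s. s > 0 \<and> distributed M lborel Z (normal_density m s)))"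

definition gaussian_process :: "'a measure \<Rightarrow> (real \<Rightarrow> 'a \<Rightarrow> real) \<Rightarrow> bool" where
  "gaussian_process M B \<longleftrightarrow>
     (\<forall>J c. finite J \<and> J \<subseteq> {0..} \<longrightarrow> gaussian M (\<lambda>\<omega>. \<Sum>t\<in>J. c t * B t \<omega>))"

definition fractional_brownian_motion :: "'a measure \<Rightarrow> real \<Rightarrow> (real \<Rightarrow> 'a \<Rightarrow> real) \<Rightarrow> bool" where
  "fractional_brownian_motion M H B \<longleftrightarrow>
     prob_space M \<and>
     gaussian_process M B \<and>
     (\<forall>t\<ge>0. prob_space.expectation M (B t) = 0) \<and>
     (\<forall>s\<ge>0. \<forall>t\<ge>0. prob_space.expectation M (\<lambda>\<omega>. B s \<omega> * B t \<omega>)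
        = (s powr (2 * H) + t powr (2 * H) - \<bar>t - s\<bar> powr (2 * H)) / 2) \<and>
     (AE \<omega> in M. continuous_on {0..} (\<lambda>t. B t \<omega>))"

definition holder_on :: "real set \<Rightarrow> real \<Rightarrow> (real \<Rightarrow> real) \<Rightarrow> bool" where
  "holder_on S \<gamma> f \<longleftrightarrow>
     0 < \<gamma> \<and> \<gamma> \<le> 1 \<and> (\<exists>C. \<forall>x\<in>S. \<forall>y\<in>S. \<bar>f x - f y\<bar> \<le> C * \<bar>x - y\<bar> powr \<gamma>)"

text \<open>The Riemann--Stieltjes integral of \<open>f\<close> against \<open>g\<close> over \<open>[a,b]\<close>, as the limit of the tagged sums
  when the mesh tends to \<open>0\<close>; a constant gauge bounds the mesh, and an interval \<open>K\<close> of the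
  division is \<open>[Inf K, Sup K]\<close>.\<close>

definition has_RS_integral ::
    "(real \<Rightarrow> real) \<Rightarrow> (real \<Rightarrow> real) \<Rightarrow> real \<Rightarrow> real \<Rightarrow> real \<Rightarrow> bool" where
  "has_RS_integral f g a b I \<longleftrightarrow>
     (\<forall>e>0. \<exists>d>0. \<forall>p. p tagged_division_of {a..b} \<and> (\<lambda>x. ball x d) fine p \<longrightarrow>
        \<bar>(\<Sum>(x, K)\<in>p. f x * (g (Sup K) - g (Inf K))) - I\<bar> < e)"

text \<open>\<open>X\<close> solves \<open>dX = \<sigma>(X) \<circ> dB + b(X) dt\<close> pathwise. The paths of \<open>B\<close> are locally Hoelder of every
  order below \<open>H\<close>, so local Hoelder regularity of \<open>X\<close> of some order above \<open>1 - H\<close> is what Young's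
  theory requires for the integral of \<open>\<sigma>(X)\<close> against \<open>B\<close>. It fixes the class of paths in which the
  solution is unique.\<close>

definition young_sde_solution ::
    "'a measure \<Rightarrow> real \<Rightarrow> (real \<Rightarrow> real) \<Rightarrow> (real \<Rightarrow> real) \<Rightarrow>
     (real \<Rightarrow> 'a \<Rightarrow> real) \<Rightarrow> (real \<Rightarrow> 'a \<Rightarrow> real) \<Rightarrow> bool" where
  "young_sde_solution M H \<sigma> b B X \<longleftrightarrow>
     (\<forall>t\<ge>0. X t \<in> borel_measurable M) \<and>
     (AE \<omega> in M. \<exists>\<alpha>>1 - H. \<forall>T\<ge>0. holder_on {0..T} \<alpha> (\<lambda>t. X t \<omega>)) \<and>
     (AE \<omega> in M. \<forall>t\<ge>0.
        has_RS_integral (\<lambda>r. \<sigma> (X r \<omega>)) (\<lambda>r. B r \<omega>) 0 t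
          (X t \<omega> - X 0 \<omega> - integral {0..t} (\<lambda>r. b (X r \<omega>))))"

text \<open>I.i.d. copies of a process with continuous paths. The product \<open>\<sigma>\<close>-algebra does not see path
  continuity, so that the copies again have continuous paths is required separately.\<close>

definition iid_copies ::
    "'a measure \<Rightarrow> ('i \<Rightarrow> real \<Rightarrow> 'a \<Rightarrow> real) \<Rightarrow> 'b measure \<Rightarrow> (real \<Rightarrow> 'b \<Rightarrow> real) \<Rightarrow> bool" where
  "iid_copies M XX M0 X \<longleftrightarrow>
     prob_space.indep_vars M (\<lambda>_. path_space) (\<lambda>k. sample_path (XX k)) UNIV \<and>
     (\<forall>k. distr M path_space (sample_path (XX k)) = distr M0 path_space (sample_path X)) \<and>
     (\<forall>k. AE \<omega> in M. continuous_on {0..} (\<lambda>t. XX k t \<omega>))"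

text \<open>Rows and columns are numbered from \<open>0\<close>; the entries below the diagonal are given by symmetry.\<close>

definition Y_mat :: "(nat \<times> nat \<Rightarrow> real \<Rightarrow> 'a \<Rightarrow> real) \<Rightarrow> nat \<Rightarrow> real \<Rightarrow> 'a \<Rightarrow> real mat" where
  "Y_mat XX N t \<omega> = Matrix.mat N N (\<lambda>(i, j).
     if i = j then sqrt 2 / sqrt (real N) * XX (i, i) t \<omega>
     else 1 / sqrt (real N) * XX (min i j, max i j) t \<omega>)"

text \<open>The real eigenvalues in increasing order, repeated according to algebraic multiplicity. For a
  real symmetric matrix of size \<open>N\<close> this list has length \<open>N\<close>.\<close>

definition eigenvalue_list :: "real mat \<Rightarrow> real list" where
  "eigenvalue_list A = sorted_list_of_multiset (proots (char_poly A))"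

text \<open>The image of the uniform distribution on the indices, that is, \<open>(1/N) \<Sum>\<^sub>i \<delta>(\<lambda>\<^sub>i)\<close>.\<close>

definition empirical_spectral_measure :: "real mat \<Rightarrow> real measure" where
  "empirical_spectral_measure A =
     distr (uniform_count_measure {..<dim_row A}) borel (\<lambda>i. eigenvalue_list A ! i)"

lemma integral_empirical_spectral_measure:
  assumes "f \<in> borel_measurable borel"
  shows "(\<integral>x. f x \<partial>empirical_spectral_measure A)
    = (\<Sum>i<dim_row A. f (eigenvalue_list A ! i)) / real (dim_row A)"
  using assms unfolding empirical_spectral_measure_def
  by (subst integral_distr)
     (auto simp: uniform_count_measure_def lebesgue_integral_point_measure_finite sum_divide_distrib)

definition L :: "(nat \<times> nat \<Rightarrow> real \<Rightarrow> 'a \<Rightarrow> real) \<Rightarrow> nat \<Rightarrow> real \<Rightarrow> 'a \<Rightarrow> real measure" where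
  "L XX N t \<omega> = empirical_spectral_measure (Y_mat XX N t \<omega>)"

definition bounded_continuous :: "(real \<Rightarrow> real) \<Rightarrow> bool" where
  "bounded_continuous f \<longleftrightarrow> continuous_on UNIV f \<and> bounded (range f)"

text \<open>The coarsest topology on the Borel probability measures (the elements of
  \<open>space (prob_algebra borel)\<close>) for which \<open>\<mu> \<mapsto> \<integral> f d\<mu>\<close> is continuous for all bounded continuous \<open>f\<close>.\<close>

definition weak_topology :: "real measure topology" where
  "weak_topology = topology_generated_by
     {{\<mu> \<in> space (prob_algebra borel). (\<integral>x. f x \<partial>\<mu>) \<in> U} | f U. bounded_continuous f \<and> open U}"

text \<open>Paths are taken to be \<open>undefined\<close> outside \<open>[0,T]\<close>.\<close>

definition measure_paths :: "real \<Rightarrow> (real \<Rightarrow> real measure) set" where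
  "measure_paths T =
     {\<mu> \<in> extensional {0..T}. continuous_map (top_of_set {0..T}) weak_topology \<mu>}"

text \<open>Uniform convergence on \<open>[0,T]\<close> refers to the uniformity of the weak topology, given by the
  pseudometrics \<open>(\<mu>, \<nu>) \<mapsto> \<bar>\<integral> f d\<mu> - \<integral> f d\<nu>\<bar>\<close> for bounded continuous \<open>f\<close>. As \<open>[0,T]\<close> is compact,
  any metric inducing the weak topology gives the same topology on continuous paths.\<close>

definition uniform_topology :: "real \<Rightarrow> (real \<Rightarrow> real measure) topology" where
  "uniform_topology T = topology_generated_by
     {{\<mu> \<in> measure_paths T. \<forall>t\<in>{0..T}. \<bar>(\<integral>x. f x \<partial>\<mu> t) - (\<integral>x. f x \<partial>\<nu> t)\<bar> < e} | f \<nu> e.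
        bounded_continuous f \<and> \<nu> \<in> measure_paths T \<and> e > 0}"

definition relatively_compact_in :: "'a topology \<Rightarrow> 'a set \<Rightarrow> bool" where
  "relatively_compact_in X S \<longleftrightarrow> S \<subseteq> topspace X \<and> compactin X (X closure_of S)"

end

theory Submission
  imports Defs "Jordan_Normal_Form.Schur_Decomposition"
begin

text \<open>If \<open>A\<close>, \<open>B\<close> are real symmetric with orthonormal eigenbases \<open>u\<close>, \<open>v\<close>, then \<open>p\<^sub>i\<^sub>j = (u\<^sub>i \<bullet> v\<^sub>j)\<^sup>2\<close> is
  doubly stochastic and \<open>\<Sum> p\<^sub>i\<^sub>j (a\<^sub>i - b\<^sub>j)\<^sup>2\<close> is the squared Frobenius distance. So the increments of
  \<open>\<integral> f dL\<^sub>N\<close>, for Lipschitz \<open>f\<close>, are controlled by the mean square of those of the entries. The law of large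
  numbers bounds this mean in \<open>N\<close> once a Hoelder seminorm of \<open>X\<close> has a fourth moment, and then \<open>L\<^sub>N\<close> is
  equicontinuous and tight.

  For the moment, let \<open>1/2 < \<beta> < H\<close> and let \<open>g\<close> be the \<open>\<beta>\<close>-Hoelder seminorm of \<open>B\<close>. Young's estimate bounds
  \<open>X\<close> at the cost of a constant factor per interval of length about \<open>g\<close> to the power \<open>-1/\<beta>\<close>. As \<open>1/\<beta> < 2\<close>, the
  result is below a multiple of \<open>exp (\<delta> g\<^sup>2)\<close> for every \<open>\<delta> > 0\<close>, which is integrable for small \<open>\<delta>\<close> because \<open>B\<close> is Gaussian.
  Only dyadic times enter these estimates.\<close>

section \<open>Spectral theorem for real symmetric matrices\<close>

text \<open>The copies \<open>XX\<close> share only their law with \<open>X\<close>; they need not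
  solve an equation. What is needed about them must therefore be a measurable functional on
  \<open>path_space\<close>, and a supremum over dyadic times is one, being countable. Path
  continuity then returns the estimate to all times. The fourth moment comes from the law of large
  numbers: a matrix of size N averages the squared seminorms of about N^2/2 independent entries, so
  once the squares have a second moment, the averages have variance of order 1/N^2, which is
  summable in N. Two obstacles shape the moment bound. The solution is only known to be Hoelder of a
  random order above 1 - H, possibly below 1/2, so its regularity must be raised to \<beta> before
  Young's estimate can be closed on itself. And closing it absorbs a multiple of the Hoelder
  constant of the solution, which is legitimate only because that constant is already known to be
  finite. The final bound retains only the size of the coefficients at \<open>X 0\<close>, which is
  independent of \<open>B\<close>, so that the expectation factors.\<close>

lemma real_symmetric_eigenvalue_exists:
  fixes A :: "real mat"
  assumes A: "A \<in> carrier_mat n n" and sym: "A\<^sup>T = A" and n: "n > 0"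
  shows "\<exists>e. eigenvalue A e"
proof -
  let ?C = "map_mat complex_of_real A"
  have C: "?C \<in> carrier_mat n n" using A by auto
  have "degree (char_poly ?C) = n" using degree_monic_char_poly[OF C] by auto
  then have "\<not> constant (poly (char_poly ?C))" using n by (simp add: constant_degree)
  \<comment> \<open>A root of the characteristic polynomial exists over the complex numbers, so
    \<open>v\<close> below is a complex vector. The Hermitian form of \<open>?C\<close> at
    \<open>v\<close> equals both \<open>z\<close> and its conjugate times the squared norm of
    \<open>v\<close>, since a real symmetric matrix can be moved across the form; hence
    \<open>z\<close> is real.\<close>
  then obtain z where z: "poly (char_poly ?C) z = 0"
    using fundamental_theorem_of_algebra by blast
  then have "eigenvalue ?C z" using eigenvalue_root_char_poly[OF C] by simp
  then obtain v where v: "v \<in> carrier_vec n" "v \<noteq> 0\<^sub>v n" "?C *\<^sub>v v = z \<cdot>\<^sub>v v"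
    unfolding eigenvalue_def eigenvector_def using C by auto
  have symi: "A $$ (i, j) = A $$ (j, i)" if "i < n" "j < n" for i j
    using sym that A by (metis carrier_matD index_transpose_mat(1))
  have "(?C *\<^sub>v v) \<bullet>c v = (\<Sum>i<n. (\<Sum>j<n. of_real (A $$ (i,j)) * v $ j) * cnj (v $ i))"
    using A v(1) by (auto simp: scalar_prod_def atLeast0LessThan intro!: sum.cong)
  also have "\<dots> = (\<Sum>i<n. \<Sum>j<n. of_real (A $$ (i,j)) * v $ j * cnj (v $ i))"
    by (simp add: sum_distrib_right)
  also have "\<dots> = (\<Sum>j<n. \<Sum>i<n. of_real (A $$ (i,j)) * v $ j * cnj (v $ i))"
    by (rule sum.swap)
  also have "\<dots> = (\<Sum>j<n. v $ j * cnj (\<Sum>i<n. of_real (A $$ (j,i)) * v $ i))"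
    by (auto simp: sum_distrib_left symi intro!: sum.cong)
  also have "\<dots> = v \<bullet>c (?C *\<^sub>v v)"
    using A v(1) by (auto simp: scalar_prod_def atLeast0LessThan intro!: sum.cong)
  finally have eq: "(z \<cdot>\<^sub>v v) \<bullet>c v = v \<bullet>c (z \<cdot>\<^sub>v v)" using v(3) by simp
  have "(z \<cdot>\<^sub>v v) \<bullet>c v = z * (v \<bullet>c v)" using v(1) by simp
  moreover have "v \<bullet>c (z \<cdot>\<^sub>v v) = cnj z * (v \<bullet>c v)"
    using v(1) by (simp add: conjugate_smult_vec)
  moreover have "v \<bullet>c v \<noteq> 0" using v(1,2) by (simp add: conjugate_square_eq_0_vec)
  ultimately have "cnj z = z" using eq by simp
  then obtain r where r: "z = of_real r" using Reals_cnj_iff Reals_cases by metis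
  have "char_poly ?C = map_poly of_real (char_poly A)" by (rule of_real_hom.char_poly_hom[OF A])
  then have "poly (char_poly A) r = 0" using z unfolding r by simp
  then show ?thesis using eigenvalue_root_char_poly[OF A] by auto
qed

text \<open>Gram-Schmidt applied to a basis that starts with \<open>v\<close> leaves its first
  vector unchanged, and the normalisation leaves it unchanged too because \<open>v\<close> is a unit
  vector.\<close>

lemma orthogonal_mat_with_first_col:
  fixes v :: "real vec"
  assumes v: "v \<in> carrier_vec n" "v \<bullet> v = 1" and n: "n > 0"
  shows "\<exists>W\<in>carrier_mat n n. W\<^sup>T * W = 1\<^sub>m n \<and> col W 0 = v"
proof -
  have v0: "v \<noteq> 0\<^sub>v n" using v by auto
  interpret cof_vec_space n "TYPE(real)" .
  define b where "b = basis_completion v"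
  define ws where "ws = gram_schmidt n b"
  from basis_completion[OF v(1) v0, folded b_def]
  have dist_b: "distinct b" and indep: "\<not> lin_dep (set b)" and b: "set b \<subseteq> carrier_vec n"
    and hdb: "hd b = v" and len_b: "length b = n" by auto
  from hdb len_b n obtain vs where bv: "b = v # vs" by (cases b) auto
  from gram_schmidt_result[OF b dist_b indep refl, folded ws_def]
  have ws: "set ws \<subseteq> carrier_vec n" "corthogonal ws" "length ws = n" by (auto simp: len_b)
  have "hd ws = v" unfolding ws_def using gram_schmidt_hd[OF v(1), of vs, folded bv] .
  then have ws0: "ws ! 0 = v" using ws(3) n by (cases ws) auto
  have wsc: "ws ! i \<in> carrier_vec n" if "i < n" for i using ws that by auto
  have orth: "(ws ! i \<bullet> ws ! j = 0) = (i \<noteq> j)" if "i < n" "j < n" for i j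
    using corthogonalD[OF ws(2)] that ws(3) by simp
  define s where "s i = 1 / sqrt (ws ! i \<bullet> ws ! i)" for i
  define W where "W = mat_of_cols n (map (\<lambda>i. s i \<cdot>\<^sub>v ws ! i) [0..<n])"
  have W: "W \<in> carrier_mat n n" unfolding W_def by (rule mat_of_cols_carrier(1)[of n "map _ [0..<n]", simplified])
  have colW: "col W i = s i \<cdot>\<^sub>v ws ! i" if "i < n" for i
    unfolding W_def using that wsc[OF that] by (subst col_mat_of_cols) auto
  have "W\<^sup>T * W = 1\<^sub>m n"
  proof (rule eq_matI)
    fix i j assume "i < dim_row (1\<^sub>m n :: real mat)" "j < dim_col (1\<^sub>m n :: real mat)"
    then have ij: "i < n" "j < n" by auto
    have "(W\<^sup>T * W) $$ (i, j) = col W i \<bullet> col W j" using ij W by simp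
    also have "\<dots> = s i * s j * (ws ! i \<bullet> ws ! j)"
      using ij wsc[of i] wsc[of j]
      by (simp add: colW carrier_vecD[of _ n])
    also have "\<dots> = (if i = j then 1 else 0)"
    proof (cases "i = j")
      case True
      have "ws ! i \<bullet> ws ! i \<ge> 0" by (simp add: scalar_prod_def sum_nonneg)
      moreover have "ws ! i \<bullet> ws ! i \<noteq> 0" using orth[of i i] ij by simp
      ultimately show ?thesis using True by (simp add: s_def)
    qed (use orth ij in auto)
    finally show "(W\<^sup>T * W) $$ (i, j) = 1\<^sub>m n $$ (i, j)" using ij by simp
  qed (use W in auto)
  moreover have "col W 0 = v" using colW[OF n] v by (simp add: ws0 s_def)
  ultimately show ?thesis using W by auto
qed

definition diag_of :: "real list \<Rightarrow> real mat" where
  "diag_of es = Matrix.mat (length es) (length es) (\<lambda>(i, j). if i = j then es ! i else 0)"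

lemma diag_of_carrier [simp]: "diag_of es \<in> carrier_mat (length es) (length es)"
  by (simp add: diag_of_def)

text \<open>Deflation: conjugation by an orthogonal matrix whose first column is a unit eigenvector
  clears the rest of the first column, and symmetry clears the first row. The remaining block is
  again symmetric, so the induction hypothesis applies to it.\<close>

theorem real_symmetric_diagonalization:
  fixes A :: "real mat"
  assumes "A \<in> carrier_mat n n" "A\<^sup>T = A"
  shows "\<exists>U es. U \<in> carrier_mat n n \<and> U\<^sup>T * U = 1\<^sub>m n \<and> length es = n \<and> A = U * diag_of es * U\<^sup>T"
  using assms
proof (induction n arbitrary: A)
  case 0
  then have "A = 1\<^sub>m 0 * diag_of [] * (1\<^sub>m 0)\<^sup>T" by (intro eq_matI) (auto simp: diag_of_def)
  then show ?case
    by (intro exI[of _ "1\<^sub>m 0"] exI[of _ "[]"]) (auto simp: diag_of_def)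
next
  case (Suc n)
  note A = Suc.prems(1)
  obtain e where "eigenvalue A e"
    using real_symmetric_eigenvalue_exists[OF Suc.prems] by auto
  then obtain v where v: "v \<in> carrier_vec (Suc n)" "v \<noteq> 0\<^sub>v (Suc n)" "A *\<^sub>v v = e \<cdot>\<^sub>v v"
    unfolding eigenvalue_def eigenvector_def using A by auto
  define w where "w = (1 / sqrt (v \<bullet> v)) \<cdot>\<^sub>v v"
  have vv: "v \<bullet> v > 0"
  proof -
    have "v \<bullet> v \<ge> 0" by (simp add: scalar_prod_def sum_nonneg)
    moreover have "v \<bullet> v \<noteq> 0" using v(1,2) conjugate_square_eq_0_vec[of v "Suc n"] by simp
    ultimately show ?thesis by simp
  qed
  have w: "w \<in> carrier_vec (Suc n)" "w \<bullet> w = 1" using v(1) vv by (auto simp: w_def)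
  have Aw: "A *\<^sub>v w = e \<cdot>\<^sub>v w"
    using v A unfolding w_def by (simp add: mult_mat_vec smult_smult_assoc mult.commute)
  obtain W where W: "W \<in> carrier_mat (Suc n) (Suc n)" "W\<^sup>T * W = 1\<^sub>m (Suc n)" "col W 0 = w"
    using orthogonal_mat_with_first_col[OF w] by auto
  have WW': "W * W\<^sup>T = 1\<^sub>m (Suc n)"
    using mat_mult_left_right_inverse[OF _ W(1) W(2)] W(1) by auto
  define A' where "A' = W\<^sup>T * A * W"
  have A': "A' \<in> carrier_mat (Suc n) (Suc n)" using A W(1) unfolding A'_def by auto
  have A'sym: "A'\<^sup>T = A'"
  proof -
    have "A'\<^sup>T = W\<^sup>T * (W\<^sup>T * A)\<^sup>T" unfolding A'_def
      using A W(1) by (subst transpose_mult[of _ "Suc n" "Suc n" _ "Suc n"]) auto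
    also have "(W\<^sup>T * A)\<^sup>T = A * W"
      using A W(1) Suc.prems(2) by (subst transpose_mult[of _ "Suc n" "Suc n" _ "Suc n"]) auto
    also have "W\<^sup>T * (A * W) = A'" unfolding A'_def
      using A W(1) by (subst assoc_mult_mat[of _ "Suc n" "Suc n" _ "Suc n" _ "Suc n"]) auto
    finally show ?thesis .
  qed
  \<comment> \<open>Since \<open>w\<close> is an eigenvector, column 0 of \<open>A'\<close> is
    \<open>e\<close> times column 0 of \<open>W\<^sup>T * W\<close>, which is the identity.\<close>
  have A'col: "A' $$ (i, 0) = (if i = 0 then e else 0)" if "i < Suc n" for i
  proof -
    have "A' = W\<^sup>T * (A * W)" unfolding A'_def
      using A W(1) by (subst assoc_mult_mat[of _ "Suc n" "Suc n" _ "Suc n" _ "Suc n"]) auto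
    then have "A' $$ (i, 0) = col W i \<bullet> col (A * W) 0" using that A W(1) by simp
    also have "col (A * W) 0 = A *\<^sub>v w"
    proof -
      have "col (A * W) 0 = A *\<^sub>v col W 0" by (rule col_mult2[OF A W(1)]) simp
      then show ?thesis using W(3) by simp
    qed
    also have "col W i \<bullet> (A *\<^sub>v w) = e * (col W i \<bullet> col W 0)"
      using W(1) w(1) that by (simp add: Aw W(3))
    also have "col W i \<bullet> col W 0 = (W\<^sup>T * W) $$ (i, 0)" using that W(1) by simp
    also have "e * \<dots> = (if i = 0 then e else 0)" using W(2) that by simp
    finally show ?thesis .
  qed
  have A'row: "A' $$ (0, i) = (if i = 0 then e else 0)" if "i < Suc n" for i
    using A'col[OF that] A'sym A' that by (metis carrier_matD index_transpose_mat(1) zero_less_Suc)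
  define A3 where "A3 = Matrix.mat n n (\<lambda>(i, j). A' $$ (Suc i, Suc j))"
  have A3: "A3 \<in> carrier_mat n n" by (simp add: A3_def)
  have "A3\<^sup>T = A3"
  proof (rule eq_matI)
    fix i j assume "i < dim_row A3" "j < dim_col A3"
    then have ij: "i < n" "j < n" using A3 by auto
    have "A' $$ (Suc j, Suc i) = A' $$ (Suc i, Suc j)"
      using A'sym A' ij by (metis Suc_mono carrier_matD index_transpose_mat(1))
    then show "A3\<^sup>T $$ (i, j) = A3 $$ (i, j)" using ij by (simp add: A3_def)
  qed (use A3 in auto)
  from Suc.IH[OF A3 this] obtain U es where U: "U \<in> carrier_mat n n" "U\<^sup>T * U = 1\<^sub>m n"
    "length es = n" "A3 = U * diag_of es * U\<^sup>T" by blast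
  define E where "E = Matrix.mat 1 1 (\<lambda>_. e)"
  have E: "E \<in> carrier_mat 1 1" by (simp add: E_def)
  have A'block: "A' = four_block_mat E (0\<^sub>m 1 n) (0\<^sub>m n 1) A3"
    using A' A'col A'row by (intro eq_matI) (auto simp: E_def A3_def)
  have Dblock: "diag_of (e # es) = four_block_mat E (0\<^sub>m 1 n) (0\<^sub>m n 1) (diag_of es)"
    using U(3) by (intro eq_matI) (auto simp: E_def diag_of_def nth_Cons')
  define V where "V = four_block_mat (1\<^sub>m 1) (0\<^sub>m 1 n) (0\<^sub>m n 1) U"
  have V: "V \<in> carrier_mat (Suc n) (Suc n)" using U(1) unfolding V_def by auto
  have VT: "V\<^sup>T = four_block_mat (1\<^sub>m 1) (0\<^sub>m 1 n) (0\<^sub>m n 1) U\<^sup>T"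
    unfolding V_def using U(1)
    by (subst transpose_four_block_mat[of _ 1 1 _ n _ n]) auto
  have D: "diag_of es \<in> carrier_mat n n" using U(3) by auto
  have "V\<^sup>T * V = four_block_mat (1\<^sub>m 1) (0\<^sub>m 1 n) (0\<^sub>m n 1) (1\<^sub>m n)"
    unfolding VT unfolding V_def using U(1)
    by (subst mult_four_block_mat[of _ 1 1 _ n _ n _ _ 1 _ n]) (auto simp: U(2))
  also have "\<dots> = 1\<^sub>m (Suc n)" by (intro eq_matI) auto
  finally have VV: "V\<^sup>T * V = 1\<^sub>m (Suc n)" .
  have "V * diag_of (e # es) = four_block_mat E (0\<^sub>m 1 n) (0\<^sub>m n 1) (U * diag_of es)"
    unfolding V_def Dblock using U(1) D E
    by (subst mult_four_block_mat[of _ 1 1 _ n _ n _ _ 1 _ n]) auto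
  also have "\<dots> * V\<^sup>T = A'"
    unfolding VT A'block using U(1) D E
    by (subst mult_four_block_mat[of _ 1 1 _ n _ n _ _ 1 _ n]) (auto simp: U(4))
  finally have VA: "V * diag_of (e # es) * V\<^sup>T = A'" .
  let ?D = "diag_of (e # es)"
  let ?m = "Suc n"
  have D': "?D \<in> carrier_mat ?m ?m" using U(3) diag_of_carrier[of "e # es"] by simp
  have "W * A' * W\<^sup>T = (W * W\<^sup>T) * A * (W * W\<^sup>T)"
  proof -
    have "W * A' = W * (W\<^sup>T * (A * W))" unfolding A'_def
      using A W(1) by (simp add: assoc_mult_mat[of _ ?m ?m _ ?m _ ?m])
    also have "\<dots> = (W * W\<^sup>T) * (A * W)"
      using A W(1) by (simp add: assoc_mult_mat[of _ ?m ?m _ ?m _ ?m])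
    finally have "W * A' * W\<^sup>T = ((W * W\<^sup>T) * (A * W)) * W\<^sup>T" by simp
    then show ?thesis using A W(1) by (simp add: assoc_mult_mat[of _ ?m ?m _ ?m _ ?m])
  qed
  then have AA: "A = W * A' * W\<^sup>T" using A WW' by simp
  have tr: "(W * V)\<^sup>T = V\<^sup>T * W\<^sup>T" by (rule transpose_mult[OF W(1) V])
  have 1: "(W * V)\<^sup>T * (W * V) = 1\<^sub>m ?m"
  proof -
    have "(W * V)\<^sup>T * (W * V) = V\<^sup>T * (W\<^sup>T * W * V)"
      unfolding tr using V W(1) by (simp add: assoc_mult_mat[of _ ?m ?m _ ?m _ ?m])
    then show ?thesis using V W VV by simp
  qed
  have 2: "A = (W * V) * ?D * (W * V)\<^sup>T"
    unfolding AA VA[symmetric] tr using V W(1) D'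
    by (simp add: assoc_mult_mat[of _ ?m ?m _ ?m _ ?m])
  show ?case
    using 1 2 W(1) V U(3) by (intro exI[of _ "W * V"] exI[of _ "e # es"]) auto
qed

section \<open>Spectral sums are Lipschitz in the Frobenius norm\<close>

definition frobenius_sq :: "real mat \<Rightarrow> real" where
  "frobenius_sq M = (\<Sum>i<dim_row M. \<Sum>j<dim_col M. (M $$ (i, j))\<^sup>2)"

lemma frobenius_sq_transpose: "frobenius_sq M\<^sup>T = frobenius_sq M"
  unfolding frobenius_sq_def by (simp add: sum.swap[of _ "{..<dim_col M}"])

text \<open>The squared Frobenius norm is the trace of \<open>M\<^sup>T * M\<close>, and there
  \<open>U\<^sup>T * U\<close> cancels.\<close>

lemma frobenius_sq_orthogonal_mult:
  assumes U: "U \<in> carrier_mat n n" "U\<^sup>T * U = 1\<^sub>m n" and M: "M \<in> carrier_mat n m"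
  shows "frobenius_sq (U * M) = frobenius_sq M"
proof -
  have diag: "frobenius_sq X = (\<Sum>j<m. (X\<^sup>T * X) $$ (j, j))" if "X \<in> carrier_mat n m" for X :: "real mat"
    using that unfolding frobenius_sq_def
    by (subst sum.swap) (auto simp: scalar_prod_def power2_eq_square atLeast0LessThan intro!: sum.cong)
  have "(U * M)\<^sup>T * (U * M) = M\<^sup>T * (U\<^sup>T * U * M)"
    using U(1) M by (simp add: transpose_mult[of _ n n _ m] assoc_mult_mat[of _ m n _ n _ m] assoc_mult_mat[of _ n n _ n _ m])
  then have "(U * M)\<^sup>T * (U * M) = M\<^sup>T * M" using U M by simp
  then show ?thesis using diag[OF M] diag[of "U * M"] U(1) M by simp
qed

lemma orthogonal_mat_transpose:
  assumes "U \<in> carrier_mat n n" "U\<^sup>T * U = (1\<^sub>m n :: real mat)"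
  shows "U * U\<^sup>T = 1\<^sub>m n"
  using mat_mult_left_right_inverse[OF _ assms(1) assms(2)] assms(1) by auto

text \<open>The right factor is brought to the left by transposition, which does not change the
  norm.\<close>

lemma frobenius_sq_orthogonal_conj:
  assumes U: "U \<in> carrier_mat n n" "U\<^sup>T * U = 1\<^sub>m n"
    and V: "V \<in> carrier_mat n n" "V\<^sup>T * V = 1\<^sub>m n" and M: "M \<in> carrier_mat n n"
  shows "frobenius_sq (U\<^sup>T * M * V) = frobenius_sq M"
proof -
  have "frobenius_sq (U\<^sup>T * M * V) = frobenius_sq (V\<^sup>T * (U\<^sup>T * M)\<^sup>T)"
    using U(1) V(1) M by (subst frobenius_sq_transpose[symmetric]) (simp add: transpose_mult[of _ n n _ n])
  also have "\<dots> = frobenius_sq ((U\<^sup>T * M)\<^sup>T)"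
    using U(1) M V orthogonal_mat_transpose[OF V] by (intro frobenius_sq_orthogonal_mult) auto
  also have "\<dots> = frobenius_sq (U\<^sup>T * M)" by (rule frobenius_sq_transpose)
  also have "\<dots> = frobenius_sq M"
    using U(1) M orthogonal_mat_transpose[OF U] by (intro frobenius_sq_orthogonal_mult) auto
  finally show ?thesis .
qed

lemma orthogonal_mat_row_sq_sum:
  assumes P: "P \<in> carrier_mat n n" "P\<^sup>T * P = 1\<^sub>m n" and j: "j < n"
  shows "(\<Sum>i<n. (P $$ (i, j))\<^sup>2) = (1 :: real)"
proof -
  have "(P\<^sup>T * P) $$ (j, j) = (\<Sum>i<n. (P $$ (i, j))\<^sup>2)"
    using P(1) j by (auto simp: scalar_prod_def power2_eq_square atLeast0LessThan intro!: sum.cong)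
  then show ?thesis using P(2) j by simp
qed

text \<open>The weights \<open>p i j\<close> couple the two spectra, so both sums become double sums
  against the same weights and neither list has to be sorted. Cauchy-Schwarz with these weights, of
  total mass \<open>n\<close>, produces the factor \<open>sqrt n\<close> and leaves the root of the
  weighted squares.\<close>

lemma spectral_sum_diff_le:
  fixes A B :: "real mat"
  assumes A: "A = U * diag_of as * U\<^sup>T" "U \<in> carrier_mat n n" "U\<^sup>T * U = 1\<^sub>m n" "length as = n"
    and B: "B = V * diag_of bs * V\<^sup>T" "V \<in> carrier_mat n n" "V\<^sup>T * V = 1\<^sub>m n" "length bs = n"
    and f: "\<And>x y. \<bar>f x - f y\<bar> \<le> l * \<bar>x - y\<bar>" and l: "l \<ge> 0"
  shows "\<bar>(\<Sum>i<n. f (as ! i)) - (\<Sum>i<n. f (bs ! i))\<bar> \<le> l * sqrt n * sqrt (frobenius_sq (A - B))"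
proof -
  define P where "P = U\<^sup>T * V"
  have Pc: "P \<in> carrier_mat n n" using A B by (auto simp: P_def)
  have Da: "diag_of as \<in> carrier_mat n n" and Db: "diag_of bs \<in> carrier_mat n n"
    using A(4) B(4) diag_of_carrier by metis+
  note assoc = assoc_mult_mat[of _ n n _ n _ n]
  have "P\<^sup>T * P = V\<^sup>T * ((U * U\<^sup>T) * V)"
    unfolding P_def using A(2) B(2) by (simp add: transpose_mult[of _ n n _ n] assoc)
  then have P1: "P\<^sup>T * P = 1\<^sub>m n" using orthogonal_mat_transpose[OF A(2,3)] B by simp
  have P2: "P * P\<^sup>T = 1\<^sub>m n" by (rule orthogonal_mat_transpose[OF Pc P1])
  define p where "p i j = (P $$ (i, j))\<^sup>2" for i j
  have col1: "(\<Sum>i<n. p i j) = 1" if "j < n" for j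
    using orthogonal_mat_row_sq_sum[OF Pc P1 that] by (simp add: p_def)
  have row1: "(\<Sum>j<n. p i j) = 1" if "i < n" for i
    using orthogonal_mat_row_sq_sum[of "P\<^sup>T" n i] Pc P2 that by (simp add: p_def)
  have UA: "U\<^sup>T * A = diag_of as * U\<^sup>T"
  proof -
    have "U\<^sup>T * A = (U\<^sup>T * U) * (diag_of as * U\<^sup>T)"
      unfolding A(1) using A(2) Da by (simp add: assoc)
    then show ?thesis using A(2,3) Da by simp
  qed
  have BV: "B * V = V * diag_of bs"
  proof -
    have "B * V = V * diag_of bs * (V\<^sup>T * V)"
      unfolding B(1) using B(2) Db by (simp add: assoc)
    then show ?thesis using B(2,3) Db by simp
  qed
  have Ac: "A \<in> carrier_mat n n" and Bc: "B \<in> carrier_mat n n"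
    unfolding A(1) B(1) using A(2) B(2) Da Db by auto
  have "U\<^sup>T * (A - B) * V = U\<^sup>T * A * V - U\<^sup>T * B * V"
    using A(2) B(2) Ac Bc by (simp add: mult_minus_distrib_mat[of _ n n _ n] minus_mult_distrib_mat[of _ n n _ _ n])
  also have "U\<^sup>T * A * V = diag_of as * P"
    unfolding UA P_def using A(2) B(2) Da by (simp add: assoc)
  also have "U\<^sup>T * B * V = P * diag_of bs"
  proof -
    have "U\<^sup>T * B * V = U\<^sup>T * (B * V)" using A(2) B(2) Bc by (simp add: assoc)
    then show ?thesis unfolding BV P_def using A(2) B(2) Db by (simp add: assoc)
  qed
  \<comment> \<open>In the two eigenbases the difference of the matrices takes this form, so each of
    its entries is an eigenvalue difference times an overlap, while the orthogonal conjugation keeps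
    the norm.\<close>
  finally have conj: "U\<^sup>T * (A - B) * V = diag_of as * P - P * diag_of bs" .
  have entry: "(diag_of as * P - P * diag_of bs) $$ (i, j) = (as ! i - bs ! j) * P $$ (i, j)"
    if "i < n" "j < n" for i j
  proof -
    have "(diag_of as * P) $$ (i, j) = (\<Sum>k<n. (if i = k then as ! i else 0) * P $$ (k, j))"
      using that Pc Da A(4) by (auto simp: scalar_prod_def diag_of_def atLeast0LessThan intro!: sum.cong)
    also have "\<dots> = as ! i * P $$ (i, j)"
      using that by (simp add: if_distrib[of "\<lambda>x. x * _"] cong: if_cong)
    finally have 1: "(diag_of as * P) $$ (i, j) = as ! i * P $$ (i, j)" .
    have "(P * diag_of bs) $$ (i, j) = (\<Sum>k<n. P $$ (i, k) * (if k = j then bs ! j else 0))"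
      using that Pc Db B(4) by (auto simp: scalar_prod_def diag_of_def atLeast0LessThan intro!: sum.cong)
    also have "\<dots> = P $$ (i, j) * bs ! j"
      using that by (simp add: if_distrib[of "\<lambda>x. _ * x"] cong: if_cong)
    finally have 2: "(P * diag_of bs) $$ (i, j) = P $$ (i, j) * bs ! j" .
    show ?thesis using 1 2 that Pc Da Db A(4) B(4) by (simp add: algebra_simps)
  qed
  have "frobenius_sq (A - B) = frobenius_sq (diag_of as * P - P * diag_of bs)"
    using frobenius_sq_orthogonal_conj[OF A(2,3) B(2,3) minus_carrier_mat[OF Bc, of A]] conj by simp
  also have "\<dots> = (\<Sum>i<n. \<Sum>j<n. ((diag_of as * P - P * diag_of bs) $$ (i, j))\<^sup>2)"
    unfolding frobenius_sq_def using Pc Da Db by simp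
  also have "\<dots> = (\<Sum>i<n. \<Sum>j<n. p i j * (as ! i - bs ! j)\<^sup>2)"
    by (intro sum.cong refl) (simp add: entry p_def power_mult_distrib)
  finally have frob: "frobenius_sq (A - B) = (\<Sum>i<n. \<Sum>j<n. p i j * (as ! i - bs ! j)\<^sup>2)" .
  have fa: "(\<Sum>i<n. f (as ! i)) = (\<Sum>i<n. \<Sum>j<n. p i j * f (as ! i))"
    by (simp add: sum_distrib_right[symmetric] row1)
  have fb: "(\<Sum>j<n. f (bs ! j)) = (\<Sum>i<n. \<Sum>j<n. p i j * f (bs ! j))"
    by (subst sum.swap) (simp add: sum_distrib_right[symmetric] col1)
  have p0: "p i j \<ge> 0" for i j by (simp add: p_def)
  have total: "(\<Sum>i<n. \<Sum>j<n. p i j) = n" using row1 by simp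
  have "\<bar>(\<Sum>i<n. f (as ! i)) - (\<Sum>i<n. f (bs ! i))\<bar>
      = \<bar>\<Sum>i<n. \<Sum>j<n. p i j * (f (as ! i) - f (bs ! j))\<bar>"
    unfolding fa fb by (simp add: sum_subtractf[symmetric] right_diff_distrib)
  also have "\<dots> \<le> (\<Sum>i<n. \<Sum>j<n. p i j * (l * \<bar>as ! i - bs ! j\<bar>))"
    by (intro order_trans[OF sum_abs] sum_mono) (simp add: abs_mult p0 mult_left_mono f)
  also have "\<dots> = l * (\<Sum>i<n. \<Sum>j<n. p i j * \<bar>as ! i - bs ! j\<bar>)"
    by (simp add: sum_distrib_left mult_ac)
  \<comment> \<open>Each weight is split into two square roots, one for each factor in
    Cauchy-Schwarz.\<close>
  also have "(\<Sum>i<n. \<Sum>j<n. p i j * \<bar>as ! i - bs ! j\<bar>)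
      = (\<Sum>k\<in>{..<n} \<times> {..<n}. sqrt (p (fst k) (snd k)) * (sqrt (p (fst k) (snd k)) * \<bar>as ! fst k - bs ! snd k\<bar>))"
    by (simp add: sum.cartesian_product case_prod_beta mult.assoc[symmetric] p0)
  also have "\<dots> \<le> L2_set (\<lambda>k. sqrt (p (fst k) (snd k))) ({..<n} \<times> {..<n})
      * L2_set (\<lambda>k. sqrt (p (fst k) (snd k)) * \<bar>as ! fst k - bs ! snd k\<bar>) ({..<n} \<times> {..<n})"
    by (rule order_trans[OF _ L2_set_mult_ineq]) (auto intro!: sum_mono simp: p0)
  also have "L2_set (\<lambda>k. sqrt (p (fst k) (snd k))) ({..<n} \<times> {..<n}) = sqrt n"
    using total by (simp add: L2_set_def p0 sum.cartesian_product case_prod_beta)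
  also have "L2_set (\<lambda>k. sqrt (p (fst k) (snd k)) * \<bar>as ! fst k - bs ! snd k\<bar>) ({..<n} \<times> {..<n})
      = sqrt (frobenius_sq (A - B))"
    unfolding frob by (simp add: L2_set_def p0 sum.cartesian_product case_prod_beta power_mult_distrib)
  finally show ?thesis using l by (simp add: mult_left_mono mult.assoc)
qed

section \<open>Sorted eigenvalue lists from orthogonal diagonalizations\<close>

lemma proots_prod_list_linear: "proots (\<Prod>e\<leftarrow>es. [:- e, 1:] :: real poly) = mset es"
proof (induction es)
  case (Cons e es)
  have "(\<Prod>e\<leftarrow>es. [:- e, 1:] :: real poly) \<noteq> 0" by (auto simp: prod_list_zero_iff)
  then have "proots ([:- e, 1:] * (\<Prod>e\<leftarrow>es. [:- e, 1:])) = add_mset e (mset es)"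
    using Cons by (subst proots_mult) auto
  then show ?case by simp
qed simp

lemma char_poly_orthogonal_diag:
  assumes A: "A = U * diag_of es * U\<^sup>T" "U \<in> carrier_mat n n" "U\<^sup>T * U = 1\<^sub>m n" "length es = n"
  shows "char_poly A = (\<Prod>e\<leftarrow>es. [:- e, 1:])"
proof -
  have D: "diag_of es \<in> carrier_mat n n" using A(4) diag_of_carrier by metis
  have "similar_mat A (diag_of es)"
    unfolding similar_mat_def
    using A D orthogonal_mat_transpose[OF A(2,3)]
    by (intro exI[of _ U] exI[of _ "U\<^sup>T"] similar_mat_witI[of _ _ n]) auto
  then have "char_poly A = char_poly (diag_of es)" by (rule char_poly_similar)
  also have "\<dots> = (\<Prod>e\<leftarrow>diag_mat (diag_of es). [:- e, 1:])"
    by (rule char_poly_upper_triangular[OF D]) (auto simp: diag_of_def)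
  also have "diag_mat (diag_of es) = es"
    by (intro nth_equalityI) (auto simp: diag_mat_def diag_of_def)
  finally show ?thesis .
qed

lemma eigenvalue_list_orthogonal_diag:
  assumes "A = U * diag_of es * U\<^sup>T" "U \<in> carrier_mat n n" "U\<^sup>T * U = 1\<^sub>m n" "length es = n"
  shows "eigenvalue_list A = sort es"
  unfolding eigenvalue_list_def char_poly_orthogonal_diag[OF assms] proots_prod_list_linear
  by simp

lemma sum_nth_sort:
  fixes f :: "real \<Rightarrow> real"
  shows "(\<Sum>i<length es. f (sort es ! i)) = (\<Sum>i<length es. f (es ! i))"
proof -
  have *: "(\<Sum>i<length xs. f (xs ! i)) = sum_mset (image_mset f (mset xs))" for xs :: "real list"
    by (simp add: sum_list_sum_nth atLeast0LessThan sum_mset_sum_list flip: mset_map)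
  show ?thesis using *[of es] *[of "sort es"] by simp
qed

text \<open>A sum over the sorted list does not see the order, so the diagonal entries in any
  eigenbases may stand in for the roots of the characteristic polynomials.\<close>

theorem eigenvalue_list_lipschitz_sum:
  fixes A B :: "real mat"
  assumes A: "A \<in> carrier_mat n n" "A\<^sup>T = A" and B: "B \<in> carrier_mat n n" "B\<^sup>T = B"
    and f: "\<And>x y. \<bar>f x - f y\<bar> \<le> l * \<bar>x - y\<bar>" and l: "l \<ge> 0"
  shows "\<bar>(\<Sum>i<n. f (eigenvalue_list A ! i)) - (\<Sum>i<n. f (eigenvalue_list B ! i))\<bar>
     \<le> l * sqrt n * sqrt (frobenius_sq (A - B))"
proof -
  obtain U as where U: "U \<in> carrier_mat n n" "U\<^sup>T * U = 1\<^sub>m n" "length as = n" "A = U * diag_of as * U\<^sup>T"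
    using real_symmetric_diagonalization[OF A] by blast
  obtain V bs where V: "V \<in> carrier_mat n n" "V\<^sup>T * V = 1\<^sub>m n" "length bs = n" "B = V * diag_of bs * V\<^sup>T"
    using real_symmetric_diagonalization[OF B] by blast
  show ?thesis
    using spectral_sum_diff_le[OF U(4,1,2,3) V(4,1,2,3) f l] sum_nth_sort[of f as] sum_nth_sort[of f bs]
      eigenvalue_list_orthogonal_diag[OF U(4,1,2,3)] eigenvalue_list_orthogonal_diag[OF V(4,1,2,3)]
      U(3) V(3) by simp
qed

section \<open>Weak convergence through bounded Lipschitz functions\<close>

abbreviation mean :: "real measure \<Rightarrow> (real \<Rightarrow> real) \<Rightarrow> real" where
  "mean \<mu> f \<equiv> \<integral>x. f x \<partial>\<mu>"

text \<open>The test functions of the bounded Lipschitz metric. This class determines weak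
  convergence, and the spectral estimate is uniform over it because only the Lipschitz constant
  enters there.\<close>

definition BL1 :: "(real \<Rightarrow> real) set" where
  "BL1 = {f. (\<forall>x. \<bar>f x\<bar> \<le> 1) \<and> (\<forall>x y. \<bar>f x - f y\<bar> \<le> \<bar>x - y\<bar>)}"

lemma BL1_bound: "f \<in> BL1 \<Longrightarrow> \<bar>f x\<bar> \<le> 1"
  and BL1_lipschitz: "f \<in> BL1 \<Longrightarrow> \<bar>f x - f y\<bar> \<le> \<bar>x - y\<bar>"
  by (auto simp: BL1_def)

lemma BL1_continuous: "f \<in> BL1 \<Longrightarrow> continuous_on UNIV f"
  unfolding continuous_on_iff
  by (metis BL1_lipschitz dist_real_def order_le_less_trans)

lemma BL1_measurable: "f \<in> BL1 \<Longrightarrow> f \<in> borel_measurable borel"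
  by (intro borel_measurable_continuous_onI BL1_continuous)

lemma zero_in_BL1: "(\<lambda>_. 0) \<in> BL1" by (simp add: BL1_def)

lemma prob_algebra_borel_iff:
  "\<mu> \<in> space (prob_algebra borel) \<longleftrightarrow> real_distribution (\<mu> :: real measure)"
  by (auto simp: space_prob_algebra real_distribution_def real_distribution_axioms_def)

lemma BL1_integral_bound:
  assumes "real_distribution \<mu>" "f \<in> BL1"
  shows "\<bar>mean \<mu> f\<bar> \<le> 1"
proof -
  interpret real_distribution \<mu> by fact
  have [measurable]: "f \<in> borel_measurable borel" by (rule BL1_measurable) fact
  have i: "integrable \<mu> f"
    by (rule integrable_const_bound[of _ 1]) (auto simp: BL1_bound[OF assms(2)])
  have "\<bar>mean \<mu> f\<bar> \<le> (\<integral>x. \<bar>f x\<bar> \<partial>\<mu>)" by (rule integral_abs_bound)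
  also have "\<dots> \<le> (\<integral>x. 1 \<partial>\<mu>)"
    by (intro integral_mono) (use i BL1_bound[OF assms(2)] in auto)
  also have "\<dots> = 1" using prob_space by simp
  finally show ?thesis .
qed

text \<open>Weak convergence of laws on the line is already decided by the ramps
  \<open>cts_step a b\<close>, and a small multiple of each ramp lies in \<open>BL1\<close>.\<close>

lemma BL1_conv_imp_weak_conv:
  assumes \<mu>n: "\<And>n. real_distribution (\<mu>n n)" and \<mu>: "real_distribution \<mu>"
    and conv: "\<And>f. f \<in> BL1 \<Longrightarrow> (\<lambda>n. mean (\<mu>n n) f) \<longlonglongrightarrow> mean \<mu> f"
  shows "weak_conv_m \<mu>n \<mu>"
proof (rule integral_cts_step_conv_imp_weak_conv[OF \<mu>n \<mu>])
  fix a b :: real assume ab: "a < b"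
  \<comment> \<open>The slope of the ramp has size \<open>1 / (b - a)\<close>; the minimum with
    \<open>1\<close> keeps the scaled ramp bounded by \<open>1\<close>.\<close>
  define c where "c = min 1 (b - a)"
  have c: "c > 0" "c \<le> 1" "c \<le> b - a" using ab by (auto simp: c_def)
  have lip: "\<bar>cts_step a b x - cts_step a b y\<bar> \<le> \<bar>x - y\<bar> / (b - a)" for x y
    using ab by (auto simp: cts_step_def divide_simps)
  have "(\<lambda>x. c * cts_step a b x) \<in> BL1"
    unfolding BL1_def
  proof (intro CollectI conjI allI)
    fix x y
    have "\<bar>cts_step a b x\<bar> \<le> 1" using ab by (auto simp: cts_step_def)
    then show "\<bar>c * cts_step a b x\<bar> \<le> 1" using c by (simp add: abs_mult mult_le_one)
    have "\<bar>c * cts_step a b x - c * cts_step a b y\<bar> = c * \<bar>cts_step a b x - cts_step a b y\<bar>"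
      using c by (simp add: abs_mult right_diff_distrib[symmetric])
    also have "\<dots> \<le> c * (\<bar>x - y\<bar> / (b - a))" using lip c by (intro mult_left_mono) auto
    also have "\<dots> \<le> (b - a) * (\<bar>x - y\<bar> / (b - a))" using c ab by (intro mult_right_mono) auto
    also have "\<dots> = \<bar>x - y\<bar>" using ab by simp
    finally show "\<bar>c * cts_step a b x - c * cts_step a b y\<bar> \<le> \<bar>x - y\<bar>" .
  qed
  from conv[OF this] have "(\<lambda>n. c * (\<integral>x. cts_step a b x \<partial>\<mu>n n)) \<longlonglongrightarrow> c * (\<integral>x. cts_step a b x \<partial>\<mu>)" by simp
  from tendsto_mult_left[OF this, of "1 / c"] c(1)
  show "(\<lambda>n. \<integral>x. cts_step a b x \<partial>\<mu>n n) \<longlonglongrightarrow> (\<integral>x. cts_step a b x \<partial>\<mu>)" by simp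
qed

lemma weak_conv_imp_bounded_continuous_conv:
  assumes "\<And>n. real_distribution (\<mu>n n)" "real_distribution \<mu>" "weak_conv_m \<mu>n \<mu>" "bounded_continuous f"
  shows "(\<lambda>n. mean (\<mu>n n) f) \<longlonglongrightarrow> mean \<mu> f"
proof -
  obtain K where "\<And>x. norm (f x) \<le> K"
    using assms(4) unfolding bounded_continuous_def bounded_iff by auto
  moreover have "isCont f x" for x
    using assms(4) by (simp add: bounded_continuous_def continuous_on_eq_continuous_at)
  ultimately show ?thesis
    using weak_conv_imp_integral_bdd_continuous_conv[OF assms(1-3)] by blast
qed

lemma BL1_bounded_continuous: "f \<in> BL1 \<Longrightarrow> bounded_continuous f"
  unfolding bounded_continuous_def bounded_iff using BL1_continuous BL1_bound by fastforce

text \<open>In a Skorohod representation the variables converge pointwise, and every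
  \<open>f\<close> in \<open>BL1\<close> changes by at most the distance of the two values, cut off
  at \<open>2\<close>. This majorant does not depend on \<open>f\<close>, so dominated convergence
  gives uniformity over the class.\<close>

lemma weak_conv_imp_BL1_uniform_conv:
  assumes \<mu>n: "\<And>n. real_distribution (\<mu>n n)" and \<mu>: "real_distribution \<mu>" and w: "weak_conv_m \<mu>n \<mu>"
    and e: "e > 0"
  shows "\<forall>\<^sub>F n in sequentially. \<forall>f\<in>BL1. \<bar>mean (\<mu>n n) f - mean \<mu> f\<bar> < e"
proof -
  obtain \<Omega> :: "real measure" and Yn Y where ps: "prob_space \<Omega>"
    and Yn[measurable]: "\<And>n. Yn n \<in> borel_measurable \<Omega>"
    and dn: "\<And>n. distr \<Omega> borel (Yn n) = \<mu>n n"
    and Y[measurable]: "Y \<in> borel_measurable \<Omega>"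
    and d: "distr \<Omega> borel Y = \<mu>"
    and lim: "\<And>x. x \<in> space \<Omega> \<Longrightarrow> (\<lambda>n. Yn n x) \<longlonglongrightarrow> Y x"
    using Skorohod[OF \<mu>n \<mu> w] by force
  interpret prob_space \<Omega> by fact
  define D where "D n = (\<integral>\<omega>. min \<bar>Yn n \<omega> - Y \<omega>\<bar> 2 \<partial>\<Omega>)" for n
  have "D \<longlonglongrightarrow> (\<integral>\<omega>. 0 \<partial>\<Omega>)" unfolding D_def
  proof (rule integral_dominated_convergence[where w="\<lambda>_. 2"])
    show "AE \<omega> in \<Omega>. (\<lambda>n. min \<bar>Yn n \<omega> - Y \<omega>\<bar> 2) \<longlonglongrightarrow> 0"
    proof (rule AE_I2)
      fix \<omega> assume "\<omega> \<in> space \<Omega>"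
      from lim[OF this] have "(\<lambda>n. \<bar>Yn n \<omega> - Y \<omega>\<bar>) \<longlonglongrightarrow> 0"
        using LIM_zero tendsto_rabs_zero by fastforce
      from tendsto_min[OF this tendsto_const[of 2]] show "(\<lambda>n. min \<bar>Yn n \<omega> - Y \<omega>\<bar> 2) \<longlonglongrightarrow> 0" by simp
    qed
  qed auto
  then have "D \<longlonglongrightarrow> 0" by simp
  moreover have "\<bar>mean (\<mu>n n) f - mean \<mu> f\<bar> \<le> D n" if f: "f \<in> BL1" for f n
  proof -
    have [measurable]: "f \<in> borel_measurable borel" by (rule BL1_measurable) fact
    have i: "integrable \<Omega> (\<lambda>\<omega>. f (Z \<omega>))" if [measurable]: "Z \<in> borel_measurable \<Omega>" for Z
      by (rule integrable_const_bound[of _ 1]) (auto simp: BL1_bound[OF f])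
    have "mean (\<mu>n n) f - mean \<mu> f = (\<integral>\<omega>. f (Yn n \<omega>) - f (Y \<omega>) \<partial>\<Omega>)"
      unfolding dn[symmetric] d[symmetric] by (simp add: integral_distr i)
    also have "\<bar>\<dots>\<bar> \<le> (\<integral>\<omega>. \<bar>f (Yn n \<omega>) - f (Y \<omega>)\<bar> \<partial>\<Omega>)" by (rule integral_abs_bound)
    also have "\<dots> \<le> D n" unfolding D_def
    proof (rule integral_mono)
      show "integrable \<Omega> (\<lambda>\<omega>. min \<bar>Yn n \<omega> - Y \<omega>\<bar> 2)"
        by (rule integrable_const_bound[of _ 2]) auto
      fix \<omega>
      show "\<bar>f (Yn n \<omega>) - f (Y \<omega>)\<bar> \<le> min \<bar>Yn n \<omega> - Y \<omega>\<bar> 2"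
        using BL1_lipschitz[OF f, of "Yn n \<omega>" "Y \<omega>"] BL1_bound[OF f, of "Yn n \<omega>"] BL1_bound[OF f, of "Y \<omega>"]
        by linarith
    qed (use i in auto)
    finally show ?thesis .
  qed
  ultimately show ?thesis using e
    by (auto dest!: order_tendstoD(2)[of D 0 _ e] elim!: eventually_mono intro: order_le_less_trans)
qed

text \<open>The constant sequence \<mu> converges weakly to \<nu>, so the ramps have equal
  integrals. The integral of a ramp from \<open>x\<close> to \<open>y\<close> lies between the
  values of the distribution function at \<open>x\<close> and at \<open>y\<close>, so one
  distribution function at \<open>x\<close> is at most the other at any \<open>y > x\<close>; right
  continuity closes the gap.\<close>

lemma real_distribution_eqI_BL1:
  assumes \<mu>: "real_distribution \<mu>" and \<nu>: "real_distribution \<nu>"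
    and eq: "\<And>f. f \<in> BL1 \<Longrightarrow> mean \<mu> f = mean \<nu> f"
  shows "\<mu> = \<nu>"
proof -
  have w: "weak_conv_m (\<lambda>_. \<mu>) \<nu>"
    by (rule BL1_conv_imp_weak_conv[OF \<mu> \<nu>]) (simp add: eq)
  have st: "(\<integral>x. cts_step a b x \<partial>\<mu>) = (\<integral>x. cts_step a b x \<partial>\<nu>)" if "a < b" for a b
  proof -
    have "continuous_on UNIV (cts_step a b)"
      using cts_step_uniformly_continuous[OF that] uniformly_continuous_imp_continuous by blast
    moreover have "bounded (range (cts_step a b))"
      unfolding bounded_iff using that by (intro exI[of _ 1]) (auto simp: cts_step_def)
    ultimately have "bounded_continuous (cts_step a b)" by (simp add: bounded_continuous_def)
    from weak_conv_imp_bounded_continuous_conv[OF \<mu> \<nu> w this] show ?thesis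
      using LIMSEQ_unique tendsto_const by blast
  qed
  have le: "cdf M x \<le> cdf N x" if M: "real_distribution M" and N: "real_distribution N"
    and st: "\<And>a b. a < b \<Longrightarrow> (\<integral>x. cts_step a b x \<partial>M) = (\<integral>x. cts_step a b x \<partial>N)" for M N x
  proof -
    interpret M: real_distribution M by fact
    interpret N: real_distribution N by fact
    have "cdf M x \<le> cdf N y" if "x < y" for y
      using M.cdf_cts_step(1)[OF that] N.cdf_cts_step(2)[OF that] st[OF that] by simp
    then have "\<forall>\<^sub>F y in at_right x. cdf M x \<le> cdf N y" by (simp add: eventually_at_filter)
    moreover have "(cdf N \<longlongrightarrow> cdf N x) (at_right x)"
      using N.cdf_is_right_cont[of x] by (simp add: continuous_within)
    ultimately show ?thesis by (intro tendsto_lowerbound) auto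
  qed
  have "cdf \<mu> = cdf \<nu>"
    using le[OF \<mu> \<nu>] le[OF \<nu> \<mu>] st by (intro ext antisym) auto
  then show ?thesis
    using \<mu> \<nu> by (intro cdf_unique) auto
qed

section \<open>The uniform topology on paths of measures\<close>

lemma topspace_weak_topology: "topspace weak_topology = space (prob_algebra borel)"
proof -
  have "bounded_continuous (\<lambda>_. 0)" by (simp add: bounded_continuous_def)
  then show ?thesis
    unfolding weak_topology_def topology_generated_by_topspace
    by (auto intro!: exI[of _ UNIV] exI[of _ "space (prob_algebra borel)"] exI[of _ "\<lambda>_. 0"])
qed

text \<open>A map into an initial topology is continuous exactly when its composites with the
  generating functionals are, which reduces paths of measures to families of real functions.\<close>

lemma measure_paths_iff:
  "\<mu> \<in> measure_paths T \<longleftrightarrow> \<mu> \<in> extensional {0..T} \<and> (\<forall>t\<in>{0..T}. real_distribution (\<mu> t)) \<and>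
     (\<forall>f. bounded_continuous f \<longrightarrow> continuous_on {0..T} (\<lambda>t. mean (\<mu> t) f))"
proof -
  have "continuous_map (top_of_set {0..T}) weak_topology \<mu> \<longleftrightarrow>
     (\<forall>t\<in>{0..T}. real_distribution (\<mu> t)) \<and>
     (\<forall>f. bounded_continuous f \<longrightarrow> continuous_on {0..T} (\<lambda>t. mean (\<mu> t) f))" (is "?l \<longleftrightarrow> ?p \<and> ?r")
  proof (intro iffI conjI)
    assume ?l
    then show p: ?p
      using continuous_map_image_subset_topspace[of "top_of_set {0..T}" weak_topology \<mu>]
      by (auto simp: topspace_weak_topology prob_algebra_borel_iff[symmetric])
    show ?r
    proof (intro allI impI)
      fix f assume f: "bounded_continuous f"
      have "openin (top_of_set {0..T}) ({0..T} \<inter> (\<lambda>t. mean (\<mu> t) f) -` U)" if U: "open U" for U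
      proof -
        have "openin weak_topology {\<mu> \<in> space (prob_algebra borel). mean \<mu> f \<in> U}"
          unfolding weak_topology_def by (rule topology_generated_by_Basis) (use f U in auto)
        from openin_continuous_map_preimage[OF \<open>?l\<close> this]
        show ?thesis
          using p by (simp add: Int_def vimage_def prob_algebra_borel_iff conj_commute cong: conj_cong)
      qed
      then show "continuous_on {0..T} (\<lambda>t. mean (\<mu> t) f)"
        by (simp add: continuous_on_open_gen[of _ _ UNIV] continuous_openin_preimage_eq)
    qed
  next
    assume pr: "?p \<and> ?r"
    show ?l unfolding weak_topology_def
    proof (rule continuous_on_generated_topo)
      fix V assume "V \<in> {{\<mu> \<in> space (prob_algebra borel). mean \<mu> f \<in> U} | f U. bounded_continuous f \<and> open U}"
      then obtain f U where f: "bounded_continuous f" "open U"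
        and V: "V = {\<mu> \<in> space (prob_algebra borel). mean \<mu> f \<in> U}" by auto
      have "openin (top_of_set {0..T}) ({0..T} \<inter> (\<lambda>t. mean (\<mu> t) f) -` U)"
        using pr f by (intro continuous_openin_preimage_gen) auto
      also have "{0..T} \<inter> (\<lambda>t. mean (\<mu> t) f) -` U = \<mu> -` V \<inter> topspace (top_of_set {0..T})"
        using pr unfolding V by (auto simp: prob_algebra_borel_iff)
      finally show "openin (top_of_set {0..T}) (\<mu> -` V \<inter> topspace (top_of_set {0..T}))" .
    next
      show "\<mu> ` topspace (top_of_set {0..T}) \<subseteq>
        \<Union> {{\<mu> \<in> space (prob_algebra borel). mean \<mu> f \<in> U} | f U. bounded_continuous f \<and> open U}"
        using pr topspace_weak_topology
        unfolding weak_topology_def topology_generated_by_topspace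
        by (auto simp: prob_algebra_borel_iff)
    qed
  qed
  then show ?thesis unfolding measure_paths_def by auto
qed

text \<open>Time is metrizable, so sequences suffice; along a sequence of times convergence on
  \<open>BL1\<close> is weak convergence, which covers all bounded continuous test
  functions.\<close>

lemma measure_pathsI_BL1:
  assumes ext: "\<mu> \<in> extensional {0..T}" and rd: "\<And>t. t \<in> {0..T} \<Longrightarrow> real_distribution (\<mu> t)"
    and cont: "\<And>f. f \<in> BL1 \<Longrightarrow> continuous_on {0..T} (\<lambda>t. mean (\<mu> t) f)"
  shows "\<mu> \<in> measure_paths T"
  unfolding measure_paths_iff
proof (intro conjI allI impI ballI ext rd)
  fix f assume f: "bounded_continuous f"
  show "continuous_on {0..T} (\<lambda>t. mean (\<mu> t) f)"
    unfolding continuous_on_sequentially comp_def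
  proof (intro allI ballI impI)
    fix s t assume t: "t \<in> {0..T}" and s: "(\<forall>n. s n \<in> {0..T}) \<and> s \<longlonglongrightarrow> t"
    have "weak_conv_m (\<lambda>n. \<mu> (s n)) (\<mu> t)"
      using cont s t rd
      by (intro BL1_conv_imp_weak_conv) (auto simp: continuous_on_sequentially comp_def)
    then show "(\<lambda>n. mean (\<mu> (s n)) f) \<longlonglongrightarrow> mean (\<mu> t) f"
      using f s t rd by (intro weak_conv_imp_bounded_continuous_conv) auto
  qed
qed

abbreviation uniform_ball :: "real \<Rightarrow> (real \<Rightarrow> real) \<Rightarrow> (real \<Rightarrow> real measure) \<Rightarrow> real \<Rightarrow> (real \<Rightarrow> real measure) set" where
  "uniform_ball T f \<nu> e \<equiv> {\<mu> \<in> measure_paths T. \<forall>t\<in>{0..T}. \<bar>mean (\<mu> t) f - mean (\<nu> t) f\<bar> < e}"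

lemma topspace_uniform_topology: "topspace (uniform_topology T) = measure_paths T"
proof -
  have "bounded_continuous (\<lambda>_. 0)" by (simp add: bounded_continuous_def)
  then have "\<mu> \<in> \<Union> {uniform_ball T f \<nu> e | f \<nu> e.
        bounded_continuous f \<and> \<nu> \<in> measure_paths T \<and> e > 0}" if "\<mu> \<in> measure_paths T" for \<mu>
    using that
    by (intro UnionI[of "uniform_ball T (\<lambda>_. 0) \<mu> 1"])
       (auto intro!: exI[of _ "\<lambda>_. 0"] exI[of _ \<mu>] exI[of _ "1::real"])
  then show ?thesis
    unfolding uniform_topology_def topology_generated_by_topspace by blast
qed

text \<open>Makes compact sets of paths closed, so that a compact set contains the closure of each
  of its subsets. Distinct paths are separated by one time and one function of \<open>BL1\<close>,
  with half the gap as radius.\<close>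

lemma Hausdorff_uniform_topology: "Hausdorff_space (uniform_topology T)"
  unfolding Hausdorff_space_def topspace_uniform_topology
proof (intro allI impI, elim conjE)
  fix \<mu> \<nu> assume \<mu>: "\<mu> \<in> measure_paths T" and \<nu>: "\<nu> \<in> measure_paths T" and ne: "\<mu> \<noteq> \<nu>"
  have "\<exists>t\<in>{0..T}. \<mu> t \<noteq> \<nu> t"
    using \<mu> \<nu> ne unfolding measure_paths_iff by (meson extensionalityI)
  then obtain t where t: "t \<in> {0..T}" "\<mu> t \<noteq> \<nu> t" by auto
  then obtain f where f: "f \<in> BL1" "mean (\<mu> t) f \<noteq> mean (\<nu> t) f"
    using \<mu> \<nu> real_distribution_eqI_BL1 unfolding measure_paths_iff by metis
  define e where "e = \<bar>mean (\<mu> t) f - mean (\<nu> t) f\<bar> / 2"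
  have e: "e > 0" using f by (simp add: e_def)
  let ?B = "\<lambda>\<nu>. uniform_ball T f \<nu> e"
  have op: "openin (uniform_topology T) (?B \<nu>)" if "\<nu> \<in> measure_paths T" for \<nu>
    unfolding uniform_topology_def
    by (rule topology_generated_by_Basis) (use that e BL1_bounded_continuous[OF f(1)] in blast)
  have "disjnt (?B \<mu>) (?B \<nu>)"
    unfolding disjnt_iff
  proof (intro allI notI)
    fix \<kappa> assume "\<kappa> \<in> ?B \<mu> \<and> \<kappa> \<in> ?B \<nu>"
    then have "\<bar>mean (\<kappa> t) f - mean (\<mu> t) f\<bar> < e" "\<bar>mean (\<kappa> t) f - mean (\<nu> t) f\<bar> < e"
      using t by auto
    moreover have "\<bar>mean (\<mu> t) f - mean (\<nu> t) f\<bar> = 2 * e" by (simp add: e_def)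
    ultimately show False by linarith
  qed
  then show "\<exists>U V. openin (uniform_topology T) U \<and> openin (uniform_topology T) V \<and> \<mu> \<in> U \<and> \<nu> \<in> V \<and> disjnt U V"
    using op[OF \<mu>] op[OF \<nu>] \<mu> \<nu> e by (intro exI[of _ "?B \<mu>"] exI[of _ "?B \<nu>"]) auto
qed

text \<open>The bounded Lipschitz distance, uniform in time. On \<open>measure_paths T\<close> the
  supremum is over numbers at most \<open>2\<close>.\<close>

definition bl_dist :: "real \<Rightarrow> (real \<Rightarrow> real measure) \<Rightarrow> (real \<Rightarrow> real measure) \<Rightarrow> real" where
  "bl_dist T \<mu> \<nu> = (SUP (f, t)\<in>BL1 \<times> {0..T}. \<bar>mean (\<mu> t) f - mean (\<nu> t) f\<bar>)"

lemma bl_dist_upper: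
  assumes "\<mu> \<in> measure_paths T" "\<nu> \<in> measure_paths T" "f \<in> BL1" "t \<in> {0..T}"
  shows "\<bar>mean (\<mu> t) f - mean (\<nu> t) f\<bar> \<le> bl_dist T \<mu> \<nu>"
proof -
  have "bdd_above ((\<lambda>(f, t). \<bar>mean (\<mu> t) f - mean (\<nu> t) f\<bar>) ` (BL1 \<times> {0..T}))"
  proof (rule bdd_aboveI2[of _ _ 2], safe)
    fix f t assume "f \<in> BL1" "t \<in> {0..T}"
    then show "\<bar>mean (\<mu> t) f - mean (\<nu> t) f\<bar> \<le> 2"
      using BL1_integral_bound[of "\<mu> t" f] BL1_integral_bound[of "\<nu> t" f] assms(1,2)
      unfolding measure_paths_iff by fastforce
  qed
  from cSUP_upper[OF _ this, of "(f, t)"] show ?thesis using assms(3,4) by (simp add: bl_dist_def)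
qed

lemma bl_dist_least:
  assumes "T \<ge> 0" "\<And>f t. f \<in> BL1 \<Longrightarrow> t \<in> {0..T} \<Longrightarrow> \<bar>mean (\<mu> t) f - mean (\<nu> t) f\<bar> \<le> e"
  shows "bl_dist T \<mu> \<nu> \<le> e"
  unfolding bl_dist_def using assms zero_in_BL1 by (intro cSUP_least) auto

text \<open>The locale asks for nonnegativity at all arguments, also off the carrier, where the
  supremum may be unbounded; hence the default \<open>0\<close>.\<close>

lemma Metric_space_bl_dist:
  assumes T: "T \<ge> 0"
  shows "Metric_space (measure_paths T) (\<lambda>\<mu> \<nu>. if \<mu> \<in> measure_paths T \<and> \<nu> \<in> measure_paths T then bl_dist T \<mu> \<nu> else 0)"
proof (standard, goal_cases)
  case (1 \<mu> \<nu>)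
  then show ?case
    using bl_dist_upper[of \<mu> T \<nu> "\<lambda>_. 0" 0] zero_in_BL1 T by auto
next
  case (2 \<mu> \<nu>)
  then show ?case by (simp add: bl_dist_def abs_minus_commute)
next
  case (3 \<mu> \<nu>)
  show ?case
  proof (simp add: 3, rule iffI)
    assume d0: "bl_dist T \<mu> \<nu> = 0"
    have "\<mu> t = \<nu> t" if t: "t \<in> {0..T}" for t
    proof (rule real_distribution_eqI_BL1)
      fix f assume "f \<in> BL1"
      from bl_dist_upper[OF 3 this t] show "mean (\<mu> t) f = mean (\<nu> t) f" using d0 by simp
    qed (use 3 t in \<open>auto simp: measure_paths_iff\<close>)
    then show "\<mu> = \<nu>" using 3 unfolding measure_paths_iff by (meson extensionalityI)
  next
    assume eq: "\<mu> = \<nu>"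
    have "bl_dist T \<mu> \<nu> \<le> 0" by (rule bl_dist_least[OF T]) (simp add: eq)
    then show "bl_dist T \<mu> \<nu> = 0"
      using bl_dist_upper[OF 3 zero_in_BL1, of 0] T by simp
  qed
next
  case (4 \<mu> \<nu> \<kappa>)
  have "bl_dist T \<mu> \<kappa> \<le> bl_dist T \<mu> \<nu> + bl_dist T \<nu> \<kappa>"
  proof (rule bl_dist_least[OF T])
    fix f t assume "f \<in> BL1" "t \<in> {0..T}"
    from bl_dist_upper[OF 4(1,2) this] bl_dist_upper[OF 4(2,3) this]
    show "\<bar>mean (\<mu> t) f - mean (\<kappa> t) f\<bar> \<le> bl_dist T \<mu> \<nu> + bl_dist T \<nu> \<kappa>" by linarith
  qed
  then show ?case using 4 by simp
qed

text \<open>Expresses that the identity from the metric \<open>bl_dist T\<close> to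
  \<open>uniform_topology T\<close> is continuous. A function that is merely bounded and continuous
  has no rate with respect to \<open>BL1\<close>, so the radius comes from compactness: paths and
  times violating the bound at radii \<open>1 / Suc n\<close> yield a limit time at which the strict
  inequality for \<mu> fails.\<close>

lemma uniform_subbasic_open_in_bl_dist:
  assumes T: "T \<ge> 0" and \<mu>: "\<mu> \<in> measure_paths T" and \<nu>: "\<nu> \<in> measure_paths T" and f: "bounded_continuous f"
    and close: "\<forall>t\<in>{0..T}. \<bar>mean (\<mu> t) f - mean (\<nu> t) f\<bar> < e"
  shows "\<exists>r>0. \<forall>\<kappa>\<in>measure_paths T. bl_dist T \<mu> \<kappa> < r \<longrightarrow>
           (\<forall>t\<in>{0..T}. \<bar>mean (\<kappa> t) f - mean (\<nu> t) f\<bar> < e)"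
proof (rule ccontr)
  assume "\<not> ?thesis"
  then have "\<exists>\<kappa> t. \<kappa> \<in> measure_paths T \<and> bl_dist T \<mu> \<kappa> < r \<and> t \<in> {0..T} \<and>
      \<bar>mean (\<kappa> t) f - mean (\<nu> t) f\<bar> \<ge> e" if "r > 0" for r :: real
    using that by (meson not_less)
  then have "\<forall>n. \<exists>\<kappa> t. \<kappa> \<in> measure_paths T \<and> bl_dist T \<mu> \<kappa> < 1 / real (Suc n) \<and> t \<in> {0..T} \<and>
      \<bar>mean (\<kappa> t) f - mean (\<nu> t) f\<bar> \<ge> e" by simp
  then obtain \<kappa> s where \<kappa>: "\<And>n. \<kappa> n \<in> measure_paths T" and d: "\<And>n. bl_dist T \<mu> (\<kappa> n) < 1 / real (Suc n)"
    and s: "\<And>n. s n \<in> {0..T}" and far: "\<And>n. \<bar>mean (\<kappa> n (s n)) f - mean (\<nu> (s n)) f\<bar> \<ge> e"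
    by metis
  have "seq_compact {0..T}" using compact_Icc compact_imp_seq_compact by blast
  then obtain t r where t: "t \<in> {0..T}" and r: "strict_mono r" and lim: "(s \<circ> r) \<longlonglongrightarrow> t"
    using s unfolding seq_compact_def by metis
  have cont: "(\<lambda>n. mean (\<eta> (s (r n))) g) \<longlonglongrightarrow> mean (\<eta> t) g"
    if "bounded_continuous g" "\<eta> \<in> measure_paths T" for g \<eta>
  proof -
    have "continuous_on {0..T} (\<lambda>t. mean (\<eta> t) g)" using that by (simp add: measure_paths_iff)
    then show ?thesis
      using continuous_on_tendsto_compose[of "{0..T}" _ "s \<circ> r" t] lim s t by (auto simp: comp_def)
  qed
  \<comment> \<open>At the moving times \<open>s (r n)\<close> the path
    \<open>\<kappa> (r n)\<close> is uniformly close to \<mu>, and \<mu> is continuous at the limit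
    time \<open>t\<close>.\<close>
  have "weak_conv_m (\<lambda>n. \<kappa> (r n) (s (r n))) (\<mu> t)"
  proof (rule BL1_conv_imp_weak_conv)
    fix g assume g: "g \<in> BL1"
    have "(\<lambda>n. mean (\<mu> (s (r n))) g - mean (\<kappa> (r n) (s (r n))) g) \<longlonglongrightarrow> 0"
    proof (rule Lim_null_comparison)
      show "\<forall>\<^sub>F n in sequentially. norm ((mean (\<mu> (s (r n))) g) - mean (\<kappa> (r n) (s (r n))) g) \<le> 1 / real (Suc (r n))"
        using bl_dist_upper[OF \<mu> \<kappa> g s] d by (intro always_eventually allI) (metis less_imp_le order_trans real_norm_def)
      show "(\<lambda>n. 1 / real (Suc (r n))) \<longlonglongrightarrow> 0"
        using LIMSEQ_subseq_LIMSEQ[OF LIMSEQ_Suc[OF lim_1_over_n] r] by (simp add: comp_def)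
    qed
    from tendsto_diff[OF cont[OF BL1_bounded_continuous[OF g] \<mu>] this]
    show "(\<lambda>n. mean (\<kappa> (r n) (s (r n))) g) \<longlonglongrightarrow> mean (\<mu> t) g" by simp
  qed (use \<kappa> \<mu> s t in \<open>auto simp: measure_paths_iff\<close>)
  then have "(\<lambda>n. mean (\<kappa> (r n) (s (r n))) f) \<longlonglongrightarrow> mean (\<mu> t) f"
    using \<kappa> \<mu> s t f by (intro weak_conv_imp_bounded_continuous_conv) (auto simp: measure_paths_iff)
  from tendsto_rabs[OF tendsto_diff[OF this cont[OF f \<nu>]]]
  have "(\<lambda>n. \<bar>mean (\<kappa> (r n) (s (r n))) f - mean (\<nu> (s (r n))) f\<bar>) \<longlonglongrightarrow> \<bar>mean (\<mu> t) f - mean (\<nu> t) f\<bar>" .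
  then have "e \<le> \<bar>mean (\<mu> t) f - mean (\<nu> t) f\<bar>"
    by (rule LIMSEQ_le_const) (use far in auto)
  then show False using close t by force
qed

lemma tight_of_integral_bound:
  assumes \<mu>: "\<And>n. real_distribution (\<mu> n)" and [measurable]: "\<phi> \<in> borel_measurable borel"
    and inf: "filterlim \<phi> at_top at_infinity"
    and C: "\<And>n. (\<integral>\<^sup>+ x. ennreal (\<phi> x) \<partial>\<mu> n) \<le> ennreal C"
  shows "tight \<mu>"
  unfolding tight_def
proof (intro conjI allI impI \<mu>)
  fix \<epsilon> :: real assume \<epsilon>: "\<epsilon> > 0"
  \<comment> \<open>Markov's inequality bounds the mass where \<phi> is at least \<open>c\<close> by
    \<open>\<bar>C\<bar> / c\<close>, which is below \<epsilon>; the added \<open>1\<close> keeps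
    \<open>c\<close> positive.\<close>
  define c where "c = (\<bar>C\<bar> + 1) / \<epsilon>"
  have c: "c > 0" using \<epsilon> by (auto simp: c_def intro!: divide_pos_pos)
  from inf have "\<forall>\<^sub>F x in at_infinity. \<phi> x \<ge> c" by (simp add: filterlim_at_top)
  then obtain R where R: "\<And>x. norm x \<ge> R \<Longrightarrow> \<phi> x \<ge> c" unfolding eventually_at_infinity by auto
  define b where "b = max R 1"
  have "measure (\<mu> n) {-b<..b} > 1 - \<epsilon>" for n
  proof -
    interpret real_distribution "\<mu> n" by (rule \<mu>)
    have "emeasure (\<mu> n) (UNIV - {-b<..b}) \<le> emeasure (\<mu> n) {x\<in>UNIV. 1 \<le> ennreal (1 / c) * ennreal (\<phi> x)}"
    proof (rule emeasure_mono)
      show "UNIV - {-b<..b} \<subseteq> {x\<in>UNIV. 1 \<le> ennreal (1 / c) * ennreal (\<phi> x)}"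
      proof
        fix x assume "x \<in> UNIV - {-b<..b}"
        then have "norm x \<ge> R" by (auto simp: b_def)
        from R[OF this] have "1 \<le> 1 / c * \<phi> x" "0 \<le> \<phi> x" using c by (auto simp: field_simps)
        then show "x \<in> {x\<in>UNIV. 1 \<le> ennreal (1 / c) * ennreal (\<phi> x)}"
          using c by (simp add: ennreal_mult'[symmetric] del: ennreal_1 flip: ennreal_1)
      qed
    qed simp
    also have "\<dots> \<le> ennreal (1 / c) * (\<integral>\<^sup>+ x. ennreal (\<phi> x) * indicator UNIV x \<partial>\<mu> n)"
      by (rule nn_integral_Markov_inequality) auto
    also have "\<dots> \<le> ennreal (1 / c) * ennreal C"
      using C[of n] by (intro mult_left_mono) auto
    also have "\<dots> \<le> ennreal (1 / c) * ennreal \<bar>C\<bar>"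
      by (intro mult_left_mono) (auto intro: ennreal_leI)
    also have "\<dots> = ennreal (1 / c * \<bar>C\<bar>)"
      using c by (subst ennreal_mult) auto
    finally have "prob (UNIV - {-b<..b}) \<le> 1 / c * \<bar>C\<bar>"
      using c by (simp add: emeasure_eq_measure)
    also have "\<dots> < \<epsilon>" using \<epsilon> by (simp add: c_def field_simps)
    finally show ?thesis using prob_compl[of "{-b<..b}"] by simp
  qed
  moreover have "-b < b" by (simp add: b_def)
  ultimately show "\<exists>a b. a < b \<and> (\<forall>n. measure (\<mu> n) {a<..b} > 1 - \<epsilon>)" by blast
qed

section \<open>A compactness criterion\<close>

text \<open>The hypotheses of Arzela-Ascoli for measure-valued paths: a moment bound that gives
  tightness at each time, and a common modulus of continuity, sampled along the sequences \<delta>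
  and \<rho>. For nonnegative \<phi> the bound on the nonnegative integral includes integrability,
  and it survives weak limits.\<close>

definition tight_paths ::
    "real \<Rightarrow> (real \<Rightarrow> real) \<Rightarrow> real \<Rightarrow> (nat \<Rightarrow> real) \<Rightarrow> (nat \<Rightarrow> real) \<Rightarrow> (real \<Rightarrow> real measure) set" where
  "tight_paths T \<phi> C \<delta> \<rho> = {\<mu> \<in> measure_paths T.
     (\<forall>t\<in>{0..T}. (\<integral>\<^sup>+ x. ennreal (\<phi> x) \<partial>\<mu> t) \<le> ennreal C) \<and>
     (\<forall>f\<in>BL1. \<forall>m. \<forall>s\<in>{0..T}. \<forall>t\<in>{0..T}. \<bar>s - t\<bar> \<le> \<delta> m \<longrightarrow>
        \<bar>mean (\<mu> s) f - mean (\<mu> t) f\<bar> \<le> \<rho> m)}"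

text \<open>Arzela-Ascoli: a diagonal subsequence converges weakly at countably many times,
  equicontinuity carries this to all times, and finite nets make the convergence uniform.\<close>

lemma tight_paths_seq_compact:
  assumes T: "T \<ge> 0" and \<phi>0: "\<And>x. \<phi> x \<ge> 0" and \<phi>c: "continuous_on UNIV \<phi>"
    and inf: "filterlim \<phi> at_top at_infinity"
    and \<delta>: "\<And>m. \<delta> m > 0" and \<rho>: "\<rho> \<longlonglongrightarrow> 0"
    and \<sigma>: "\<And>n::nat. \<sigma> n \<in> tight_paths T \<phi> C \<delta> \<rho>"
  shows "\<exists>l r. l \<in> tight_paths T \<phi> C \<delta> \<rho> \<and> strict_mono r \<and>
    (\<forall>e>0. \<forall>\<^sub>F n in sequentially. bl_dist T (\<sigma> (r n)) l < e)"
proof -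
  have [measurable]: "\<phi> \<in> borel_measurable borel" using \<phi>c by (rule borel_measurable_continuous_onI)
  have rd: "real_distribution (\<sigma> n t)" if "t \<in> {0..T}" for n t
    using \<sigma>[of n] that by (auto simp: tight_paths_def measure_paths_iff)
  have tight: "tight (\<lambda>n. \<sigma> n t)" if "t \<in> {0..T}" for t
    using \<sigma> that inf by (intro tight_of_integral_bound[where \<phi>=\<phi> and C=C] rd) (auto simp: tight_paths_def)
  have eq: "\<bar>mean (\<sigma> n s) f - mean (\<sigma> n t) f\<bar> \<le> \<rho> m"
    if "f \<in> BL1" "s \<in> {0..T}" "t \<in> {0..T}" "\<bar>s - t\<bar> \<le> \<delta> m" for f n s t m
    using \<sigma>[of n] that by (auto simp: tight_paths_def)
  have "\<exists>k. finite k \<and> k \<subseteq> {0..T} \<and> {0..T} \<subseteq> (\<Union>x\<in>k. ball x (\<delta> m))" for m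
    using seq_compact_imp_totally_bounded[of "{0..T}"] compact_Icc[of 0 T] compact_imp_seq_compact \<delta>[of m] by blast
  then obtain net where net: "\<And>m. finite (net m)" "\<And>m. net m \<subseteq> {0..T}" "\<And>m. {0..T} \<subseteq> (\<Union>x\<in>net m. ball x (\<delta> m))"
    by metis
  \<comment> \<open>A \<open>\<delta> m\<close>-net for every \<open>m\<close>, all together
    countable. What is used is that at a scale where \<open>\<rho> m\<close> is small, every time
    has a point of \<open>D\<close> within \<open>\<delta> m\<close>.\<close>
  define D where "D = (\<Union>m. net m)"
  have "countable D" unfolding D_def using net(1) by (auto intro: countable_finite)
  moreover have "D \<noteq> {}" unfolding D_def using net(3) T by fastforce
  ultimately have D: "range (from_nat_into D) = D" by (rule range_from_nat_into[rotated])
  have DT: "D \<subseteq> {0..T}" unfolding D_def using net(2) by auto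
  define P where "P k s \<longleftrightarrow> (\<exists>M. real_distribution M \<and> weak_conv_m (\<lambda>n. \<sigma> (s n) (from_nat_into D k)) M)"
    for k :: nat and s :: "nat \<Rightarrow> nat"
  interpret subseqs P
  proof
    fix k and s :: "nat \<Rightarrow> nat" assume s: "strict_mono s"
    have "from_nat_into D k \<in> {0..T}" using D DT by blast
    from tight_imp_convergent_subsubsequence[OF tight[OF this] s]
    show "\<exists>r'. strict_mono r' \<and> P k (s \<circ> r')" by (auto simp: P_def comp_def)
  qed
  have weak_subseq: "weak_conv_m (\<mu> \<circ> r) M" if "weak_conv_m \<mu> M" "strict_mono r" for \<mu> M and r :: "nat \<Rightarrow> nat"
    using that LIMSEQ_subseq_LIMSEQ unfolding weak_conv_m_def weak_conv_def comp_def by fast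
  \<comment> \<open>From position \<open>Suc k\<close> on, the diagonal sequence is a subsequence of
    the one chosen for the \<open>k\<close>-th point.\<close>
  have "P k (diagseq \<circ> (+) (Suc k))" for k
  proof (rule diagseq_holds)
    fix r s :: "nat \<Rightarrow> nat" and n assume "strict_mono r" "P n s"
    then show "P n (s \<circ> r)" using weak_subseq[of "\<lambda>i. \<sigma> (s i) (from_nat_into D n)"] by (auto simp: P_def comp_def)
  qed
  then have convD: "convergent (\<lambda>n. mean (\<sigma> (diagseq n) t) f)" if t: "t \<in> D" and f: "f \<in> BL1" for f t
  proof -
    obtain k where k: "t = from_nat_into D k" using D t by blast
    from \<open>\<And>k. P k (diagseq \<circ> (+) (Suc k))\<close>[of k]
    obtain M where "real_distribution M" "weak_conv_m (\<lambda>n. \<sigma> (diagseq (Suc k + n)) t) M"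
      unfolding P_def k comp_def by blast
    then have "(\<lambda>n. mean (\<sigma> (diagseq (Suc k + n)) t) f) \<longlonglongrightarrow> mean M f"
      using rd t DT BL1_bounded_continuous[OF f] by (intro weak_conv_imp_bounded_continuous_conv) auto
    then have "(\<lambda>n. mean (\<sigma> (diagseq n) t) f) \<longlonglongrightarrow> mean M f"
      using LIMSEQ_offset[of "\<lambda>n. mean (\<sigma> (diagseq n) t) f" "Suc k"] by (simp add: add.commute)
    then show ?thesis by (rule convergentI)
  qed
  let ?r = diagseq
  have r: "strict_mono ?r" by (rule subseq_diagseq)
  have near: "\<exists>u\<in>net m. \<bar>t - u\<bar> \<le> \<delta> m" if "t \<in> {0..T}" for t m
    using net(3)[of m] that by (force simp: dist_real_def abs_minus_commute)
  have \<rho>small: "\<exists>m. \<rho> m < e" if "e > 0" for e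
    using order_tendstoD(2)[OF \<rho> that] eventually_sequentially by auto
  have conv: "convergent (\<lambda>n. mean (\<sigma> (?r n) t) f)" if t: "t \<in> {0..T}" and f: "f \<in> BL1" for f t
  proof (rule Cauchy_convergent, rule metric_CauchyI)
    fix e :: real assume e: "e > 0"
    obtain m where m: "\<rho> m < e / 3" using \<rho>small[of "e / 3"] e by auto
    obtain u where u: "u \<in> net m" "\<bar>t - u\<bar> \<le> \<delta> m" using near[OF t] by auto
    have uD: "u \<in> D" using u by (auto simp: D_def)
    have uT: "u \<in> {0..T}" using uD DT by auto
    from metric_CauchyD[OF convergent_Cauchy[OF convD[OF uD f]], of "e / 3"] e
    obtain N where N: "\<And>a b. a \<ge> N \<Longrightarrow> b \<ge> N \<Longrightarrow> dist (mean (\<sigma> (?r a) u) f) (mean (\<sigma> (?r b) u) f) < e / 3"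
      by auto
    show "\<exists>N. \<forall>a\<ge>N. \<forall>b\<ge>N. dist (mean (\<sigma> (?r a) t) f) (mean (\<sigma> (?r b) t) f) < e"
    proof (intro exI allI impI)
      fix a b assume "a \<ge> N" "b \<ge> N"
      from N[OF this] eq[OF f t uT u(2), of "?r a"] eq[OF f t uT u(2), of "?r b"] m
      show "dist (mean (\<sigma> (?r a) t) f) (mean (\<sigma> (?r b) t) f) < e"
        unfolding dist_real_def by linarith
    qed
  qed
  \<comment> \<open>All integrals converge already; tightness along a further subsequence shows that
    their limits are integrals against a probability measure.\<close>
  have "\<exists>M. real_distribution M \<and> (\<forall>f\<in>BL1. (\<lambda>n. mean (\<sigma> (?r n) t) f) \<longlonglongrightarrow> mean M f)" if t: "t \<in> {0..T}" for t
  proof -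
    from tight_imp_convergent_subsubsequence[OF tight[OF t] r]
    obtain r' M where r': "strict_mono r'" and M: "real_distribution M"
      and w: "weak_conv_m (\<lambda>n. \<sigma> (?r (r' n)) t) M" by (auto simp: comp_def)
    have "(\<lambda>n. mean (\<sigma> (?r n) t) f) \<longlonglongrightarrow> mean M f" if f: "f \<in> BL1" for f
    proof -
      obtain L where L: "(\<lambda>n. mean (\<sigma> (?r n) t) f) \<longlonglongrightarrow> L" using conv[OF t f] by (auto simp: convergent_def)
      have "(\<lambda>n. mean (\<sigma> (?r (r' n)) t) f) \<longlonglongrightarrow> mean M f"
        using w M rd[OF t] BL1_bounded_continuous[OF f] by (intro weak_conv_imp_bounded_continuous_conv) auto
      moreover have "(\<lambda>n. mean (\<sigma> (?r (r' n)) t) f) \<longlonglongrightarrow> L"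
        using LIMSEQ_subseq_LIMSEQ[OF L r'] by (simp add: comp_def)
      ultimately show ?thesis using L LIMSEQ_unique by blast
    qed
    with M show ?thesis by blast
  qed
  then obtain M where M: "\<And>t. t \<in> {0..T} \<Longrightarrow> real_distribution (M t)"
    and limM: "\<And>t f. t \<in> {0..T} \<Longrightarrow> f \<in> BL1 \<Longrightarrow> (\<lambda>n. mean (\<sigma> (?r n) t) f) \<longlonglongrightarrow> mean (M t) f"
    by metis
  define l where "l = restrict M {0..T}"
  have l: "real_distribution (l t)" "f \<in> BL1 \<Longrightarrow> (\<lambda>n. mean (\<sigma> (?r n) t) f) \<longlonglongrightarrow> mean (l t) f"
    if "t \<in> {0..T}" for t f using M limM that by (auto simp: l_def)
  have wl: "weak_conv_m (\<lambda>n. \<sigma> (?r n) t) (l t)" if t: "t \<in> {0..T}" for t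
    using rd[OF t] l[OF t] by (intro BL1_conv_imp_weak_conv) auto
  have leq: "\<bar>mean (l s) f - mean (l t) f\<bar> \<le> \<rho> m"
    if f: "f \<in> BL1" and st: "s \<in> {0..T}" "t \<in> {0..T}" "\<bar>s - t\<bar> \<le> \<delta> m" for f s t m
  proof (rule LIMSEQ_le_const2)
    show "(\<lambda>n. \<bar>mean (\<sigma> (?r n) s) f - mean (\<sigma> (?r n) t) f\<bar>) \<longlonglongrightarrow> \<bar>mean (l s) f - mean (l t) f\<bar>"
      by (intro tendsto_intros l st f)
  qed (use eq[OF f st] in auto)
  have lpath: "l \<in> measure_paths T"
  proof (rule measure_pathsI_BL1)
    fix f assume f: "f \<in> BL1"
    show "continuous_on {0..T} (\<lambda>t. mean (l t) f)"
      unfolding continuous_on_iff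
    proof (intro ballI allI impI)
      fix t e :: real assume t: "t \<in> {0..T}" and e: "e > 0"
      obtain m where m: "\<rho> m < e" using \<rho>small[OF e] by auto
      show "\<exists>d>0. \<forall>t'\<in>{0..T}. dist t' t < d \<longrightarrow> dist (mean (l t') f) (mean (l t) f) < e"
        using leq[OF f _ t, of _ m] m \<delta>[of m] by (intro exI[of _ "\<delta> m"]) (force simp: dist_real_def)
    qed
  qed (use l in \<open>auto simp: l_def\<close>)
  \<comment> \<open>As \<phi> is unbounded, weak convergence is applied to its truncations, and
    monotone convergence removes them.\<close>
  have lphi: "(\<integral>\<^sup>+ x. ennreal (\<phi> x) \<partial>l t) \<le> ennreal C" if t: "t \<in> {0..T}" for t
  proof -
    have trunc: "(\<integral>\<^sup>+ x. ennreal (min (\<phi> x) (real k)) \<partial>l t) \<le> ennreal C" for k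
    proof -
      have bc: "bounded_continuous (\<lambda>x. min (\<phi> x) (real k))"
        unfolding bounded_continuous_def bounded_iff using \<phi>c \<phi>0
        by (auto intro!: continuous_intros exI[of _ "real k"])
      have nn: "(\<integral>\<^sup>+ x. ennreal (min (\<phi> x) (real k)) \<partial>N) = ennreal (\<integral>x. min (\<phi> x) (real k) \<partial>N)"
        if "real_distribution N" for N
      proof -
        interpret real_distribution N by fact
        show ?thesis
          by (rule nn_integral_eq_integral) (auto intro!: integrable_const_bound[of _ "real k"] simp: \<phi>0)
      qed
      have "(\<lambda>n. \<integral>\<^sup>+ x. ennreal (min (\<phi> x) (real k)) \<partial>\<sigma> (?r n) t) \<longlonglongrightarrow> (\<integral>\<^sup>+ x. ennreal (min (\<phi> x) (real k)) \<partial>l t)"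
        unfolding nn[OF rd[OF t]] nn[OF l(1)[OF t]]
        by (intro tendsto_ennrealI weak_conv_imp_bounded_continuous_conv wl rd l t bc)
      moreover have "(\<integral>\<^sup>+ x. ennreal (min (\<phi> x) (real k)) \<partial>\<sigma> (?r n) t) \<le> ennreal C" for n
      proof -
        have "(\<integral>\<^sup>+ x. ennreal (min (\<phi> x) (real k)) \<partial>\<sigma> (?r n) t) \<le> (\<integral>\<^sup>+ x. ennreal (\<phi> x) \<partial>\<sigma> (?r n) t)"
          by (intro nn_integral_mono ennreal_leI) simp
        also have "\<dots> \<le> ennreal C" using \<sigma>[of "?r n"] t by (auto simp: tight_paths_def)
        finally show ?thesis .
      qed
      ultimately show ?thesis by (intro LIMSEQ_le_const2) auto
    qed
    interpret real_distribution "l t" by (rule l(1)[OF t])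
    have "(\<integral>\<^sup>+ x. ennreal (\<phi> x) \<partial>l t) = (\<integral>\<^sup>+ x. (SUP k. ennreal (min (\<phi> x) (real k))) \<partial>l t)"
    proof (intro nn_integral_cong antisym SUP_least)
      fix x
      obtain k where "\<phi> x \<le> real k" using real_arch_simple by blast
      then show "ennreal (\<phi> x) \<le> (SUP k. ennreal (min (\<phi> x) (real k)))" by (intro SUP_upper2[of k]) auto
    qed (auto intro: ennreal_leI)
    also have "\<dots> = (SUP k. \<integral>\<^sup>+ x. ennreal (min (\<phi> x) (real k)) \<partial>l t)"
      by (rule nn_integral_monotone_convergence_SUP)
         (auto simp: incseq_def le_fun_def intro!: ennreal_leI intro: min.mono)
    also have "\<dots> \<le> ennreal C" by (intro SUP_least trunc)
    finally show ?thesis .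
  qed
  have lK: "l \<in> tight_paths T \<phi> C \<delta> \<rho>"
    using lpath lphi leq by (auto simp: tight_paths_def)
  have "\<forall>\<^sub>F n in sequentially. bl_dist T (\<sigma> (?r n)) l < e" if e: "e > 0" for e
  proof -
    \<comment> \<open>Three errors below \<open>e / 4\<close> each, two from moving to a net point
      and one at the net point, leave a strict margin after the supremum is taken.\<close>
    obtain m where m: "\<rho> m < e / 4" using \<rho>small[of "e / 4"] e by auto
    have "\<forall>\<^sub>F n in sequentially. \<forall>u\<in>net m. \<forall>f\<in>BL1. \<bar>mean (\<sigma> (?r n) u) f - mean (l u) f\<bar> < e / 4"
      using net(1,2)[of m] e
      by (intro eventually_ball_finite ballI weak_conv_imp_BL1_uniform_conv rd l wl) auto
    then show ?thesis
    proof eventually_elim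
      case (elim n)
      have "bl_dist T (\<sigma> (?r n)) l \<le> 3 * e / 4"
      proof (rule bl_dist_least[OF T])
        fix f t assume f: "f \<in> BL1" and t: "t \<in> {0..T}"
        obtain u where u: "u \<in> net m" "\<bar>t - u\<bar> \<le> \<delta> m" using near[OF t] by auto
        have uT: "u \<in> {0..T}" using u(1) net(2) by blast
        from elim u(1) f have "\<bar>mean (\<sigma> (?r n) u) f - mean (l u) f\<bar> < e / 4" by blast
        with eq[OF f t uT u(2), of "?r n"] leq[OF f t uT u(2)] m
        show "\<bar>mean (\<sigma> (?r n) t) f - mean (l t) f\<bar> \<le> 3 * e / 4" by linarith
      qed
      then show ?case using e by linarith
    qed
  qed
  with lK r show ?thesis by blast
qed

text \<open>The class is compact for the metric \<open>bl_dist T\<close>; the continuous identity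
  carries compactness to the uniform topology, and the Hausdorff property makes the class closed
  there, so that it contains the closure of \<open>S\<close>.\<close>

theorem relatively_compact_in_uniform_topology:
  assumes T: "T \<ge> 0" and \<phi>0: "\<And>x. \<phi> x \<ge> 0" and \<phi>c: "continuous_on UNIV \<phi>"
    and inf: "filterlim \<phi> at_top at_infinity"
    and \<delta>: "\<And>m. \<delta> m > 0" and \<rho>: "\<rho> \<longlonglongrightarrow> 0"
    and S: "S \<subseteq> tight_paths T \<phi> C \<delta> \<rho>"
  shows "relatively_compact_in (uniform_topology T) S"
proof -
  let ?K = "tight_paths T \<phi> C \<delta> \<rho>"
  define d where "d \<mu> \<nu> = (if \<mu> \<in> measure_paths T \<and> \<nu> \<in> measure_paths T then bl_dist T \<mu> \<nu> else 0)" for \<mu> \<nu>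
  interpret Metric_space "measure_paths T" d
    unfolding d_def by (rule Metric_space_bl_dist[OF T])
  have Kp: "?K \<subseteq> measure_paths T" by (auto simp: tight_paths_def)
  have "compactin mtopology ?K"
    unfolding compactin_sequentially
  proof (intro conjI allI impI Kp)
    fix \<sigma> :: "nat \<Rightarrow> _" assume "range \<sigma> \<subseteq> ?K"
    then have \<sigma>: "\<And>n. \<sigma> n \<in> ?K" by auto
    obtain l r where l: "l \<in> ?K" and r: "strict_mono r"
      and lim: "\<forall>e>0. \<forall>\<^sub>F n in sequentially. bl_dist T (\<sigma> (r n)) l < e"
      using tight_paths_seq_compact[where \<phi>=\<phi> and \<delta>=\<delta> and \<rho>=\<rho> and C=C and T=T and \<sigma>=\<sigma>,
          OF T \<phi>0 \<phi>c inf \<delta> \<rho> \<sigma>]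
      by (elim exE conjE)
    have "limitin mtopology (\<sigma> \<circ> r) l sequentially"
    proof -
      have lp: "l \<in> measure_paths T" and \<sigma>p: "\<And>n. \<sigma> n \<in> measure_paths T" using l \<sigma> Kp by blast+
      then show ?thesis unfolding limitin_metric using lim by (simp add: d_def)
    qed
    with l r show "\<exists>l r. l \<in> ?K \<and> strict_mono r \<and> limitin mtopology (\<sigma> \<circ> r) l sequentially" by blast
  qed
  moreover have "continuous_map mtopology (uniform_topology T) id"
    unfolding uniform_topology_def
  proof (rule continuous_on_generated_topo)
    fix U assume "U \<in> {uniform_ball T f \<nu> e | f \<nu> e.
        bounded_continuous f \<and> \<nu> \<in> measure_paths T \<and> e > 0}"
    then obtain f \<nu> e where U: "U = uniform_ball T f \<nu> e"
      and f: "bounded_continuous f" and \<nu>: "\<nu> \<in> measure_paths T" by (elim CollectE exE conjE)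
    have "\<exists>r>0. mball \<mu> r \<subseteq> U" if \<mu>: "\<mu> \<in> U" for \<mu>
    proof -
      have \<mu>p: "\<mu> \<in> measure_paths T" and "\<forall>t\<in>{0..T}. \<bar>mean (\<mu> t) f - mean (\<nu> t) f\<bar> < e"
        using \<mu> unfolding U by simp_all
      from uniform_subbasic_open_in_bl_dist[OF T \<mu>p \<nu> f this(2)]
      obtain r where r: "r > 0" "\<And>\<kappa>. \<kappa> \<in> measure_paths T \<Longrightarrow> bl_dist T \<mu> \<kappa> < r \<Longrightarrow>
           (\<forall>t\<in>{0..T}. \<bar>mean (\<kappa> t) f - mean (\<nu> t) f\<bar> < e)" by blast
      have "mball \<mu> r \<subseteq> U"
      proof
        fix \<kappa> assume "\<kappa> \<in> mball \<mu> r"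
        then have \<kappa>: "\<kappa> \<in> measure_paths T" "bl_dist T \<mu> \<kappa> < r" using \<mu>p by (simp_all add: d_def split: if_splits)
        then show "\<kappa> \<in> U" using r(2) unfolding U by blast
      qed
      with r(1) show ?thesis by blast
    qed
    then have "openin mtopology U" unfolding openin_mtopology using U by blast
    then show "openin mtopology (id -` U \<inter> topspace mtopology)"
      using openin_subset[of mtopology U] by (simp add: Int_absorb2)
  next
    show "id ` topspace mtopology \<subseteq> \<Union> {uniform_ball T f \<nu> e | f \<nu> e.
        bounded_continuous f \<and> \<nu> \<in> measure_paths T \<and> e > 0}"
      unfolding topspace_uniform_topology[of T, unfolded uniform_topology_def topology_generated_by_topspace]
      by simp
  qed
  ultimately have K: "compactin (uniform_topology T) ?K"
    using image_compactin[of mtopology ?K "uniform_topology T" id] by simp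
  then have Kc: "closedin (uniform_topology T) ?K"
    by (rule compactin_imp_closedin[OF Hausdorff_uniform_topology])
  have "uniform_topology T closure_of S \<subseteq> ?K"
    by (rule closure_of_minimal[OF S Kc])
  then have "compactin (uniform_topology T) (uniform_topology T closure_of S)"
    by (rule closed_compactin[OF K]) simp
  then show ?thesis
    unfolding relatively_compact_in_def topspace_uniform_topology using S Kp by auto
qed

section \<open>Moments of sums and Gaussian increments\<close>

lemma (in prob_space) second_moment_sum_indep_centered:
  fixes U :: "'i \<Rightarrow> 'a \<Rightarrow> real"
  assumes indep: "indep_vars (\<lambda>_. borel) U UNIV"
    and int: "\<And>k. integrable M (U k)" and sq: "\<And>k. integrable M (\<lambda>\<omega>. (U k \<omega>)\<^sup>2)"
    and cent: "\<And>k. expectation (U k) = 0" and I: "finite I"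
  shows "integrable M (\<lambda>\<omega>. (\<Sum>k\<in>I. U k \<omega>)\<^sup>2)"
    and "expectation (\<lambda>\<omega>. (\<Sum>k\<in>I. U k \<omega>)\<^sup>2) = (\<Sum>k\<in>I. expectation (\<lambda>\<omega>. (U k \<omega>)\<^sup>2))"
proof -
  have prod: "integrable M (\<lambda>\<omega>. U k \<omega> * U l \<omega>) \<and>
      expectation (\<lambda>\<omega>. U k \<omega> * U l \<omega>) = (if k = l then expectation (\<lambda>\<omega>. (U k \<omega>)\<^sup>2) else 0)" for k l
  proof (cases "k = l")
    case True
    then show ?thesis using sq[of k] by (simp add: power2_eq_square)
  next
    case False
    have "indep_vars (\<lambda>_. borel) U {k, l}" by (rule indep_vars_subset[OF indep]) simp
    from indep_vars_lebesgue_integral[OF _ this int] indep_vars_integrable[OF _ this int] False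
    show ?thesis by (simp add: cent)
  qed
  have eq: "(\<lambda>\<omega>. (\<Sum>k\<in>I. U k \<omega>)\<^sup>2) = (\<lambda>\<omega>. \<Sum>k\<in>I. \<Sum>l\<in>I. U k \<omega> * U l \<omega>)"
    by (simp add: power2_eq_square sum_product)
  show "integrable M (\<lambda>\<omega>. (\<Sum>k\<in>I. U k \<omega>)\<^sup>2)"
    unfolding eq using prod by auto
  show "expectation (\<lambda>\<omega>. (\<Sum>k\<in>I. U k \<omega>)\<^sup>2) = (\<Sum>k\<in>I. expectation (\<lambda>\<omega>. (U k \<omega>)\<^sup>2))"
    unfolding eq using prod I by (simp add: sum.delta cong: if_cong)
qed

definition tri :: "nat \<Rightarrow> (nat \<times> nat) set" where
  "tri N = {(i, j). i \<le> j \<and> j < N}"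

text \<open>At most \<open>N\<^sup>2\<close> independent centred variables of variance at most
  \<open>q\<close>, summed and divided by \<open>N\<^sup>2\<close>, have second moment at most
  \<open>q / N\<^sup>2\<close>. These bounds are summable over \<open>N\<close>, so the series of
  the squares is almost surely finite, and its value bounds every term.\<close>

theorem (in prob_space) triangular_array_sum_bounded:
  fixes V :: "nat \<times> nat \<Rightarrow> 'a \<Rightarrow> real"
  assumes indep: "indep_vars (\<lambda>_. borel) V UNIV"
    and sq: "\<And>k. integrable M (\<lambda>\<omega>. (V k \<omega>)\<^sup>2)"
    and mean: "\<And>k. expectation (V k) = \<mu>" and q: "\<And>k. expectation (\<lambda>\<omega>. (V k \<omega>)\<^sup>2) \<le> q"
  shows "AE \<omega> in M. \<exists>R. \<forall>N. (\<Sum>k\<in>tri N. V k \<omega>) \<le> R * (real N)\<^sup>2"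
proof -
  have V[measurable]: "V k \<in> borel_measurable M" for k
    using indep unfolding indep_vars_def by (cases k) simp
  have int: "integrable M (V k)" for k
    by (rule square_integrable_imp_integrable[OF V sq])
  define U where "U k \<omega> = V k \<omega> - \<mu>" for k \<omega>
  have U[measurable]: "U k \<in> borel_measurable M" for k unfolding U_def by measurable
  have indepU: "indep_vars (\<lambda>_. borel) U UNIV"
    unfolding U_def by (rule indep_vars_compose2[OF indep]) auto
  have Uint: "integrable M (U k)" "expectation (U k) = 0" for k
    unfolding U_def using int mean by (auto simp: prob_space)
  have Usq: "integrable M (\<lambda>\<omega>. (U k \<omega>)\<^sup>2)" for k
    unfolding U_def power2_diff using int sq by auto
  have Uq: "expectation (\<lambda>\<omega>. (U k \<omega>)\<^sup>2) \<le> q" for k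
  proof -
    have "expectation (\<lambda>\<omega>. (U k \<omega>)\<^sup>2) = expectation (\<lambda>\<omega>. (V k \<omega>)\<^sup>2) - \<mu>\<^sup>2"
      unfolding U_def power2_diff using int sq mean
      by (simp add: prob_space power2_eq_square)
    then show ?thesis using q[of k] zero_le_power2[of \<mu>] by linarith
  qed
  have Isub: "tri N \<subseteq> {..<N} \<times> {..<N}" for N by (auto simp: tri_def)
  have finI: "finite (tri N)" for N by (rule finite_subset[OF Isub]) simp
  have cardI: "real (card (tri N)) \<le> (real N)\<^sup>2" for N
  proof -
    have "card (tri N) \<le> card ({..<N} \<times> {..<N})" by (intro card_mono Isub) simp
    then show ?thesis by (simp add: power2_eq_square flip: of_nat_mult)
  qed
  \<comment> \<open>\<open>Suc n\<close> stands for the matrix size, so that the denominator is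
    never zero.\<close>
  define Z where "Z n \<omega> = ((\<Sum>k\<in>tri (Suc n). U k \<omega>) / (real (Suc n))\<^sup>2)\<^sup>2" for n \<omega>
  have Z[measurable]: "Z n \<in> borel_measurable M" for n unfolding Z_def by measurable
  \<comment> \<open>Any index will do here, since \<open>q\<close> bounds the second moment at every
    index.\<close>
  have q0: "q \<ge> 0" using q[of undefined] by (rule order_trans[rotated]) simp
  have EZ: "(\<integral>\<^sup>+\<omega>. ennreal (Z n \<omega>) \<partial>M) \<le> ennreal (q * (1 / (real (Suc n))\<^sup>2))" for n
  proof -
    note sm = second_moment_sum_indep_centered[OF indepU Uint(1) Usq Uint(2) finI[of "Suc n"]]
    have eq: "Z n = (\<lambda>\<omega>. (\<Sum>k\<in>tri (Suc n). U k \<omega>)\<^sup>2 / (real (Suc n))^4)"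
      by (auto simp: Z_def power_divide)
    have "integrable M (Z n)" unfolding eq using sm(1) by simp
    moreover have "Z n \<omega> \<ge> 0" for \<omega> by (simp add: Z_def)
    ultimately have "(\<integral>\<^sup>+\<omega>. ennreal (Z n \<omega>) \<partial>M) = ennreal (expectation (Z n))"
      by (intro nn_integral_eq_integral) auto
    also have "expectation (Z n) = (\<Sum>k\<in>tri (Suc n). expectation (\<lambda>\<omega>. (U k \<omega>)\<^sup>2)) / (real (Suc n))^4"
      unfolding eq using sm by simp
    also have "\<dots> \<le> (real (Suc n))\<^sup>2 * q / (real (Suc n))^4"
    proof (intro divide_right_mono)
      have "(\<Sum>k\<in>tri (Suc n). expectation (\<lambda>\<omega>. (U k \<omega>)\<^sup>2)) \<le> real (card (tri (Suc n))) * q"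
        using sum_bounded_above[of "tri (Suc n)" "\<lambda>k. expectation (\<lambda>\<omega>. (U k \<omega>)\<^sup>2)" q] Uq by auto
      also have "\<dots> \<le> (real (Suc n))\<^sup>2 * q" by (intro mult_right_mono cardI q0)
      finally show "(\<Sum>k\<in>tri (Suc n). expectation (\<lambda>\<omega>. (U k \<omega>)\<^sup>2)) \<le> (real (Suc n))\<^sup>2 * q" .
    qed simp
    also have "\<dots> = q * (1 / (real (Suc n))\<^sup>2)"
      by (simp add: power2_eq_square power4_eq_xxxx field_simps del: of_nat_Suc)
    finally show ?thesis by (simp add: ennreal_leI)
  qed
  have "(\<integral>\<^sup>+\<omega>. (\<Sum>n. ennreal (Z n \<omega>)) \<partial>M) = (\<Sum>n. \<integral>\<^sup>+\<omega>. ennreal (Z n \<omega>) \<partial>M)"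
    by (rule nn_integral_suminf) measurable
  also have "\<dots> \<le> (\<Sum>n. ennreal (q * (1 / (real (Suc n))\<^sup>2)))"
    by (intro suminf_le EZ) auto
  also have "\<dots> < \<infinity>"
  proof -
    have "summable (\<lambda>n. 1 / (real n)\<^sup>2)"
      using inverse_power_summable[of 2, where 'a=real] by (simp add: inverse_eq_divide)
    then have "summable (\<lambda>n. q * (1 / (real (Suc n))\<^sup>2))"
      by (intro summable_mult) (simp add: summable_Suc_iff[of "\<lambda>n. 1 / (real n)\<^sup>2"] del: of_nat_Suc)
    then show ?thesis
      using q0 by (subst suminf_ennreal2) (auto simp: less_top)
  qed
  finally have "AE \<omega> in M. (\<Sum>n. ennreal (Z n \<omega>)) \<noteq> \<infinity>"
    by (intro nn_integral_PInf_AE) auto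
  then show ?thesis
  proof eventually_elim
    case (elim \<omega>)
    then obtain s where s: "(\<Sum>n. ennreal (Z n \<omega>)) = ennreal s" "s \<ge> 0" by (cases "\<Sum>n. ennreal (Z n \<omega>)") auto
    have Zs: "Z n \<omega> \<le> s" for n
    proof -
      have "ennreal (Z n \<omega>) \<le> (\<Sum>n. ennreal (Z n \<omega>))"
        using sum_le_suminf[of "\<lambda>n. ennreal (Z n \<omega>)" "{n}"] by simp
      then show ?thesis using s by (simp add: ennreal_le_iff)
    qed
    have "(\<Sum>k\<in>tri N. V k \<omega>) \<le> (sqrt s + \<bar>\<mu>\<bar>) * (real N)\<^sup>2" for N
    proof (cases N)
      case 0
      then show ?thesis by (simp add: tri_def)
    next
      case (Suc n)
      have "(\<Sum>k\<in>tri N. U k \<omega>) / (real N)\<^sup>2 \<le> sqrt s"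
        using Zs[of n] unfolding Z_def Suc[symmetric] by (rule real_le_rsqrt)
      then have "(\<Sum>k\<in>tri N. U k \<omega>) \<le> sqrt s * (real N)\<^sup>2"
        using Suc by (simp add: pos_divide_le_eq)
      moreover have "(\<Sum>k\<in>tri N. V k \<omega>) = (\<Sum>k\<in>tri N. U k \<omega>) + real (card (tri N)) * \<mu>"
        by (simp add: U_def sum_subtractf)
      moreover have "real (card (tri N)) * \<mu> \<le> (real N)\<^sup>2 * \<bar>\<mu>\<bar>"
      proof -
        have "real (card (tri N)) * \<mu> \<le> real (card (tri N)) * \<bar>\<mu>\<bar>" by (intro mult_left_mono) auto
        also have "\<dots> \<le> (real N)\<^sup>2 * \<bar>\<mu>\<bar>" by (intro mult_right_mono cardI) auto
        finally show ?thesis .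
      qed
      ultimately show ?thesis by (simp add: algebra_simps)
    qed
    then show ?case by blast
  qed
qed

section \<open>Gaussian laws of the increments of fractional Brownian motion\<close>

lemma gaussian_square_integrable:
  assumes "prob_space M" and g: "gaussian M Z"
  shows "integrable M (\<lambda>\<omega>. (Z \<omega>)\<^sup>2)"
proof -
  interpret prob_space M by fact
  have [measurable]: "Z \<in> borel_measurable M" using g by (simp add: gaussian_def)
  from g consider m where "AE \<omega> in M. Z \<omega> = m"
    | m s where "s > 0" "distributed M lborel Z (normal_density m s)" by (auto simp: gaussian_def)
  then show ?thesis
  proof cases
    case 1
    then have "AE \<omega> in M. (Z \<omega>)\<^sup>2 = m\<^sup>2" by auto
    then have "integrable M (\<lambda>\<omega>. (Z \<omega>)\<^sup>2) \<longleftrightarrow> integrable M (\<lambda>_. m\<^sup>2)"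
      by (intro integrable_cong_AE) auto
    then show ?thesis by simp
  next
    case 2
    \<comment> \<open>The identity
      \<open>x\<^sup>2 = (x - m)\<^sup>2 + 2 * m * x - m\<^sup>2\<close> reduces the second moment
      to known moments of the normal density.\<close>
    have "integrable lborel (\<lambda>x. normal_density m s x * (x - m)^2 + 2 * m * (normal_density m s x * x) - m\<^sup>2 * normal_density m s x)"
      using integrable_normal_moment[OF 2(1), of m 2] integrable_normal_moment_nz_1[OF 2(1), of m] 2(1) by auto
    also have "(\<lambda>x. normal_density m s x * (x - m)^2 + 2 * m * (normal_density m s x * x) - m\<^sup>2 * normal_density m s x)
       = (\<lambda>x. normal_density m s x * x\<^sup>2)"
      by (auto simp: power2_diff algebra_simps power2_eq_square)
    finally show ?thesis
      using distributed_integrable[OF 2(2), of "\<lambda>x. x\<^sup>2"] by simp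
  qed
qed

lemma fbm_gaussian_sum:
  assumes "gaussian_process M B" "s \<ge> 0" "t \<ge> 0"
  shows "gaussian M (B t)" and "gaussian M (\<lambda>\<omega>. B t \<omega> - B s \<omega>)"
proof -
  have G: "gaussian M (\<lambda>\<omega>. \<Sum>t\<in>J. c t * B t \<omega>)" if "finite J" "J \<subseteq> {0..}" for J c
    using assms(1) that by (simp add: gaussian_process_def)
  show "gaussian M (B t)" using G[of "{t}" "\<lambda>_. 1"] assms by simp
  show "gaussian M (\<lambda>\<omega>. B t \<omega> - B s \<omega>)"
  \<comment> \<open>The definition sums over a set of times, and \<open>{s, t}\<close> has two
    elements only if \<open>s\<close> differs from \<open>t\<close>.\<close>
  proof (cases "s = t")
    case True
    then show ?thesis using G[of "{}" "\<lambda>_. 1"] by simp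
  next
    case False
    then show ?thesis using G[of "{s, t}" "\<lambda>u. if u = t then 1 else -1"] assms by simp
  qed
qed

lemma fbm_increment_distributed:
  assumes B: "fractional_brownian_motion M H B" and H: "H > 0" and st: "0 \<le> s" "s < t"
  shows "distributed M lborel (\<lambda>\<omega>. B t \<omega> - B s \<omega>) (normal_density 0 ((t - s) powr H))"
proof -
  interpret prob_space M using B by (simp add: fractional_brownian_motion_def)
  have gp: "gaussian_process M B" using B by (simp add: fractional_brownian_motion_def)
  define D where "D = (\<lambda>\<omega>. B t \<omega> - B s \<omega>)"
  have g: "gaussian M D" "gaussian M (B s)" "gaussian M (B t)"
    unfolding D_def using fbm_gaussian_sum[OF gp, of s t] fbm_gaussian_sum[OF gp, of t s] st by auto
  have [measurable]: "B s \<in> borel_measurable M" "B t \<in> borel_measurable M" "D \<in> borel_measurable M"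
    using g by (auto simp: gaussian_def)
  note sq = g[THEN gaussian_square_integrable[OF prob_space_axioms]]
  have int: "integrable M (B s)" "integrable M (B t)" "integrable M D"
    by (rule square_integrable_imp_integrable, measurable, rule sq)+
  have prod: "integrable M (\<lambda>\<omega>. B s \<omega> * B t \<omega>)"
  proof -
    have "integrable M (\<lambda>\<omega>. ((B s \<omega>)\<^sup>2 + (B t \<omega>)\<^sup>2 - (D \<omega>)\<^sup>2) / 2)" using sq by auto
    then show ?thesis by (simp add: D_def power2_diff algebra_simps)
  qed
  have ED: "expectation D = 0"
    unfolding D_def using int B st by (simp add: fractional_brownian_motion_def)
  have cov: "expectation (\<lambda>\<omega>. B u \<omega> * B v \<omega>) = (u powr (2 * H) + v powr (2 * H) - \<bar>v - u\<bar> powr (2 * H)) / 2"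
    if "u \<ge> 0" "v \<ge> 0" for u v using B that by (simp add: fractional_brownian_motion_def)
  have "expectation (\<lambda>\<omega>. (D \<omega>)\<^sup>2) = expectation (\<lambda>\<omega>. B t \<omega> * B t \<omega>) + expectation (\<lambda>\<omega>. B s \<omega> * B s \<omega>) - 2 * expectation (\<lambda>\<omega>. B s \<omega> * B t \<omega>)"
  proof -
    have "(\<lambda>\<omega>. (D \<omega>)\<^sup>2) = (\<lambda>\<omega>. B t \<omega> * B t \<omega> + B s \<omega> * B s \<omega> - 2 * (B s \<omega> * B t \<omega>))"
      by (rule ext) (simp add: D_def power2_eq_square algebra_simps)
    then show ?thesis using sq prod by (simp add: power2_eq_square[of "B _ _"])
  qed
  also have "\<dots> = (t - s) powr (2 * H)"
    using st by (simp add: cov diff_divide_distrib add_divide_distrib)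
  also have "\<dots> = ((t - s) powr H)\<^sup>2"
    by (simp add: power2_eq_square powr_add[symmetric])
  finally have ED2: "expectation (\<lambda>\<omega>. (D \<omega>)\<^sup>2) = ((t - s) powr H)\<^sup>2" .
  have pos: "(t - s) powr H > 0" using st by simp
  from g(1) consider m where "AE \<omega> in M. D \<omega> = m"
    | m v where "v > 0" "distributed M lborel D (normal_density m v)" by (auto simp: gaussian_def)
  then have "distributed M lborel D (normal_density 0 ((t - s) powr H))"
  proof cases
    case 1
    then have "expectation D = expectation (\<lambda>_. m)" by (intro integral_cong_AE) auto
    then have "m = 0" using ED by (simp add: prob_space)
    have "expectation (\<lambda>\<omega>. (D \<omega>)\<^sup>2) = expectation (\<lambda>_. m\<^sup>2)" using 1 by (intro integral_cong_AE) auto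
    then show ?thesis using \<open>m = 0\<close> ED2 pos by simp
  next
    case 2
    have m: "m = 0" using normal_distributed_expectation[OF 2] ED by simp
    have "v\<^sup>2 = ((t - s) powr H)\<^sup>2" using normal_distributed_variance[OF 2] ED ED2 by simp
    then have "v = (t - s) powr H" using 2(1) pos by (simp add: power2_eq_iff_nonneg)
    then show ?thesis using 2(2) m by simp
  qed
  then show ?thesis by (simp add: D_def)
qed

text \<open>The exponent \<open>1 / (4 * v\<^sup>2)\<close> is half of the one in the density, so
  the product is a Gaussian density of variance \<open>2 * v\<^sup>2\<close>, up to the ratio
  \<open>sqrt 2\<close> of the normalising constants.\<close>

lemma normal_exp_square_integral:
  assumes D: "distributed M lborel Z (normal_density 0 v)" and v: "v > 0"
  shows "(\<integral>\<^sup>+\<omega>. ennreal (exp ((Z \<omega>)\<^sup>2 / (4 * v\<^sup>2))) \<partial>M) = ennreal (sqrt 2)"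
proof -
  have "(\<integral>\<^sup>+\<omega>. ennreal (exp ((Z \<omega>)\<^sup>2 / (4 * v\<^sup>2))) \<partial>M)
      = (\<integral>\<^sup>+x. ennreal (normal_density 0 v x) * ennreal (exp (x\<^sup>2 / (4 * v\<^sup>2))) \<partial>lborel)"
    by (rule distributed_nn_integral[OF D, symmetric]) measurable
  also have "\<dots> = (\<integral>\<^sup>+x. ennreal (sqrt 2) * ennreal (normal_density 0 (sqrt 2 * v) x) \<partial>lborel)"
  proof (rule nn_integral_cong)
    fix x
    have e: "exp (- x\<^sup>2 / (2 * v\<^sup>2)) * exp (x\<^sup>2 / (4 * v\<^sup>2)) = exp (- x\<^sup>2 / (2 * (2 * v\<^sup>2)))"
      unfolding exp_add[symmetric] using v by (intro arg_cong[of _ _ exp]) (simp add: field_simps)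
    have "normal_density 0 v x * exp (x\<^sup>2 / (4 * v\<^sup>2)) = 1 / sqrt (2 * pi * v\<^sup>2) * exp (- x\<^sup>2 / (2 * (2 * v\<^sup>2)))"
      unfolding normal_density_def using e by simp
    also have "\<dots> = sqrt 2 * normal_density 0 (sqrt 2 * v) x"
    proof -
      have "1 / sqrt (2 * pi * v\<^sup>2) = sqrt 2 * (1 / sqrt (2 * pi * (sqrt 2 * v)\<^sup>2))"
      proof -
        have "sqrt (2 * pi * (sqrt 2 * v)\<^sup>2) = sqrt 2 * sqrt (2 * pi * v\<^sup>2)"
          by (simp add: power_mult_distrib real_sqrt_mult)
        then show ?thesis by simp
      qed
      then show ?thesis unfolding normal_density_def by (simp add: power_mult_distrib)
    qed
    finally show "ennreal (normal_density 0 v x) * ennreal (exp (x\<^sup>2 / (4 * v\<^sup>2)))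
        = ennreal (sqrt 2) * ennreal (normal_density 0 (sqrt 2 * v) x)"
      by (simp add: ennreal_mult[symmetric])
  qed
  also have "\<dots> = ennreal (sqrt 2) * (\<integral>\<^sup>+x. ennreal (normal_density 0 (sqrt 2 * v) x) \<partial>lborel)"
    by (rule nn_integral_cmult) measurable
  also have "(\<integral>\<^sup>+x. ennreal (normal_density 0 (sqrt 2 * v) x) \<partial>lborel) = 1"
    using v by (subst nn_integral_eq_integral) auto
  finally show ?thesis by simp
qed

section \<open>Young estimates on dyadic points\<close>

definition dy :: "real \<Rightarrow> nat \<Rightarrow> nat \<Rightarrow> real" where
  "dy T k j = real j * T / 2 ^ k"

definition dinc :: "real \<Rightarrow> (real \<Rightarrow> real) \<Rightarrow> nat \<Rightarrow> nat \<Rightarrow> real" where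
  "dinc T f k j = f (dy T k (Suc j)) - f (dy T k j)"

lemma dy_refine: "dy T (k + n) (2 ^ n * j) = dy T k j"
  by (simp add: dy_def power_add)

lemma dy_Suc_double: "dy T (Suc k) (2 * j) = dy T k j"
  using dy_refine[of T k 1 j] by simp

lemma dy_0 [simp]: "dy T k 0 = 0" by (simp add: dy_def)

lemma dy_mono: "T \<ge> 0 \<Longrightarrow> i \<le> j \<Longrightarrow> dy T k i \<le> dy T k j"
  by (simp add: dy_def divide_right_mono mult_right_mono)

lemma dy_nonneg: "T \<ge> 0 \<Longrightarrow> dy T k j \<ge> 0"
  by (simp add: dy_def)

lemma dy_in: "T \<ge> 0 \<Longrightarrow> j \<le> 2 ^ k \<Longrightarrow> dy T k j \<in> {0..T}"
  using dy_mono[of T j "2 ^ k" k] by (simp add: dy_nonneg) (simp add: dy_def)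

text \<open>Keeps descendants in range: a subinterval, \<open>n\<close> levels down, of interval
  \<open>i\<close> of level \<open>m\<close> is an interval of level \<open>m + n\<close>.\<close>

lemma dyadic_descendant_less:
  fixes i l m n :: nat
  assumes "i < 2 ^ m" "l < 2 ^ n * Suc i"
  shows "l < 2 ^ (m + n)"
proof -
  have "2 ^ n * Suc i \<le> 2 ^ n * 2 ^ m" using assms(1) by (intro mult_left_mono) auto
  then show ?thesis using assms(2) by (simp add: power_add mult.commute)
qed

lemma dy_diff: "dy T k (Suc j) - dy T k j = T / 2 ^ k"
  by (simp add: dy_def field_simps)

section \<open>Riemann-Stieltjes sums and chaining on dyadic grids\<close>

lemma uniform_tagged_division:
  fixes h :: real
  assumes h: "h > 0"
  shows "(\<lambda>l. (real l * h, {real l * h..real (Suc l) * h})) ` {..m} tagged_division_of {0..real (Suc m) * h}"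
proof (induction m)
  case 0
  have "{(0, cbox 0 h)} tagged_division_of cbox 0 h"
    using h by (intro tagged_division_of_self) auto
  then show ?case by simp
next
  case (Suc m)
  let ?a = "real (Suc m) * h" and ?b = "real (Suc (Suc m)) * h"
  have ab: "?a \<le> ?b" "0 \<le> ?a" using h by (auto intro!: mult_right_mono)
  have "{(?a, cbox ?a ?b)} tagged_division_of cbox ?a ?b"
    using ab by (intro tagged_division_of_self) auto
  from tagged_division_Un[OF Suc.IH this]
  have "(\<lambda>l. (real l * h, {real l * h..real (Suc l) * h})) ` {..m} \<union> {(?a, {?a..?b})} tagged_division_of {0..?a} \<union> {?a..?b}"
    by (simp add: interior_atLeastAtMost_real del: of_nat_Suc)
  moreover have "{0..?a} \<union> {?a..?b} = {0..?b}" using ab by auto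
  ultimately show ?case by (simp add: atMost_Suc del: of_nat_Suc)
qed

text \<open>The left-endpoint sums on dyadic grids are tagged sums whose mesh tends to
  \<open>0\<close>. For \<open>j = 0\<close> the sums are empty and their limit is \<open>0\<close>,
  hence the side condition on \<open>I\<close>.\<close>

lemma has_RS_integral_dyadic_limit:
  assumes T: "T > 0" and RS: "has_RS_integral f g 0 (dy T k j) I" and I0: "j = 0 \<Longrightarrow> I = 0"
  shows "(\<lambda>n. \<Sum>l<2 ^ n * j. f (dy T (k + n) l) * dinc T g (k + n) l) \<longlonglongrightarrow> I"
proof (cases "j = 0")
  case True
  then show ?thesis using I0 by simp
next
  case False
  show ?thesis
  proof (rule LIMSEQ_I)
    fix e :: real assume "e > 0"
    then obtain d where d: "d > 0" and close: "\<And>p. p tagged_division_of {0..dy T k j} \<Longrightarrow> (\<lambda>x. ball x d) fine p \<Longrightarrow>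
        \<bar>(\<Sum>(x, K)\<in>p. f x * (g (Sup K) - g (Inf K))) - I\<bar> < e"
      using RS unfolding has_RS_integral_def by meson
    have "(\<lambda>n. (1/2) ^ n * (T / 2 ^ k)) \<longlonglongrightarrow> 0 * (T / 2 ^ k)"
      by (intro tendsto_mult_right LIMSEQ_realpow_zero) auto
    then have "\<forall>\<^sub>F n in sequentially. (1/2) ^ n * (T / 2 ^ k) < d"
      using d order_tendstoD(2)[of "\<lambda>n. (1/2) ^ n * (T / 2 ^ k)" 0 sequentially d] by simp
    then obtain n0 where n0: "\<And>n. n \<ge> n0 \<Longrightarrow> (1/2) ^ n * (T / 2 ^ k) < d"
      by (auto simp: eventually_sequentially)
    show "\<exists>no. \<forall>n\<ge>no. norm ((\<Sum>l<2 ^ n * j. f (dy T (k + n) l) * dinc T g (k + n) l) - I) < e"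
    proof (intro exI allI impI)
      fix n assume n: "n \<ge> n0"
      define h where "h = T / 2 ^ (k + n)"
      have h: "h > 0" "h < d" using T n0[OF n] by (auto simp: h_def power_add field_simps)
      obtain m where m: "2 ^ n * j = Suc m" using False by (cases "2 ^ n * j") auto
      have dyh: "dy T (k + n) l = real l * h" for l by (simp add: dy_def h_def)
      define p where "p = (\<lambda>l. (real l * h, {real l * h..real (Suc l) * h})) ` {..m}"
      have "real (Suc m) * h = dy T k j" unfolding m[symmetric] dyh[symmetric] by (rule dy_refine)
      then have "p tagged_division_of {0..dy T k j}"
        using uniform_tagged_division[OF h(1), of m] by (simp add: p_def)
      moreover have "(\<lambda>x. ball x d) fine p"
        unfolding fine_def p_def using h by (auto simp: dist_real_def algebra_simps)
      ultimately have "\<bar>(\<Sum>(x, K)\<in>p. f x * (g (Sup K) - g (Inf K))) - I\<bar> < e" by (rule close)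
      also have "(\<Sum>(x, K)\<in>p. f x * (g (Sup K) - g (Inf K))) = (\<Sum>l<2 ^ n * j. f (dy T (k + n) l) * dinc T g (k + n) l)"
        unfolding p_def m lessThan_Suc_atMost
      proof (subst sum.reindex)
        show "inj_on (\<lambda>l. (real l * h, {real l * h..real (Suc l) * h})) {..m}"
          using h by (auto simp: inj_on_def)
        have "real l * h \<le> real (Suc l) * h" for l using h by (intro mult_right_mono) auto
        then show "sum ((\<lambda>(x, K). f x * (g (Sup K) - g (Inf K))) \<circ> (\<lambda>l. (real l * h, {real l * h..real (Suc l) * h}))) {..m}
            = (\<Sum>l\<le>m. f (dy T (k + n) l) * dinc T g (k + n) l)"
          by (intro sum.cong) (simp_all add: dinc_def dyh del: of_nat_Suc)
      qed
      finally show "norm ((\<Sum>l<2 ^ n * j. f (dy T (k + n) l) * dinc T g (k + n) l) - I) < e" by simp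
    qed
  qed
qed

lemma sum_double_interval:
  fixes F :: "nat \<Rightarrow> real"
  shows "(\<Sum>l = 2 * a..<2 * b. F l) = (\<Sum>l = a..<b. F (2 * l) + F (Suc (2 * l)))"
proof (induction b)
  case (Suc b)
  then show ?case by (cases "a \<le> b") auto
qed simp

text \<open>Passing from one dyadic level to the next changes the Riemann sum only by
  products of increments over neighbouring intervals.\<close>

lemma young_dyadic_estimate:
  assumes u: "u \<ge> 0" and v: "v \<ge> 0" and uv: "2 * (u * v) < 1" and a: "a \<ge> 0" and c: "c \<ge> 0"
    and f: "\<And>n l. 2 ^ n * j \<le> l \<Longrightarrow> l < 2 ^ n * Suc j \<Longrightarrow> \<bar>dinc T f (k + n) l\<bar> \<le> a * u ^ (k + n)"
    and g: "\<And>n l. 2 ^ n * j \<le> l \<Longrightarrow> l < 2 ^ n * Suc j \<Longrightarrow> \<bar>dinc T g (k + n) l\<bar> \<le> c * v ^ (k + n)"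
    and lim: "(\<lambda>n. \<Sum>l = 2 ^ n * j..<2 ^ n * Suc j. f (dy T (k + n) l) * dinc T g (k + n) l) \<longlonglongrightarrow> I"
  shows "\<bar>I - f (dy T k j) * dinc T g k j\<bar> \<le> a * c * (u * v) ^ k / (1 - 2 * (u * v))"
proof -
  define R where "R n = (\<Sum>l = 2 ^ n * j..<2 ^ n * Suc j. f (dy T (k + n) l) * dinc T g (k + n) l)" for n
  have step: "\<bar>R (Suc n) - R n\<bar> \<le> a * c * (u * v) ^ k * (2 * (u * v)) ^ n" for n
  proof -
    let ?K = "Suc (k + n)"
    \<comment> \<open>Splitting an interval at its midpoint changes the left-point sum by the
      increment of \<open>f\<close> on the left half times that of \<open>g\<close> on the right
      half.\<close>
    have e: "f (dy T ?K (2 * l)) * dinc T g ?K (2 * l) + f (dy T ?K (Suc (2 * l))) * dinc T g ?K (Suc (2 * l))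
        - f (dy T (k + n) l) * dinc T g (k + n) l = dinc T f ?K (2 * l) * dinc T g ?K (Suc (2 * l))" for l
    proof -
      have "dy T ?K (Suc (Suc (2 * l))) = dy T (k + n) (Suc l)" using dy_Suc_double[of T "k + n" "Suc l"] by simp
      then show ?thesis unfolding dinc_def dy_Suc_double by (simp only:) (simp add: algebra_simps dy_Suc_double)
    qed
    have "R (Suc n) = (\<Sum>l = 2 * (2 ^ n * j)..<2 * (2 ^ n * Suc j). f (dy T ?K l) * dinc T g ?K l)"
      by (simp only: R_def power_Suc add_Suc_right mult.assoc)
    then have "R (Suc n) - R n = (\<Sum>l = 2 ^ n * j..<2 ^ n * Suc j. dinc T f ?K (2 * l) * dinc T g ?K (Suc (2 * l)))"
      by (simp only: sum_double_interval R_def[of n] sum_subtractf[symmetric] e)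
    also have "\<bar>\<dots>\<bar> \<le> (\<Sum>l = 2 ^ n * j..<2 ^ n * Suc j. a * u ^ ?K * (c * v ^ ?K))"
    proof (rule order_trans[OF sum_abs], rule sum_mono)
      fix l assume "l \<in> {2 ^ n * j..<2 ^ n * Suc j}"
      then have l: "2 ^ Suc n * j \<le> 2 * l" "2 * l < 2 ^ Suc n * Suc j" "2 ^ Suc n * j \<le> Suc (2 * l)" "Suc (2 * l) < 2 ^ Suc n * Suc j"
        by auto
      show "\<bar>dinc T f ?K (2 * l) * dinc T g ?K (Suc (2 * l))\<bar> \<le> a * u ^ ?K * (c * v ^ ?K)"
        unfolding abs_mult using f[OF l(1,2)] g[OF l(3,4)] a u by (intro mult_mono) auto
    qed
    \<comment> \<open>Interval \<open>j\<close> has \<open>2 ^ n\<close> descendants at level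
      \<open>k + n\<close>, which turns the decay \<open>(u * v) ^ n\<close> into the ratio
      \<open>2 * (u * v)\<close>. With \<open>u\<close> and \<open>v\<close> equal to 2 to the power
      minus a Hoelder order, a ratio below \<open>1\<close> is Young's condition that the two orders
      add up to more than 1.\<close>
    also have "\<dots> = 2 ^ n * (a * c * (u * v) ^ ?K)" by (simp add: power_mult_distrib mult_ac)
    also have "\<dots> = a * c * (u * v) ^ k * (2 * (u * v)) ^ n * (u * v)"
      by (simp add: power_add power_mult_distrib mult_ac)
    also have "\<dots> \<le> a * c * (u * v) ^ k * (2 * (u * v)) ^ n * 1"
      using a c u v uv mult_nonneg_nonneg[OF u v] by (intro mult_left_mono) auto
    finally show ?thesis by simp
  qed
  have R0: "R 0 = f (dy T k j) * dinc T g k j" by (simp add: R_def)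
  have p0: "0 \<le> 2 * (u * v)" using u v by simp
  have "\<bar>R n - R 0\<bar> \<le> a * c * (u * v) ^ k / (1 - 2 * (u * v))" for n
  proof -
    have "\<bar>R n - R 0\<bar> = \<bar>\<Sum>i<n. R (Suc i) - R i\<bar>" by (simp add: sum_lessThan_telescope)
    also have "\<dots> \<le> (\<Sum>i<n. a * c * (u * v) ^ k * (2 * (u * v)) ^ i)"
      by (rule order_trans[OF sum_abs]) (intro sum_mono step)
    also have "\<dots> = a * c * (u * v) ^ k * (\<Sum>i<n. (2 * (u * v)) ^ i)" by (simp add: sum_distrib_left)
    also have "(\<Sum>i<n. (2 * (u * v)) ^ i) \<le> (\<Sum>i. (2 * (u * v)) ^ i)"
      using p0 uv by (intro sum_le_suminf summable_geometric) auto
    also have "\<dots> = 1 / (1 - 2 * (u * v))" using p0 uv by (intro suminf_geometric) auto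
    finally show ?thesis using a c u v by (simp add: mult_left_mono)
  qed
  moreover have "(\<lambda>n. \<bar>R n - R 0\<bar>) \<longlonglongrightarrow> \<bar>I - R 0\<bar>"
    using lim unfolding R_def[symmetric] by (intro tendsto_intros)
  ultimately have "\<bar>I - R 0\<bar> \<le> a * c * (u * v) ^ k / (1 - 2 * (u * v))"
    by (intro LIMSEQ_le_const2) auto
  then show ?thesis by (simp add: R0)
qed

text \<open>Chaining: a dyadic point is reached from the left endpoint by at most one interval of
  each level, so the increments add up to a geometric series; continuity passes to arbitrary
  \<open>t\<close>.\<close>

lemma dyadic_oscillation:
  assumes T: "T > 0" and v: "0 \<le> v" "v < 1" and q: "q \<ge> 0"
    and cont: "continuous_on {dy T m i..dy T m (Suc i)} x"
    and bd: "\<And>n l. 2 ^ n * i \<le> l \<Longrightarrow> l < 2 ^ n * Suc i \<Longrightarrow> \<bar>dinc T x (m + n) l\<bar> \<le> q * v ^ (m + n)"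
    and t: "t \<in> {dy T m i..dy T m (Suc i)}"
  shows "\<bar>x t - x (dy T m i)\<bar> \<le> q * v ^ m / (1 - v)"
proof -
  have P: "\<bar>x (dy T (m + n) l) - x (dy T m i)\<bar> \<le> q * v ^ m * (\<Sum>r\<le>n. v ^ r)"
    if "2 ^ n * i \<le> l" "l \<le> 2 ^ n * Suc i" for n l
    using that
  proof (induction n arbitrary: l)
    case 0
    then have "l = i \<or> l = Suc i" by auto
    then show ?case using bd[of 0 i] q v by (auto simp: dinc_def)
  next
    case (Suc n)
    show ?case
    \<comment> \<open>An even index names a point of the coarser grid; an odd one is one fine
      interval away from such a point.\<close>
    proof (cases "even l")
      case True
      then obtain l' where l': "l = 2 * l'" by auto
      have "\<bar>x (dy T (m + n) l') - x (dy T m i)\<bar> \<le> q * v ^ m * (\<Sum>r\<le>n. v ^ r)"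
        using Suc l' by (intro Suc.IH) auto
      also have "\<dots> \<le> q * v ^ m * (\<Sum>r\<le>Suc n. v ^ r)" using q v by (intro mult_left_mono) auto
      finally show ?thesis by (simp add: l' dy_Suc_double)
    next
      case False
      then obtain l' where l': "l = Suc (2 * l')" by (auto elim: oddE)
      have l'b: "2 ^ n * i \<le> l'" "l' < 2 ^ n * Suc i" using Suc.prems unfolding l' by auto
      have "\<bar>x (dy T (m + n) l') - x (dy T m i)\<bar> \<le> q * v ^ m * (\<Sum>r\<le>n. v ^ r)"
        using l'b by (intro Suc.IH) auto
      moreover have "\<bar>dinc T x (m + Suc n) (2 * l')\<bar> \<le> q * v ^ (m + Suc n)"
        using l'b by (intro bd) auto
      ultimately have "\<bar>x (dy T (m + Suc n) l) - x (dy T m i)\<bar> \<le> q * v ^ m * (\<Sum>r\<le>n. v ^ r) + q * v ^ (m + Suc n)"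
        unfolding l' dinc_def by (simp add: dy_Suc_double)
      also have "\<dots> = q * v ^ m * (\<Sum>r\<le>Suc n. v ^ r)" by (simp add: power_add distrib_left)
      finally show ?thesis .
    qed
  qed
  have geo: "(\<Sum>r\<le>n. v ^ r) \<le> 1 / (1 - v)" for n
  proof -
    have "(\<Sum>r\<le>n. v ^ r) \<le> (\<Sum>r. v ^ r)" using v by (intro sum_le_suminf summable_geometric) auto
    also have "\<dots> = 1 / (1 - v)" using v by (intro suminf_geometric) auto
    finally show ?thesis .
  qed
  \<comment> \<open>The largest grid index at or below \<open>t\<close>; the corresponding points
    converge to \<open>t\<close> and stay in the interval.\<close>
  define l where "l n = nat \<lfloor>t * 2 ^ (m + n) / T\<rfloor>" for n
  have t0: "t \<ge> 0" using t dy_nonneg[of T m i] T by auto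
  have tl: "real i \<le> t * 2 ^ m / T" "t * 2 ^ m / T \<le> real (Suc i)"
    using t T unfolding dy_def by (auto simp: field_simps)
  have lr: "real (l n) \<le> t * 2 ^ (m + n) / T" "t * 2 ^ (m + n) / T < real (l n) + 1" for n
    unfolding l_def using t0 T by (auto simp: of_nat_nat)
  have lb: "2 ^ n * i \<le> l n" "l n \<le> 2 ^ n * Suc i" for n
  proof -
    have e: "t * 2 ^ (m + n) / T = 2 ^ n * (t * 2 ^ m / T)" by (simp add: power_add)
    have "real (2 ^ n * i) < real (l n) + 1"
      using mult_left_mono[OF tl(1), of "2 ^ n"] lr(2)[of n] unfolding e by simp
    then show "2 ^ n * i \<le> l n" by linarith
    have "real (l n) \<le> real (2 ^ n * Suc i)"
      using mult_left_mono[OF tl(2), of "2 ^ n"] lr(1)[of n] unfolding e by (simp del: of_nat_Suc mult_Suc_right)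
    then show "l n \<le> 2 ^ n * Suc i" by linarith
  qed
  have conv: "(\<lambda>n. dy T (m + n) (l n)) \<longlonglongrightarrow> t"
  proof -
    have "\<bar>dy T (m + n) (l n) - t\<bar> \<le> (1/2) ^ n * (T / 2 ^ m)" for n
    proof -
      have "dy T (m + n) (l n) \<le> t" "t \<le> dy T (m + n) (l n) + T / 2 ^ (m + n)"
        using lr[of n] T unfolding dy_def by (auto simp: field_simps)
      then show ?thesis by (simp add: power_add power_one_over field_simps)
    qed
    moreover have "(\<lambda>n. (1/2) ^ n * (T / 2 ^ m)) \<longlonglongrightarrow> 0"
      using tendsto_mult_right[OF LIMSEQ_realpow_zero[of "1/2::real"], of "T / 2 ^ m"] by simp
    ultimately have "(\<lambda>n. dy T (m + n) (l n) - t) \<longlonglongrightarrow> 0"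
      by (intro Lim_null_comparison[where f="\<lambda>n. dy T (m + n) (l n) - t" and g="\<lambda>n. (1/2) ^ n * (T / 2 ^ m)"]) auto
    then show ?thesis by (simp add: LIM_zero_iff)
  qed
  have inI: "dy T (m + n) (l n) \<in> {dy T m i..dy T m (Suc i)}" for n
    using dy_mono[OF less_imp_le[OF T] lb(1)[of n], of "m + n"] dy_mono[OF less_imp_le[OF T] lb(2)[of n], of "m + n"]
    unfolding dy_refine by simp
  have "(\<lambda>n. x (dy T (m + n) (l n))) \<longlonglongrightarrow> x t"
    using continuous_on_tendsto_compose[OF cont conv t] inI by simp
  then have "(\<lambda>n. \<bar>x (dy T (m + n) (l n)) - x (dy T m i)\<bar>) \<longlonglongrightarrow> \<bar>x t - x (dy T m i)\<bar>"
    by (intro tendsto_intros)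
  moreover have "\<bar>x (dy T (m + n) (l n)) - x (dy T m i)\<bar> \<le> q * v ^ m * (1 / (1 - v))" for n
    using P[OF lb] geo[of n] q v by (meson mult_left_mono order_trans mult_nonneg_nonneg zero_le_power)
  ultimately have "\<bar>x t - x (dy T m i)\<bar> \<le> q * v ^ m * (1 / (1 - v))"
    by (intro LIMSEQ_le_const2) auto
  then show ?thesis by simp
qed

section \<open>Local bounds for solutions\<close>

text \<open>A single sample path of the equation, with all randomness removed. \<open>Lip\<close> is
  a common Lipschitz constant, taken at least \<open>1\<close> so that it can absorb other
  factors.\<close>

locale rs_solution =
  fixes T Lip :: real and \<sigma> b x B :: "real \<Rightarrow> real"
  assumes T: "T > 0"
    and RS: "\<And>t. t \<in> {0..T} \<Longrightarrow> has_RS_integral (\<lambda>r. \<sigma> (x r)) B 0 t (x t - x 0 - integral {0..t} (\<lambda>r. b (x r)))"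
    and L: "Lip \<ge> 1"
    and lip: "\<And>y z. \<bar>\<sigma> y - \<sigma> z\<bar> \<le> Lip * \<bar>y - z\<bar>"
    and lipb: "\<And>y z. \<bar>b y - b z\<bar> \<le> Lip * \<bar>y - z\<bar>"
    and contx: "continuous_on {0..T} x"
begin

lemma coefficients_continuous: "continuous_on UNIV \<sigma>" "continuous_on UNIV b"
  using lip lipb L by (auto intro!: lipschitz_on_continuous_on[of Lip] lipschitz_onI simp: dist_real_def)

text \<open>Freezing \<sigma> at the left endpoint leaves the Young remainder and the drift. The
  bounds on \<open>x\<close> and \<open>B\<close> are asked only on descendants of the interval, so
  that they can be applied with a local Hoelder constant.\<close>

lemma increment_bound:
  assumes j: "j < 2 ^ k"
    and u: "u \<ge> 0" and v: "v \<ge> 0" and uv: "2 * (u * v) < 1" and q: "q \<ge> 0" and c: "c \<ge> 0"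
    and xb: "\<And>n l. 2 ^ n * j \<le> l \<Longrightarrow> l < 2 ^ n * Suc j \<Longrightarrow> \<bar>dinc T x (k + n) l\<bar> \<le> q * u ^ (k + n)"
    and Bb: "\<And>n l. 2 ^ n * j \<le> l \<Longrightarrow> l < 2 ^ n * Suc j \<Longrightarrow> \<bar>dinc T B (k + n) l\<bar> \<le> c * v ^ (k + n)"
    and bb: "\<And>t. t \<in> {dy T k j..dy T k (Suc j)} \<Longrightarrow> \<bar>b (x t)\<bar> \<le> \<beta>"
  shows "\<bar>dinc T x k j\<bar> \<le> \<bar>\<sigma> (x (dy T k j))\<bar> * \<bar>dinc T B k j\<bar>
     + Lip * q * c * (u * v) ^ k / (1 - 2 * (u * v)) + T * \<beta> / 2 ^ k"
proof -
  let ?s = "dy T k j" and ?t = "dy T k (Suc j)"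
  have s: "?s \<in> {0..T}" and t: "?t \<in> {0..T}" using dy_in[of T _ k] T j by auto
  have st: "?s \<le> ?t" using dy_mono[of T j "Suc j" k] T by simp
  define I where "I r = x r - x 0 - integral {0..r} (\<lambda>r. b (x r))" for r
  have L0: "0 \<le> Lip" using L by simp
  have contbx: "continuous_on {0..T} (\<lambda>r. b (x r))"
    using continuous_on_compose2[OF coefficients_continuous(2) contx] by simp
  have int: "(\<lambda>r. b (x r)) integrable_on {a..a'}" if "0 \<le> a" "a' \<le> T" for a a'
    by (rule integrable_continuous_interval) (rule continuous_on_subset[OF contbx], use that in auto)
  let ?S = "\<lambda>n A. \<Sum>l\<in>A. \<sigma> (x (dy T (k + n) l)) * dinc T B (k + n) l"
  \<comment> \<open>The equation is given on intervals starting at \<open>0\<close> only; the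
    integral from \<open>?s\<close> to \<open>?t\<close> is a difference of two of them, and so are
    its Riemann sums.\<close>
  have "(\<lambda>n. ?S n {..<2 ^ n * Suc j} - ?S n {..<2 ^ n * j}) \<longlonglongrightarrow> I ?t - I ?s"
  proof (rule tendsto_diff)
    show "(\<lambda>n. ?S n {..<2 ^ n * Suc j}) \<longlonglongrightarrow> I ?t"
      by (rule has_RS_integral_dyadic_limit[OF T]) (use RS[OF t] in \<open>auto simp: I_def\<close>)
    show "(\<lambda>n. ?S n {..<2 ^ n * j}) \<longlonglongrightarrow> I ?s"
      by (rule has_RS_integral_dyadic_limit[OF T]) (use RS[OF s] in \<open>auto simp: I_def\<close>)
  qed
  also have "(\<lambda>n. ?S n {..<2 ^ n * Suc j} - ?S n {..<2 ^ n * j}) = (\<lambda>n. ?S n {2 ^ n * j..<2 ^ n * Suc j})"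
    by (rule ext) (simp add: lessThan_atLeast0 sum_diff_nat_ivl)
  finally have lim: "(\<lambda>n. \<Sum>l = 2 ^ n * j..<2 ^ n * Suc j. \<sigma> (x (dy T (k + n) l)) * dinc T B (k + n) l) \<longlonglongrightarrow> I ?t - I ?s" .
  have "\<bar>(I ?t - I ?s) - \<sigma> (x ?s) * dinc T B k j\<bar> \<le> (Lip * q) * c * (u * v) ^ k / (1 - 2 * (u * v))"
  proof (rule young_dyadic_estimate[where f="\<lambda>r. \<sigma> (x r)", OF u v uv _ c _ Bb lim])
    show "0 \<le> Lip * q" using L0 q by simp
    fix n l assume nl: "2 ^ n * j \<le> l" "l < 2 ^ n * Suc j"
    have "\<bar>dinc T (\<lambda>r. \<sigma> (x r)) (k + n) l\<bar> \<le> Lip * \<bar>dinc T x (k + n) l\<bar>"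
      unfolding dinc_def by (rule lip)
    also have "\<dots> \<le> Lip * (q * u ^ (k + n))" by (intro mult_left_mono xb nl L0)
    finally show "\<bar>dinc T (\<lambda>r. \<sigma> (x r)) (k + n) l\<bar> \<le> Lip * q * u ^ (k + n)" by simp
  qed
  moreover have "dinc T x k j = (I ?t - I ?s) + integral {?s..?t} (\<lambda>r. b (x r))"
  proof -
    have "integral {0..?s} (\<lambda>r. b (x r)) + integral {?s..?t} (\<lambda>r. b (x r)) = integral {0..?t} (\<lambda>r. b (x r))"
      using s t st int by (intro Henstock_Kurzweil_Integration.integral_combine) auto
    then show ?thesis by (simp add: I_def dinc_def)
  qed
  moreover have "\<bar>integral {?s..?t} (\<lambda>r. b (x r))\<bar> \<le> T * \<beta> / 2 ^ k"
  proof -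
    have "norm (integral {?s..?t} (\<lambda>r. b (x r))) \<le> \<beta> * (?t - ?s)"
      using s t st bb by (intro integral_bound continuous_on_subset[OF contbx]) auto
    then show ?thesis by (simp add: dy_diff mult.commute)
  qed
  moreover have "\<bar>\<sigma> (x ?s) * dinc T B k j\<bar> = \<bar>\<sigma> (x ?s)\<bar> * \<bar>dinc T B k j\<bar>" by (rule abs_mult)
  ultimately show ?thesis by linarith
qed

text \<open>Bootstrapping: \<open>u\<close> is the rough decay of the solution and \<open>w\<close>
  one of \<open>B\<close> that matches it in Young's condition. The remainder decays like
  \<open>(u * w) ^ k\<close>, faster than \<open>(1 / 2) ^ k\<close>, so the solution inherits the
  decay \<open>v\<close> of \<open>B\<close>. The resulting constant is finite but carries no moment
  bound.\<close>

lemma dyadic_regularity: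
  assumes u: "u \<ge> 0" and w: "w \<ge> 0" and uw: "2 * (u * w) < 1"
    and v: "1 / 2 \<le> v"
    and xb: "\<And>k j. j < 2 ^ k \<Longrightarrow> \<bar>dinc T x k j\<bar> \<le> a * u ^ k"
    and Bw: "\<And>k j. j < 2 ^ k \<Longrightarrow> \<bar>dinc T B k j\<bar> \<le> c * w ^ k"
    and Bv: "\<And>k j. j < 2 ^ k \<Longrightarrow> \<bar>dinc T B k j\<bar> \<le> g * v ^ k"
  shows "\<exists>Q. \<forall>k. \<forall>j<2 ^ k. \<bar>dinc T x k j\<bar> \<le> Q * v ^ k"
proof -
  have a: "a \<ge> 0" using xb[of 0 0] by simp
  have c: "c \<ge> 0" using Bw[of 0 0] by simp
  have g: "g \<ge> 0" using Bv[of 0 0] by simp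
  note cc = coefficients_continuous
  have bdd: "\<exists>S. \<forall>t\<in>{0..T}. \<bar>f (x t)\<bar> \<le> S" if "continuous_on UNIV f" for f :: "real \<Rightarrow> real"
  proof -
    have "compact ((\<lambda>t. f (x t)) ` {0..T})"
      by (intro compact_continuous_image compact_Icc continuous_on_compose2[OF that contx]) simp
    then show ?thesis by (auto dest!: compact_imp_bounded simp: bounded_iff)
  qed
  obtain S where S: "\<And>t. t \<in> {0..T} \<Longrightarrow> \<bar>\<sigma> (x t)\<bar> \<le> S" using bdd[OF cc(1)] by blast
  obtain S' where S': "\<And>t. t \<in> {0..T} \<Longrightarrow> \<bar>b (x t)\<bar> \<le> S'" using bdd[OF cc(2)] by blast
  have S0: "S \<ge> 0" "S' \<ge> 0" using S[of 0] S'[of 0] T by auto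
  define Q where "Q = S * g + Lip * a * c / (1 - 2 * (u * w)) + T * S'"
  have "\<bar>dinc T x k j\<bar> \<le> Q * v ^ k" if j: "j < 2 ^ k" for k j
  proof -
    note sub = dyadic_descendant_less[OF j]
    have st: "dy T k j \<in> {0..T}" "dy T k (Suc j) \<in> {0..T}" using dy_in[of T _ k] T j by auto
    have "\<bar>dinc T x k j\<bar> \<le> \<bar>\<sigma> (x (dy T k j))\<bar> * \<bar>dinc T B k j\<bar>
        + Lip * a * c * (u * w) ^ k / (1 - 2 * (u * w)) + T * S' / 2 ^ k"
    proof (rule increment_bound[OF j u w uw a c])
      fix n l assume "l < 2 ^ n * Suc j"
      then show "\<bar>dinc T x (k + n) l\<bar> \<le> a * u ^ (k + n)" "\<bar>dinc T B (k + n) l\<bar> \<le> c * w ^ (k + n)"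
        by (intro xb Bw sub; assumption)+
    next
      fix t assume "t \<in> {dy T k j..dy T k (Suc j)}"
      then show "\<bar>b (x t)\<bar> \<le> S'" using st by (intro S') auto
    qed
    moreover have "\<bar>\<sigma> (x (dy T k j))\<bar> * \<bar>dinc T B k j\<bar> \<le> S * (g * v ^ k)"
      using S[OF st(1)] Bv[OF j] S0 by (intro mult_mono) auto
    moreover have "Lip * a * c * (u * w) ^ k / (1 - 2 * (u * w)) \<le> Lip * a * c / (1 - 2 * (u * w)) * v ^ k"
    proof -
      have "(u * w) ^ k \<le> v ^ k" using u w uw v by (intro power_mono) auto
      then have "Lip * a * c / (1 - 2 * (u * w)) * (u * w) ^ k \<le> Lip * a * c / (1 - 2 * (u * w)) * v ^ k"
        using L a c uw by (intro mult_left_mono) auto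
      then show ?thesis by simp
    qed
    moreover have "T * S' / 2 ^ k \<le> T * S' * v ^ k"
    proof -
      have "(1 / 2) ^ k \<le> v ^ k" using v by (intro power_mono) auto
      then have "T * S' * (1 / 2) ^ k \<le> T * S' * v ^ k" using T S0 by (intro mult_left_mono) auto
      then show ?thesis by (simp add: power_one_over)
    qed
    ultimately show ?thesis unfolding Q_def by (simp add: algebra_simps)
  qed
  then show ?thesis by blast
qed

end

text \<open>With \<open>v\<close> equal to 2 to the power minus \<beta>, the condition
  \<open>2 * (v * v) < 1\<close> says that \<beta> exceeds 1/2, so Young's condition holds with the
  same order for \<open>x\<close> and \<open>B\<close>. \<open>reg\<close> supplies finiteness of
  the Hoelder constant; the bounds below do not depend on the value of \<open>Q0\<close>.\<close>

locale young_solution = rs_solution +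
  fixes v g Q0 :: real
  assumes v: "1 / 2 \<le> v" "v < 1" and vv: "2 * (v * v) < 1"
    and reg: "\<And>k j. j < 2 ^ k \<Longrightarrow> \<bar>dinc T x k j\<bar> \<le> Q0 * v ^ k"
    and Bv: "\<And>k j. j < 2 ^ k \<Longrightarrow> \<bar>dinc T B k j\<bar> \<le> g * v ^ k"
begin

text \<open>Let \<open>Q\<close> be the best Hoelder constant on the descendants of interval
  \<open>i\<close>. Inserting it into \<open>increment_bound\<close> returns \<open>Q\<close> times
  a coefficient of order \<open>v ^ m * (g + T)\<close>, at most \<open>1 / 2\<close> by
  \<open>small\<close>, and this is absorbed on the left. What survives is the size of the
  coefficients at the left endpoint, bounded by linear growth from \<open>x 0\<close>.\<close>

lemma local_bound:
  assumes i: "i < 2 ^ m"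
    and small: "v ^ m * (Lip * (1 / (1 - v) + 1 / (1 - 2 * (v * v))) * (g + T)) \<le> 1 / 2"
    and A: "A = \<bar>\<sigma> (x 0)\<bar> + \<bar>b (x 0)\<bar>"
    and nl: "2 ^ n * i \<le> l" "l < 2 ^ n * Suc i"
  shows "\<bar>dinc T x (m + n) l\<bar> \<le> 2 * (A + Lip * \<bar>x (dy T m i) - x 0\<bar>) * (g + T) * v ^ (m + n)"
proof -
  have g: "g \<ge> 0" using Bv[of 0 0] by simp
  have Q0: "Q0 \<ge> 0" using reg[of 0 0] by simp
  note sub = dyadic_descendant_less[OF i]
  define P where "P = {(n, l). 2 ^ n * i \<le> l \<and> l < 2 ^ n * Suc i}"
  define F where "F = (\<lambda>(n, l). \<bar>dinc T x (m + n) l\<bar> / v ^ (m + n))"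
  have vp: "v ^ k > 0" for k using v by simp
  have bdd: "bdd_above (F ` P)"
  proof (rule bdd_aboveI2[of _ _ Q0])
    fix p assume "p \<in> P"
    then obtain n l where p: "p = (n, l)" and "l < 2 ^ n * Suc i" by (cases p) (simp add: P_def)
    from reg[OF sub[OF this(2)]] show "F p \<le> Q0"
      using vp[of "m + n"] by (simp add: F_def p pos_divide_le_eq)
  qed
  define Q where "Q = (SUP p\<in>P. F p)"
  have PQ: "F p \<le> Q" if "p \<in> P" for p unfolding Q_def by (rule cSUP_upper[OF that bdd])
  have Pne: "(0, i) \<in> P" by (simp add: P_def)
  have Q: "\<bar>dinc T x (m + n) l\<bar> \<le> Q * v ^ (m + n)" if "2 ^ n * i \<le> l" "l < 2 ^ n * Suc i" for n l
    using PQ[of "(n, l)"] that vp[of "m + n"] by (simp add: P_def F_def pos_divide_le_eq)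
  have Q0': "Q \<ge> 0"
  proof -
    have "0 \<le> F (0, i)" using vp[of m] by (simp add: F_def)
    then show ?thesis using PQ[OF Pne] by simp
  qed
  define c K where "c = 1 / (1 - v)" and "K = 1 / (1 - 2 * (v * v))"
  have c1: "c \<ge> 1" using v by (simp add: c_def)
  have K0: "K \<ge> 0" using vv by (simp add: K_def)
  define M where "M = \<bar>x (dy T m i) - x 0\<bar>"
  have dyT: "dy T m i \<in> {0..T}" "dy T m (Suc i) \<in> {0..T}" using dy_in[of T _ m] T i by auto
  have osc: "\<bar>x t - x (dy T m i)\<bar> \<le> Q * v ^ m * c" if "t \<in> {dy T m i..dy T m (Suc i)}" for t
  proof -
    have "\<bar>x t - x (dy T m i)\<bar> \<le> Q * v ^ m / (1 - v)"
    proof (rule dyadic_oscillation[OF T _ v(2) Q0' _ Q that])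
      show "continuous_on {dy T m i..dy T m (Suc i)} x"
        using dyT by (intro continuous_on_subset[OF contx]) auto
    qed (use v in auto)
    then show ?thesis by (simp add: c_def)
  qed
  \<comment> \<open>Bounds \<sigma> and \<open>b\<close> along the whole interval: \<open>M\<close>
    is the distance of the left endpoint from \<open>x 0\<close>, and \<open>Q * v ^ m * c\<close>
    the oscillation inside the interval.\<close>
  define W where "W = A + Lip * (M + Q * v ^ m * c)"
  have lin: "\<bar>\<sigma> (x t)\<bar> \<le> W \<and> \<bar>b (x t)\<bar> \<le> W" if "t \<in> {dy T m i..dy T m (Suc i)}" for t
  proof -
    have "\<bar>x t - x 0\<bar> \<le> M + Q * v ^ m * c" using osc[OF that] unfolding M_def by linarith
    then have "Lip * \<bar>x t - x 0\<bar> \<le> Lip * (M + Q * v ^ m * c)" using L by (intro mult_left_mono) auto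
    then show ?thesis using lip[of "x t" "x 0"] lipb[of "x t" "x 0"] A unfolding W_def by linarith
  qed
  have W0: "W \<ge> 0" using lin[of "dy T m i"] dy_mono[of T i "Suc i" m] T by fastforce
  have bound: "F p \<le> W * (g + T) + Lip * Q * g * K * v ^ m" if p: "p \<in> P" for p
  proof -
    obtain n l where pnl: "p = (n, l)" by (cases p)
    have nl: "2 ^ n * i \<le> l" "l < 2 ^ n * Suc i" using p by (auto simp: pnl P_def)
    have l: "l < 2 ^ (m + n)" by (rule sub[OF nl(2)])
    have dl: "dy T m i \<le> dy T (m + n) l" "dy T (m + n) (Suc l) \<le> dy T m (Suc i)"
      using dy_mono[of T "2 ^ n * i" l "m + n"] dy_mono[of T "Suc l" "2 ^ n * Suc i" "m + n"] nl T
      unfolding dy_refine by simp_all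
    have dl': "dy T (m + n) l \<le> dy T (m + n) (Suc l)" using dy_mono[of T l "Suc l"] T by simp
    have subsub: "2 ^ (n + n') * i \<le> l' \<and> l' < 2 ^ (n + n') * Suc i"
      if "2 ^ n' * l \<le> l'" "l' < 2 ^ n' * Suc l" for n' l'
    proof
      have "2 ^ (n + n') * i = 2 ^ n' * (2 ^ n * i)" by (simp add: power_add)
      also have "\<dots> \<le> 2 ^ n' * l" using nl by (intro mult_left_mono) auto
      finally show "2 ^ (n + n') * i \<le> l'" using that by simp
      have "2 ^ n' * Suc l \<le> 2 ^ n' * (2 ^ n * Suc i)" using nl by (intro mult_left_mono) auto
      also have "\<dots> = 2 ^ (n + n') * Suc i" by (simp only: power_add mult.assoc mult.left_commute)
      finally show "l' < 2 ^ (n + n') * Suc i" using that by simp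
    qed
    have "\<bar>dinc T x (m + n) l\<bar> \<le> \<bar>\<sigma> (x (dy T (m + n) l))\<bar> * \<bar>dinc T B (m + n) l\<bar>
        + Lip * Q * g * (v * v) ^ (m + n) / (1 - 2 * (v * v)) + T * W / 2 ^ (m + n)"
    proof (rule increment_bound[OF l _ _ vv Q0' g])
      fix n' l' assume s: "2 ^ n' * l \<le> l'" "l' < 2 ^ n' * Suc l"
      show "\<bar>dinc T x (m + n + n') l'\<bar> \<le> Q * v ^ (m + n + n')"
        using Q[of "n + n'" l'] subsub[OF s] by (simp add: add.assoc)
      show "\<bar>dinc T B (m + n + n') l'\<bar> \<le> g * v ^ (m + n + n')"
        using Bv[OF sub[of l' "n + n'"]] subsub[OF s] by (simp add: add.assoc)
    next
      fix t assume "t \<in> {dy T (m + n) l..dy T (m + n) (Suc l)}"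
      then show "\<bar>b (x t)\<bar> \<le> W" using dl lin[of t] by auto
    qed (use v L in auto)
    also have "\<dots> \<le> W * (g * v ^ (m + n)) + Lip * Q * g * K * v ^ m * v ^ (m + n) + T * W * v ^ (m + n)"
    proof (intro add_mono)
      show "\<bar>\<sigma> (x (dy T (m + n) l))\<bar> * \<bar>dinc T B (m + n) l\<bar> \<le> W * (g * v ^ (m + n))"
        using lin[of "dy T (m + n) l"] dl dl' Bv[OF l] W0 by (intro mult_mono) auto
      \<comment> \<open>A factor \<open>v ^ n\<close> is given up; the factor \<open>v ^ m\<close>
        that is kept makes the remainder small.\<close>
      have "(v * v) ^ (m + n) \<le> v ^ m * v ^ (m + n)"
        unfolding power_mult_distrib using v
        by (intro mult_right_mono power_decreasing) auto
      then have "Lip * Q * g * K * (v * v) ^ (m + n) \<le> Lip * Q * g * K * (v ^ m * v ^ (m + n))"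
        using L Q0' g K0 by (intro mult_left_mono) auto
      then show "Lip * Q * g * (v * v) ^ (m + n) / (1 - 2 * (v * v)) \<le> Lip * Q * g * K * v ^ m * v ^ (m + n)"
        by (simp add: K_def)
      have "(1 / 2) ^ (m + n) \<le> v ^ (m + n)" using v by (intro power_mono) auto
      then have "T * W * (1 / 2) ^ (m + n) \<le> T * W * v ^ (m + n)" using T W0 by (intro mult_left_mono) auto
      then show "T * W / 2 ^ (m + n) \<le> T * W * v ^ (m + n)" by (simp add: power_one_over)
    qed
    also have "\<dots> = (W * (g + T) + Lip * Q * g * K * v ^ m) * v ^ (m + n)" by (simp add: algebra_simps)
    finally show ?thesis using vp[of "m + n"] by (simp add: pnl F_def pos_divide_le_eq)
  qed
  have "Q \<le> W * (g + T) + Lip * Q * g * K * v ^ m"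
    unfolding Q_def[of] using Pne bound by (intro cSUP_least) (auto simp: Q_def[symmetric])
  also have "Lip * Q * g * K * v ^ m \<le> Lip * Q * (g + T) * K * v ^ m"
    using L Q0' K0 g T v by (intro mult_right_mono mult_left_mono) auto
  \<comment> \<open>Collects the terms in \<open>Q\<close>: \<open>c\<close> comes from the
    oscillation inside \<open>W\<close>, \<open>K\<close> from the Young remainder.\<close>
  also have "W * (g + T) + Lip * Q * (g + T) * K * v ^ m = (A + Lip * M) * (g + T) + Q * (v ^ m * (Lip * (c + K) * (g + T)))"
    by (simp add: W_def algebra_simps)
  also have "\<dots> \<le> (A + Lip * M) * (g + T) + Q * (1 / 2)"
    using small Q0' unfolding c_def K_def by (intro add_left_mono mult_left_mono) auto
  finally have "Q \<le> 2 * ((A + Lip * M) * (g + T))" by linarith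
  then have "Q \<le> 2 * (A + Lip * M) * (g + T)" by (simp only: mult.assoc)
  then have "Q * v ^ (m + n) \<le> 2 * (A + Lip * M) * (g + T) * v ^ (m + n)"
    using vp[of "m + n"] by (intro mult_right_mono) auto
  then show ?thesis using Q[OF nl] unfolding M_def by linarith
qed

end

section \<open>Global bounds for solutions\<close>

text \<open>\<open>small\<close> makes the \<open>2 ^ m\<close> intervals of level \<open>m\<close>
  short enough for \<open>local_bound\<close>; crossing one of them multiplies the distance from
  \<open>x 0\<close>, increased by \<open>A\<close>, by at most \<open>Lip + 2\<close>. Increments
  of finer levels follow from \<open>local_bound\<close>, those of coarser levels from the endpoint
  values.\<close>

lemma (in young_solution) global_bound:
  assumes small: "v ^ m * (Lip * (1 / (1 - v) + 1 / (1 - 2 * (v * v))) * (g + T)) \<le> 1 / 2"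
    and A: "A = \<bar>\<sigma> (x 0)\<bar> + \<bar>b (x 0)\<bar>" and j: "j < 2 ^ k"
  shows "\<bar>dinc T x k j\<bar> \<le> A * ((Lip + 2) ^ 2 ^ m * (2 * Lip * (g + T) + 2 * 2 ^ m)) * v ^ k"
proof -
  note loc = local_bound[OF _ small A]
  have g: "g \<ge> 0" using Bv[of 0 0] by simp
  have A0: "A \<ge> 0" by (simp add: A)
  have vp: "v ^ k > 0" for k using v by simp
  define M where "M i = \<bar>x (dy T m i) - x 0\<bar>" for i
  \<comment> \<open>The bound in \<open>small\<close> carries a further factor of at least
    \<open>1\<close>, which is dropped here.\<close>
  have vm: "v ^ m * (g + T) \<le> 1 / 2"
  proof -
    define R where "R = 1 / (1 - v) + 1 / (1 - 2 * (v * v))"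
    have "1 \<le> 1 / (1 - v)" "0 \<le> 1 / (1 - 2 * (v * v))" using v vv by auto
    then have "1 \<le> R" unfolding R_def by linarith
    then have "1 \<le> Lip * R" using L by (intro mult_ge1_I) auto
    then have "1 * (v ^ m * (g + T)) \<le> Lip * R * (v ^ m * (g + T))"
      using g T v by (intro mult_right_mono) auto
    also have "\<dots> = v ^ m * (Lip * R * (g + T))" by (simp only: mult_ac)
    also have "\<dots> \<le> 1 / 2" using small unfolding R_def .
    finally show ?thesis by simp
  qed
  have M: "M i + A \<le> (Lip + 2) ^ i * A" if "i \<le> 2 ^ m" for i
    using that
  proof (induction i)
    case 0
    then show ?case by (simp add: M_def)
  next
    case (Suc i)
    have "\<bar>dinc T x m i\<bar> \<le> 2 * (A + Lip * M i) * (g + T) * v ^ m"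
      using loc[of i 0 i] Suc.prems by (simp add: M_def)
    also have "\<dots> = 2 * (A + Lip * M i) * (v ^ m * (g + T))" by (simp add: mult_ac)
    also have "\<dots> \<le> 2 * (A + Lip * M i) * (1 / 2)"
      using vm A0 L by (intro mult_left_mono) (auto simp: M_def)
    finally have "\<bar>dinc T x m i\<bar> \<le> A + Lip * M i" by simp
    moreover have "M (Suc i) \<le> M i + \<bar>dinc T x m i\<bar>" unfolding M_def dinc_def by linarith
    moreover have "0 \<le> M i" by (simp add: M_def)
    moreover have "A \<le> Lip * A" using mult_right_mono[OF L A0] by simp
    ultimately have "M (Suc i) + A \<le> (Lip + 2) * (M i + A)" using A0 unfolding distrib_left distrib_right by linarith
    also have "\<dots> \<le> (Lip + 2) * ((Lip + 2) ^ i * A)"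
      using Suc L by (intro mult_left_mono) auto
    finally show ?case by simp
  qed
  have M': "M i + A \<le> (Lip + 2) ^ 2 ^ m * A" if "i \<le> 2 ^ m" for i
  proof -
    have "(Lip + 2) ^ i * A \<le> (Lip + 2) ^ 2 ^ m * A"
      using that L A0 by (intro mult_right_mono power_increasing) auto
    then show ?thesis using M[OF that] by linarith
  qed
  let ?E = "(Lip + 2) ^ 2 ^ m * A"
  have E0: "?E \<ge> 0" using A0 L by simp
  show ?thesis
  proof (cases "m \<le> k")
    case True
    then obtain n where n: "k = m + n" using le_Suc_ex by blast
    define i where "i = j div 2 ^ n"
    have i: "i < 2 ^ m" using j unfolding i_def n power_add by (simp add: less_mult_imp_div_less mult.commute)
    have ij: "2 ^ n * i \<le> j" "j < 2 ^ n * Suc i"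
      unfolding i_def using dividend_less_times_div[of "2 ^ n" j] by (auto simp: algebra_simps)
    have "\<bar>dinc T x k j\<bar> \<le> 2 * (A + Lip * M i) * (g + T) * v ^ k"
      unfolding n M_def by (rule loc[OF i ij])
    also have "A + Lip * M i \<le> Lip * (M i + A)"
      using mult_right_mono[OF L A0] by (simp add: distrib_left)
    also have "Lip * (M i + A) \<le> Lip * ?E" using M'[of i] i L by (intro mult_left_mono) auto
    finally have "\<bar>dinc T x k j\<bar> \<le> 2 * (Lip * ?E) * (g + T) * v ^ k"
      using g T vp[of k] by (simp add: mult_right_mono)
    also have "\<dots> \<le> 2 * (Lip * ?E) * (g + T) * v ^ k + ?E * (2 * 2 ^ m) * v ^ k"
      using E0 vp[of k] by simp
    finally show ?thesis by (simp add: algebra_simps)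
  next
    case False
    then obtain n where n: "m = k + n" using nat_le_linear le_Suc_ex by metis
    have e: "dy T k j = dy T m (2 ^ n * j)" "dy T k (Suc j) = dy T m (2 ^ n * Suc j)"
      unfolding n dy_refine by auto
    have "2 ^ n * Suc j \<le> 2 ^ n * 2 ^ k" using j by (intro mult_left_mono) auto
    then have le: "2 ^ n * Suc j \<le> 2 ^ m" by (simp only: n power_add mult.commute)
    have le': "2 ^ n * j \<le> 2 ^ m" by (rule order_trans[OF _ le]) simp
    have "\<bar>dinc T x k j\<bar> \<le> M (2 ^ n * Suc j) + M (2 ^ n * j)"
      unfolding M_def dinc_def e by linarith
    also have "\<dots> \<le> ?E * 2" using M'[OF le] M'[OF le'] A0 by linarith
    also have "\<dots> \<le> ?E * 2 * (2 ^ m * v ^ k)"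
    proof -
      \<comment> \<open>For \<open>k\<close> below \<open>m\<close> the factor \<open>v ^ k\<close>
        is gained at the price of \<open>2 ^ m\<close>, because \<open>v\<close> is at least
        \<open>1 / 2\<close>.\<close>
      have "(1::real) = 2 ^ k * (1 / 2) ^ k" by (simp add: power_one_over)
      also have "\<dots> \<le> 2 ^ m * v ^ k"
        using v n by (intro mult_mono power_mono power_increasing) auto
      finally have "?E * 2 * 1 \<le> ?E * 2 * (2 ^ m * v ^ k)" using E0 by (intro mult_left_mono) auto
      then show ?thesis by simp
    qed
    also have "\<dots> \<le> ?E * 2 * (2 ^ m * v ^ k) + 2 * (Lip * ?E) * (g + T) * v ^ k"
    proof -
      have "0 \<le> 2 * (Lip * ?E) * (g + T) * v ^ k"
        using A0 g T L vp[of k] by (intro mult_nonneg_nonneg) auto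
      then show ?thesis by linarith
    qed
    finally show ?thesis by (simp add: algebra_simps)
  qed
qed

text \<open>The number of dyadic intervals needed grows like a power of the size of \<open>B\<close> below \<open>2\<close>, because
  \<open>v\<^sup>2 < 1/2\<close>; hence its exponential is controlled by a Gaussian weight.\<close>

lemma dyadic_level_growth:
  fixes \<kappa> c \<delta> T v :: real
  assumes v: "v > 0" "2 * (v * v) < 1" and \<kappa>: "\<kappa> > 0" and c: "c \<ge> 0" and \<delta>: "\<delta> > 0" and T: "T \<ge> 0"
  shows "\<exists>C. \<forall>g\<ge>0. \<exists>m. v ^ m * (\<kappa> * (g + T)) \<le> 1 / 2 \<and> c * 2 ^ m \<le> \<delta> * g\<^sup>2 + C"
proof -
  \<comment> \<open>At the critical level \<open>w ^ m\<close> is bounded by a multiple of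
    \<open>(g + T)\<^sup>2\<close>; as \<open>w > 2\<close>, the number \<open>2 ^ m\<close> of
    intervals is of lower order than \<open>w ^ m\<close>.\<close>
  define w where "w = 1 / (v * v)"
  have w: "w > 2" using v by (simp add: w_def less_divide_eq)
  \<comment> \<open>Chosen so that \<open>\<eta> * (w * (4 * \<kappa>\<^sup>2 * 2))\<close> equals
    \<delta>.\<close>
  define \<eta> where "\<eta> = \<delta> / (8 * w * \<kappa>\<^sup>2)"
  have \<eta>: "\<eta> > 0" using \<delta> w \<kappa> by (simp add: \<eta>_def)
  have "(\<lambda>m. c * (2 / w) ^ m) \<longlonglongrightarrow> c * 0"
    using w by (intro tendsto_mult_left LIMSEQ_realpow_zero) auto
  then have "\<forall>\<^sub>F m in sequentially. c * (2 / w) ^ m < \<eta>"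
    using \<eta> order_tendstoD(2)[of "\<lambda>m. c * (2 / w) ^ m" 0 sequentially \<eta>] by simp
  then obtain N where N: "\<And>m. m \<ge> N \<Longrightarrow> c * (2 / w) ^ m < \<eta>" by (auto simp: eventually_sequentially)
  have pow: "c * 2 ^ m \<le> \<eta> * w ^ m + c * 2 ^ N" for m
  proof (cases "m \<ge> N")
    case True
    then have "c * (2 / w) ^ m * w ^ m \<le> \<eta> * w ^ m" using N[OF True] w by (intro mult_right_mono) auto
    then have "c * 2 ^ m \<le> \<eta> * w ^ m" using w by (simp add: power_divide)
    then show ?thesis using c by (simp add: add_increasing2)
  next
    case False
    then have "c * 2 ^ m \<le> c * 2 ^ N" using c by (intro mult_left_mono power_increasing) auto
    moreover have "0 \<le> \<eta> * w ^ m" using \<eta> w by simp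
    ultimately show ?thesis by linarith
  qed
  define C where "C = \<delta> * T\<^sup>2 + c * 2 ^ N + c"
  show ?thesis
  proof (intro exI[of _ C] allI impI)
    fix g :: real assume g: "g \<ge> 0"
    have v1: "v < 1"
    proof (rule ccontr)
      assume "\<not> v < 1"
      then have "1 * 1 \<le> v * v" by (intro mult_mono) auto
      then show False using v by simp
    qed
    have "(\<lambda>m. v ^ m * (\<kappa> * (g + T))) \<longlonglongrightarrow> 0 * (\<kappa> * (g + T))"
      using v v1 by (intro tendsto_mult_right LIMSEQ_realpow_zero) auto
    then have "\<forall>\<^sub>F m in sequentially. v ^ m * (\<kappa> * (g + T)) < 1 / 2"
      using order_tendstoD(2)[of "\<lambda>m. v ^ m * (\<kappa> * (g + T))" 0 sequentially "1 / 2"] by simp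
    then have ex: "\<exists>m. v ^ m * (\<kappa> * (g + T)) \<le> 1 / 2" by (auto simp: eventually_sequentially intro: less_imp_le)
    \<comment> \<open>Minimality matters: unless \<open>m\<close> is \<open>0\<close>, smallness
      fails at \<open>m - 1\<close>, and this bounds \<open>w ^ m\<close> from above.\<close>
    define m where "m = (LEAST m. v ^ m * (\<kappa> * (g + T)) \<le> 1 / 2)"
    have m: "v ^ m * (\<kappa> * (g + T)) \<le> 1 / 2" unfolding m_def using ex by (rule LeastI_ex)
    have "c * 2 ^ m \<le> \<delta> * g\<^sup>2 + C"
    proof (cases m)
      case 0
      then show ?thesis using c \<delta> by (simp add: C_def add_increasing)
    next
      case (Suc n)
      have "\<not> v ^ n * (\<kappa> * (g + T)) \<le> 1 / 2"
        using not_less_Least[of n "\<lambda>m. v ^ m * (\<kappa> * (g + T)) \<le> 1 / 2"] Suc by (simp add: m_def)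
      then have "(1 / 2) * (1 / 2) < (v ^ n * (\<kappa> * (g + T))) * (v ^ n * (\<kappa> * (g + T)))"
        by (intro mult_strict_mono) auto
      also have "\<dots> = (v * v) ^ n * (\<kappa>\<^sup>2 * (g + T)\<^sup>2)"
        by (simp add: power_mult_distrib power2_eq_square mult_ac)
      finally have "w ^ n * (1 / 4) \<le> w ^ n * ((v * v) ^ n * (\<kappa>\<^sup>2 * (g + T)\<^sup>2))"
        using w by (intro mult_left_mono) auto
      also have "\<dots> = \<kappa>\<^sup>2 * (g + T)\<^sup>2"
        using v by (simp add: w_def power_divide power_mult_distrib)
      finally have "w ^ n \<le> 4 * \<kappa>\<^sup>2 * (g + T)\<^sup>2" by simp
      then have "w ^ m \<le> w * (4 * \<kappa>\<^sup>2 * (g + T)\<^sup>2)" using w Suc by (simp add: mult_left_mono)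
      also have "\<dots> \<le> w * (4 * \<kappa>\<^sup>2 * (2 * (g\<^sup>2 + T\<^sup>2)))"
      proof -
        have "(g + T)\<^sup>2 \<le> 2 * (g\<^sup>2 + T\<^sup>2)" using sum_squares_bound[of g T] by (simp add: power2_sum)
        then show ?thesis using w by (intro mult_left_mono) auto
      qed
      finally have "\<eta> * w ^ m \<le> \<eta> * (w * (4 * \<kappa>\<^sup>2 * (2 * (g\<^sup>2 + T\<^sup>2))))" using \<eta> by (intro mult_left_mono) auto
      also have "\<dots> = \<delta> * (g\<^sup>2 + T\<^sup>2)" using w \<kappa> by (simp add: \<eta>_def)
      finally show ?thesis using pow[of m] c by (simp add: C_def distrib_left)
    qed
    with m show "\<exists>m. v ^ m * (\<kappa> * (g + T)) \<le> 1 / 2 \<and> c * 2 ^ m \<le> \<delta> * g\<^sup>2 + C" by blast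
  qed
qed

text \<open>\<open>C\<close> depends on \<open>T\<close>, \<open>Lip\<close>, \<open>v\<close> and
  \<delta> but not on the path, so it serves all \<omega> at once. Half of \<delta> pays for the
  growth factor raised to the power \<open>2 ^ m\<close>, the other half for the factor linear in
  \<open>g\<close>.\<close>

theorem young_solution_dyadic_bound:
  fixes T Lip v \<delta> :: real
  assumes T: "T > 0" and L: "Lip \<ge> 1" and v: "1 / 2 \<le> v" "v < 1" and vv: "2 * (v * v) < 1" and \<delta>: "\<delta> > 0"
  shows "\<exists>C\<ge>0. \<forall>\<sigma> b x B g Q0. young_solution T Lip \<sigma> b x B v g Q0 \<longrightarrow>
     (\<forall>k. \<forall>j<2 ^ k. \<bar>dinc T x k j\<bar> \<le> (\<bar>\<sigma> (x 0)\<bar> + \<bar>b (x 0)\<bar>) * (C * exp (\<delta> * g\<^sup>2)) * v ^ k)"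
proof -
  define \<kappa> where "\<kappa> = Lip * (1 / (1 - v) + 1 / (1 - 2 * (v * v)))"
  have \<kappa>: "\<kappa> > 0" unfolding \<kappa>_def using L v vv by (intro mult_pos_pos add_pos_pos) auto
  \<comment> \<open>\<open>ln (Lip + 2)\<close> comes from the growth per interval; the added
    \<open>1\<close> pays for a factor \<open>exp (2 ^ m)\<close>, which dominates the
    \<open>2 ^ m\<close> in \<open>global_bound\<close>.\<close>
  define c where "c = ln (Lip + 2) + 1"
  have c: "c \<ge> 0" using L by (simp add: c_def)
  obtain C1 where C1: "\<And>g. g \<ge> 0 \<Longrightarrow> \<exists>m. v ^ m * (\<kappa> * (g + T)) \<le> 1 / 2 \<and> c * 2 ^ m \<le> \<delta> / 2 * g\<^sup>2 + C1"
    using dyadic_level_growth[of v \<kappa> c "\<delta> / 2" T] v vv \<kappa> c \<delta> T by auto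
  \<comment> \<open>Results from \<open>g \<le> 1 + g\<^sup>2\<close> and
    \<open>1 + y \<le> exp y\<close> with \<open>y = \<delta> / 2 * g\<^sup>2\<close>.\<close>
  define C2 where "C2 = 2 * Lip * (1 + 2 / \<delta> + T) + 2"
  have C2: "C2 \<ge> 0" using L \<delta> T by (simp add: C2_def)
  have lin: "2 * Lip * (g + T) + 2 \<le> C2 * exp (\<delta> / 2 * g\<^sup>2)" if g: "g \<ge> 0" for g
  proof -
    define E where "E = exp (\<delta> / 2 * g\<^sup>2)"
    have "1 + \<delta> / 2 * g\<^sup>2 \<le> E" unfolding E_def by (rule exp_ge_add_one_self)
    moreover have "0 \<le> \<delta> / 2 * g\<^sup>2" using \<delta> by simp
    ultimately have e: "\<delta> / 2 * g\<^sup>2 \<le> E" "1 \<le> E" by linarith+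
    have "g \<le> 1 + g\<^sup>2"
    proof -
      have "0 \<le> (g - 1)\<^sup>2" by simp
      then show ?thesis using g by (simp add: power2_diff)
    qed
    also have "\<dots> = 1 + 2 / \<delta> * (\<delta> / 2 * g\<^sup>2)" using \<delta> by simp
    also have "\<dots> \<le> E + 2 / \<delta> * E"
      using e \<delta> by (intro add_mono mult_left_mono) auto
    finally have "g \<le> E + 2 / \<delta> * E" .
    moreover have "T * 1 \<le> T * E" using e T by (intro mult_left_mono) auto
    ultimately have "g + T \<le> (1 + 2 / \<delta> + T) * E" unfolding distrib_right by linarith
    then have "2 * Lip * (g + T) \<le> 2 * Lip * ((1 + 2 / \<delta> + T) * E)"
      using L by (intro mult_left_mono) auto
    then have "2 * Lip * (g + T) \<le> 2 * Lip * (1 + 2 / \<delta> + T) * E" by (simp only: mult.assoc)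
    then show ?thesis using e(2) unfolding C2_def E_def[symmetric] distrib_right[of _ 2] by linarith
  qed
  define C where "C = C2 * exp C1"
  show ?thesis
  proof (intro exI[of _ C] conjI allI impI)
    show "0 \<le> C" using C2 by (simp add: C_def)
    fix \<sigma> b x B g Q0 k and j :: nat
    assume "young_solution T Lip \<sigma> b x B v g Q0" and j: "j < 2 ^ k"
    then interpret young_solution T Lip \<sigma> b x B v g Q0 by simp
    let ?A = "\<bar>\<sigma> (x 0)\<bar> + \<bar>b (x 0)\<bar>"
    have g: "g \<ge> 0" using Bv[of 0 0] by simp
    obtain m where m: "v ^ m * (\<kappa> * (g + T)) \<le> 1 / 2" "c * 2 ^ m \<le> \<delta> / 2 * g\<^sup>2 + C1" using C1[OF g] by blast
    have "\<bar>dinc T x k j\<bar> \<le> ?A * ((Lip + 2) ^ 2 ^ m * (2 * Lip * (g + T) + 2 * 2 ^ m)) * v ^ k"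
      by (rule global_bound[OF m(1)[unfolded \<kappa>_def] refl j])
    also have "\<dots> \<le> ?A * (C * exp (\<delta> * g\<^sup>2)) * v ^ k"
    proof (intro mult_right_mono mult_left_mono)
      have e: "(2::real) ^ m \<le> exp (2 ^ m)" "1 \<le> exp ((2::real) ^ m)"
        using exp_ge_add_one_self[of "2 ^ m"] by (linarith, simp)
      have "2 * Lip * (g + T) * 1 \<le> 2 * Lip * (g + T) * exp (2 ^ m)"
        using L g T e(2) by (intro mult_left_mono) auto
      then have "2 * Lip * (g + T) + 2 * 2 ^ m \<le> (2 * Lip * (g + T) + 2) * exp (2 ^ m)"
        using e(1) unfolding distrib_right[of _ 2] by linarith
      also have "\<dots> \<le> C2 * exp (\<delta> / 2 * g\<^sup>2) * exp (2 ^ m)"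
        by (intro mult_right_mono lin g) auto
      finally have 1: "2 * Lip * (g + T) + 2 * 2 ^ m \<le> C2 * exp (\<delta> / 2 * g\<^sup>2) * exp (2 ^ m)" .
      have "exp (real (2 ^ m) * ln (Lip + 2)) = exp (ln (Lip + 2)) ^ 2 ^ m" by (rule exp_of_nat_mult)
      then have "(Lip + 2) ^ 2 ^ m = exp (ln (Lip + 2) * 2 ^ m)" using L by (simp add: mult.commute)
      then have "(Lip + 2) ^ 2 ^ m * (2 * Lip * (g + T) + 2 * 2 ^ m) \<le> exp (ln (Lip + 2) * 2 ^ m) * (C2 * exp (\<delta> / 2 * g\<^sup>2) * exp (2 ^ m))"
        using mult_left_mono[OF 1, of "(Lip + 2) ^ 2 ^ m"] L by simp
      also have "\<dots> = C2 * exp (\<delta> / 2 * g\<^sup>2) * exp (c * 2 ^ m)"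
        by (simp add: c_def distrib_right exp_add)
      also have "\<dots> \<le> C2 * exp (\<delta> / 2 * g\<^sup>2) * exp (\<delta> / 2 * g\<^sup>2 + C1)"
        using m(2) C2 by (intro mult_left_mono) auto
      also have "\<dots> = C * (exp (\<delta> / 2 * g\<^sup>2) * exp (\<delta> / 2 * g\<^sup>2))"
        by (simp add: C_def exp_add)
      also have "exp (\<delta> / 2 * g\<^sup>2) * exp (\<delta> / 2 * g\<^sup>2) = exp (\<delta> * g\<^sup>2)"
        by (simp flip: exp_add)
      finally show "(Lip + 2) ^ 2 ^ m * (2 * Lip * (g + T) + 2 * 2 ^ m) \<le> C * exp (\<delta> * g\<^sup>2)" .
    qed (use v in auto)
    finally show "\<bar>dinc T x k j\<bar> \<le> ?A * (C * exp (\<delta> * g\<^sup>2)) * v ^ k" .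
  qed
qed

section \<open>Gaussian weights and moduli of continuity\<close>

text \<open>For fractional Brownian motion the squared increment, divided by its variance, has the
  same exponential moment on every interval. The factor \<open>(1 / 4) ^ k\<close> outweighs the
  \<open>2 ^ k\<close> intervals of level \<open>k\<close>, so the expectations are
  summable.\<close>

definition gauss_term :: "real \<Rightarrow> real \<Rightarrow> (real \<Rightarrow> real) \<Rightarrow> nat \<Rightarrow> nat \<Rightarrow> real" where
  "gauss_term T H y k j = exp ((dinc T y k j)\<^sup>2 / (4 * ((T / 2 ^ k) powr H)\<^sup>2)) * (1 / 4) ^ k"

text \<open>A dyadic form of the Garsia-Rodemich-Rumsey functional with an exponential of the
  square; its values lie in \<open>ennreal\<close>, so that no finiteness is presupposed.\<close>

definition gauss_weight :: "real \<Rightarrow> real \<Rightarrow> (real \<Rightarrow> real) \<Rightarrow> ennreal" where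
  "gauss_weight T H y = (\<Sum>k. \<Sum>j<2 ^ k.
     ennreal (gauss_term T H y k j))"

lemma gauss_weight_expectation_finite:
  assumes B: "fractional_brownian_motion M H B" and H: "H > 0" and T: "T > 0"
  shows "(\<integral>\<^sup>+\<omega>. gauss_weight T H (\<lambda>t. B t \<omega>) \<partial>M) < \<infinity>"
proof -
  let ?Z = "\<lambda>k j \<omega>. dinc T (\<lambda>t. B t \<omega>) k j"
  let ?s = "\<lambda>k. (T / 2 ^ k) powr H"
  have D: "distributed M lborel (?Z k j) (normal_density 0 (?s k))" for k j
  proof -
    have "T / 2 ^ k > 0" using T by simp
    then have "dy T k j < dy T k (Suc j)" using dy_diff[of T k j] by linarith
    from fbm_increment_distributed[OF B H dy_nonneg this] T show ?thesis by (simp add: dinc_def dy_diff)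
  qed
  have [measurable]: "?Z k j \<in> borel_measurable M" for k j
    using distributed_measurable[OF D[of k j]] by simp
  have s: "?s k > 0" for k using T by simp
  have summand: "(\<integral>\<^sup>+\<omega>. ennreal (gauss_term T H (\<lambda>t. B t \<omega>) k j) \<partial>M) = ennreal (sqrt 2 * (1 / 4) ^ k)" for k j
  proof -
    have "(\<integral>\<^sup>+\<omega>. ennreal (gauss_term T H (\<lambda>t. B t \<omega>) k j) \<partial>M)
        = (\<integral>\<^sup>+\<omega>. ennreal (exp ((?Z k j \<omega>)\<^sup>2 / (4 * (?s k)\<^sup>2))) * ennreal ((1 / 4) ^ k) \<partial>M)"
      by (simp add: gauss_term_def ennreal_mult)
    also have "\<dots> = (\<integral>\<^sup>+\<omega>. ennreal (exp ((?Z k j \<omega>)\<^sup>2 / (4 * (?s k)\<^sup>2))) \<partial>M) * ennreal ((1 / 4) ^ k)"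
      by (rule nn_integral_multc) measurable
    also have "\<dots> = ennreal (sqrt 2) * ennreal ((1 / 4) ^ k)"
      by (simp only: normal_exp_square_integral[OF D s])
    finally show ?thesis by (simp add: ennreal_mult)
  qed
  have "(\<integral>\<^sup>+\<omega>. gauss_weight T H (\<lambda>t. B t \<omega>) \<partial>M)
      = (\<Sum>k. \<Sum>j<2 ^ k. \<integral>\<^sup>+\<omega>. ennreal (gauss_term T H (\<lambda>t. B t \<omega>) k j) \<partial>M)"
    unfolding gauss_weight_def gauss_term_def by (subst nn_integral_suminf) (auto simp: nn_integral_sum simp del: sum_ennreal)
  also have "\<dots> = (\<Sum>k. ennreal (sqrt 2 * (1 / 2) ^ k))"
  proof (rule suminf_cong)
    fix k
    have "(\<Sum>j<(2::nat) ^ k. ennreal (sqrt 2 * (1 / 4) ^ k)) = ennreal (\<Sum>j<(2::nat) ^ k. sqrt 2 * (1 / 4) ^ k)"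
      by (rule sum_ennreal) simp
    also have "(\<Sum>j<(2::nat) ^ k. sqrt 2 * (1 / 4) ^ k) = sqrt 2 * (2 * (1 / 4)) ^ k"
      unfolding power_mult_distrib by simp
    finally show "(\<Sum>j<2 ^ k. \<integral>\<^sup>+\<omega>. ennreal (gauss_term T H (\<lambda>t. B t \<omega>) k j) \<partial>M) = ennreal (sqrt 2 * (1 / 2) ^ k)"
      by (simp only: summand) simp
  qed
  also have "\<dots> < \<infinity>"
  proof -
    have "summable (\<lambda>k. sqrt 2 * (1 / 2) ^ k)" by (intro summable_mult summable_geometric) simp
    then show ?thesis by (subst suminf_ennreal2) (auto simp: less_top)
  qed
  finally show ?thesis .
qed

text \<open>A single term is at most \<open>s\<close>, so a squared increment is at most
  \<open>4\<close> times the normalising variance times \<open>ln s + k * ln 4\<close>. The standard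
  deviations decay strictly faster than \<open>v ^ k\<close>, and this absorbs the \<open>k\<close>.
  The squared Hoelder constant is thus linear in \<open>ln s\<close>, and exponentials of small
  multiples of it are small powers of the weight.\<close>

lemma gauss_weight_dyadic_bound:
  assumes T: "T > 0" and v: "2 powr (- H) < v"
  shows "\<exists>c\<ge>0. \<forall>y s. gauss_weight T H y = ennreal s \<longrightarrow> s \<ge> 0 \<longrightarrow> s \<ge> 1 \<and>
    (\<forall>k. \<forall>j<2 ^ k. \<bar>dinc T y k j\<bar> \<le> sqrt (4 * (T powr H)\<^sup>2 * (ln s + c)) * v ^ k)"
proof -
  define p where "p = 2 powr (- H)"
  have p: "p > 0" "p < v" using v by (auto simp: p_def)
  define r where "r = (p / v)\<^sup>2"
  have "p / v * (p / v) < 1 * 1" using p by (intro mult_strict_mono) auto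
  then have r: "0 < r" "r < 1" using p by (auto simp: r_def power2_eq_square)
  have "(\<lambda>k. real k * r ^ k) \<longlonglongrightarrow> 0" using powser_times_n_limit_0[of r] r by simp
  then have "Bseq (\<lambda>k. real k * r ^ k)" by (intro convergent_imp_Bseq convergentI)
  then obtain K where K: "K > 0" "\<And>k. norm (real k * r ^ k) \<le> K" by (auto elim: BseqE)
  define c where "c = K * ln 4"
  have c: "c \<ge> 0" using K by (simp add: c_def)
  show ?thesis
  proof (intro exI[of _ c] conjI allI impI c)
    fix y s assume W: "gauss_weight T H y = ennreal s" and s0: "s \<ge> 0"
    have summand: "gauss_term T H y k j \<le> s" if j: "j < 2 ^ k" for k j
    proof -
      let ?f = "\<lambda>k j. ennreal (gauss_term T H y k j)"
      have "?f k j \<le> (\<Sum>j<2 ^ k. ?f k j)" using j by (intro member_le_sum) auto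
      also have "\<dots> \<le> gauss_weight T H y"
        unfolding gauss_weight_def using sum_le_suminf[of "\<lambda>k. \<Sum>j<2 ^ k. ?f k j" "{k}"] by simp
      finally show ?thesis unfolding W using s0 by (simp add: ennreal_le_iff)
    qed
    show s1: "s \<ge> 1"
    proof -
      have "1 \<le> exp ((dinc T y 0 0)\<^sup>2 / (4 * (T powr H)\<^sup>2))" by simp
      also have "\<dots> \<le> s" using summand[of 0 0] by (simp add: gauss_term_def)
      finally show ?thesis .
    qed
    fix k j :: nat assume j: "j < 2 ^ k"
    let ?\<sigma> = "(T / 2 ^ k) powr H"
    have \<sigma>: "?\<sigma> = T powr H * p ^ k"
    proof -
      have "?\<sigma> = T powr H / (2 ^ k) powr H" using T by (simp add: powr_divide)
      also have "(2 ^ k) powr H = (2 powr H) ^ k"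
        by (simp add: powr_realpow[symmetric] powr_powr mult.commute)
      finally show ?thesis by (simp add: p_def powr_minus power_inverse divide_inverse)
    qed
    have \<sigma>0: "?\<sigma> > 0" using T by simp
    have "exp ((dinc T y k j)\<^sup>2 / (4 * ?\<sigma>\<^sup>2)) \<le> s * 4 ^ k"
      using summand[OF j] by (simp add: gauss_term_def power_one_over field_simps)
    then have "(dinc T y k j)\<^sup>2 / (4 * ?\<sigma>\<^sup>2) \<le> ln (s * 4 ^ k)"
      using s1 by (subst ln_ge_iff) auto
    also have "ln (s * 4 ^ k) = ln s + real k * ln 4"
      using s1 by (simp add: ln_mult ln_realpow)
    finally have "(dinc T y k j)\<^sup>2 \<le> 4 * ?\<sigma>\<^sup>2 * (ln s + real k * ln 4)"
      using \<sigma>0 by (simp add: pos_divide_le_eq mult.commute)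
    also have "\<dots> = 4 * (T powr H)\<^sup>2 * (v ^ k)\<^sup>2 * (r ^ k * ln s + real k * r ^ k * ln 4)"
    proof -
      have "?\<sigma>\<^sup>2 = (T powr H)\<^sup>2 * ((v ^ k)\<^sup>2 * r ^ k)"
        unfolding \<sigma> r_def using p by (simp add: power_mult_distrib power_divide power_mult[symmetric] mult.commute)
      then show ?thesis by (simp add: algebra_simps)
    qed
    also have "\<dots> \<le> 4 * (T powr H)\<^sup>2 * (v ^ k)\<^sup>2 * (ln s + c)"
    proof (intro mult_left_mono add_mono)
      have "r ^ k \<le> 1" using r by (intro power_le_one) auto
      then show "r ^ k * ln s \<le> ln s" using s1 r by (intro mult_left_le_one_le) auto
      show "real k * r ^ k * ln 4 \<le> c" unfolding c_def using K(2)[of k] by (intro mult_right_mono) auto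
    qed auto
    finally have "(dinc T y k j)\<^sup>2 \<le> 4 * (T powr H)\<^sup>2 * (ln s + c) * (v ^ k)\<^sup>2" by (simp add: mult_ac)
    then have "sqrt ((dinc T y k j)\<^sup>2) \<le> sqrt (4 * (T powr H)\<^sup>2 * (ln s + c) * (v ^ k)\<^sup>2)"
      by (rule real_sqrt_le_mono)
    then show "\<bar>dinc T y k j\<bar> \<le> sqrt (4 * (T powr H)\<^sup>2 * (ln s + c)) * v ^ k"
      using p by (simp add: real_sqrt_mult)
  qed
qed

section \<open>Measurability and independence of path functionals\<close>

lemma measurable_dinc_path [measurable]:
  assumes "T \<ge> 0"
  shows "(\<lambda>y. dinc T y k j) \<in> borel_measurable path_space"
  unfolding dinc_def using assms by (intro borel_measurable_diff measurable_component_singleton) (auto simp: dy_nonneg)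

lemma measurable_gauss_weight:
  assumes "T \<ge> 0"
  shows "gauss_weight T H \<in> borel_measurable path_space"
proof -
  note [measurable] = measurable_dinc_path[OF assms]
  show ?thesis unfolding gauss_weight_def[abs_def] gauss_term_def by measurable
qed

lemma dinc_sample_path:
  "T \<ge> 0 \<Longrightarrow> dinc T (sample_path X \<omega>) k j = dinc T (\<lambda>t. X t \<omega>) k j"
  by (simp add: dinc_def sample_path_def dy_nonneg)

text \<open>The two variables take values in different types; composed with \<open>f\<close> and
  \<open>g\<close> both become \<open>ennreal\<close>-valued, and the product formula for
  independent families applies.\<close>

lemma independent_nn_integral_mult:
  fixes f :: "'b \<Rightarrow> ennreal" and g :: "'c \<Rightarrow> ennreal"
  assumes "prob_space M" and ind: "independent_variables M S Z S' W"
    and f: "f \<in> borel_measurable S" and g: "g \<in> borel_measurable S'"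
  shows "(\<integral>\<^sup>+\<omega>. f (Z \<omega>) * g (W \<omega>) \<partial>M) = (\<integral>\<^sup>+\<omega>. f (Z \<omega>) \<partial>M) * (\<integral>\<^sup>+\<omega>. g (W \<omega>) \<partial>M)"
proof -
  interpret prob_space M by fact
  have Z: "Z \<in> measurable M S" and W: "W \<in> measurable M S'"
    and ind_set: "indep_set {Z -` A \<inter> space M | A. A \<in> sets S} {W -` A \<inter> space M | A. A \<in> sets S'}"
    using ind by (auto simp: independent_variables_def)
  have fZ: "(\<lambda>\<omega>. f (Z \<omega>)) \<in> borel_measurable M" and gW: "(\<lambda>\<omega>. g (W \<omega>)) \<in> borel_measurable M"
    using measurable_compose[OF Z f] measurable_compose[OF W g] .
  have sub: "{(\<lambda>\<omega>. h (Y \<omega>)) -` A \<inter> space M | A. A \<in> sets borel} \<subseteq> {Y -` A \<inter> space M | A. A \<in> sets R}"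
    if Y: "Y \<in> measurable M R" and h: "h \<in> borel_measurable R" for h :: "'d \<Rightarrow> ennreal" and Y R
  proof safe
    fix A :: "ennreal set" assume A: "A \<in> sets borel"
    have "(\<lambda>\<omega>. h (Y \<omega>)) -` A \<inter> space M = Y -` (h -` A \<inter> space R) \<inter> space M"
      using measurable_space[OF Y] by auto
    then show "\<exists>A'. (\<lambda>\<omega>. h (Y \<omega>)) -` A \<inter> space M = Y -` A' \<inter> space M \<and> A' \<in> sets R"
      using measurable_sets[OF h A] by blast
  qed
  have "indep_set {(\<lambda>\<omega>. f (Z \<omega>)) -` A \<inter> space M | A. A \<in> sets borel} {(\<lambda>\<omega>. g (W \<omega>)) -` A \<inter> space M | A. A \<in> sets borel}"
    using ind_set sub[OF Z f] sub[OF W g] unfolding indep_sets2_eq by (meson subsetD subset_trans)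
  moreover have "Int_stable {Y -` A \<inter> space M | A. A \<in> sets borel}" for Y :: "'a \<Rightarrow> ennreal"
  proof (rule Int_stableI)
    fix a b assume "a \<in> {Y -` A \<inter> space M | A. A \<in> sets borel}" "b \<in> {Y -` A \<inter> space M | A. A \<in> sets borel}"
    then obtain A A' where "a = Y -` A \<inter> space M" "b = Y -` A' \<inter> space M" "A \<in> sets borel" "A' \<in> sets borel" by auto
    then show "a \<inter> b \<in> {Y -` A \<inter> space M | A. A \<in> sets borel}" by (auto intro!: exI[of _ "A \<inter> A'"])
  qed
  ultimately have iv: "indep_var borel (\<lambda>\<omega>. f (Z \<omega>)) borel (\<lambda>\<omega>. g (W \<omega>))"
    unfolding indep_var_eq using fZ gW by (auto intro!: indep_set_sigma_sets)
  have e: "(case_bool borel borel :: bool \<Rightarrow> ennreal measure) = (\<lambda>_. borel)" by (auto split: bool.split)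
  have "(\<integral>\<^sup>+\<omega>. (\<Prod>i\<in>UNIV. case_bool (\<lambda>\<omega>. f (Z \<omega>)) (\<lambda>\<omega>. g (W \<omega>)) i \<omega>) \<partial>M)
      = (\<Prod>i\<in>UNIV. \<integral>\<^sup>+\<omega>. case_bool (\<lambda>\<omega>. f (Z \<omega>)) (\<lambda>\<omega>. g (W \<omega>)) i \<omega> \<partial>M)"
    using iv unfolding indep_var_def e by (intro indep_vars_nn_integral) auto
  then show ?thesis by (simp add: UNIV_bool mult.commute)
qed

text \<open>Times at distance at most \<open>T / 2 ^ m\<close> lie in the same or in adjacent
  intervals of level \<open>m\<close>, so at most three oscillations add up.\<close>

lemma dyadic_modulus:
  assumes T: "T > 0" and v: "0 < v" "v < 1" and q: "q \<ge> 0" and cont: "continuous_on {0..T} y"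
    and bd: "\<And>k j. j < 2 ^ k \<Longrightarrow> \<bar>dinc T y k j\<bar> \<le> q * v ^ k"
    and st: "s \<in> {0..T}" "t \<in> {0..T}" "\<bar>s - t\<bar> \<le> T / 2 ^ m"
  shows "\<bar>y s - y t\<bar> \<le> q * (3 * v ^ m / (1 - v))"
proof -
  have osc: "\<bar>y r - y (dy T m i)\<bar> \<le> q * v ^ m / (1 - v)" if i: "i < 2 ^ m" and r: "r \<in> {dy T m i..dy T m (Suc i)}" for i r
  proof (rule dyadic_oscillation[OF T _ v(2) q _ _ r])
    show "continuous_on {dy T m i..dy T m (Suc i)} y"
      using dy_in[of T i m] dy_in[of T "Suc i" m] i T by (intro continuous_on_subset[OF cont]) auto
    fix n l assume l: "l < 2 ^ n * Suc i"
    have "l < 2 ^ (m + n)" by (rule dyadic_descendant_less[OF i l])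
    then show "\<bar>dinc T y (m + n) l\<bar> \<le> q * v ^ (m + n)" by (rule bd)
  qed (use v in auto)
  have main: "\<bar>y s - y t\<bar> \<le> q * (3 * v ^ m / (1 - v))"
    if s: "0 \<le> s" "s < t" "t \<le> T" "t - s \<le> T / 2 ^ m" for s t
  proof -
    define i where "i = nat \<lfloor>s * 2 ^ m / T\<rfloor>"
    have lo: "real i \<le> s * 2 ^ m / T" and hi: "s * 2 ^ m / T < real i + 1"
      unfolding i_def using s T by (auto simp: of_nat_nat)
    have si: "dy T m i \<le> s" "s \<le> dy T m (Suc i)"
      using lo hi T unfolding dy_def by (auto simp: field_simps)
    have "real i < 2 ^ m"
    proof -
      have "s * 2 ^ m / T < 2 ^ m" using s T by (simp add: divide_less_eq)
      then show ?thesis using lo by linarith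
    qed
    then have i: "i < 2 ^ m" by (metis of_nat_less_iff of_nat_numeral of_nat_power)
    let ?b = "q * v ^ m / (1 - v)"
    have b0: "?b \<ge> 0" using q v by simp
    have s1: "\<bar>y s - y (dy T m i)\<bar> \<le> ?b" using si by (intro osc i) auto
    have "\<bar>y s - y t\<bar> \<le> 3 * ?b"
    proof (cases "t \<le> dy T m (Suc i)")
      case True
      have "\<bar>y t - y (dy T m i)\<bar> \<le> ?b" using True si s by (intro osc i) auto
      then show ?thesis using s1 b0 by linarith
    next
      case False
      have "dy T m (Suc (Suc i)) = dy T m (Suc i) + T / 2 ^ m" using dy_diff[of T m "Suc i"] by simp
      then have t2: "t \<le> dy T m (Suc (Suc i))" using si s by simp
      \<comment> \<open>The interval to the right exists because its left endpoint lies before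
        \<open>t \<le> T\<close>.\<close>
      have "Suc i < 2 ^ m"
      proof (rule ccontr)
        assume "\<not> Suc i < 2 ^ m"
        then have "Suc i = 2 ^ m" using i by simp
        then have "dy T m (Suc i) = T" by (simp add: dy_def)
        then show False using False s by simp
      qed
      then have "\<bar>y t - y (dy T m (Suc i))\<bar> \<le> ?b" using False t2 by (intro osc) auto
      moreover have "\<bar>y (dy T m (Suc i)) - y (dy T m i)\<bar> \<le> ?b"
        using dy_mono[of T i "Suc i" m] T by (intro osc i) auto
      ultimately show ?thesis using s1 by linarith
    qed
    then show ?thesis by (simp add: mult_ac)
  qed
  show ?thesis
  proof (cases s t rule: linorder_cases)
    case less
    then show ?thesis using main[of s t] st by auto
  next
    case equal
    then show ?thesis using q v by simp
  next
    case greater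
    then show ?thesis using main[of t s] st by (auto simp: abs_minus_commute)
  qed
qed

section \<open>Moments of the dyadic Hoelder seminorm\<close>

text \<open>The fourth power of the dyadic Hoelder seminorm whose order is minus the binary
  logarithm of \<open>v\<close>. As a countable supremum in \<open>ennreal\<close> it is measurable
  on \<open>path_space\<close> whether or not it is finite.\<close>

definition hoelder4 :: "real \<Rightarrow> real \<Rightarrow> (real \<Rightarrow> real) \<Rightarrow> ennreal" where
  "hoelder4 T v y = (SUP k. SUP j\<in>{..<2 ^ k}. ennreal ((\<bar>dinc T y k j\<bar> / v ^ k) ^ 4))"

lemma measurable_hoelder4:
  assumes "T \<ge> 0"
  shows "hoelder4 T v \<in> borel_measurable path_space"
proof -
  note [measurable] = measurable_dinc_path[OF assms]
  show ?thesis unfolding hoelder4_def[abs_def] by measurable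
qed

lemma hoelder4_sample_path:
  "T \<ge> 0 \<Longrightarrow> hoelder4 T v (sample_path X \<omega>) = hoelder4 T v (\<lambda>t. X t \<omega>)"
  by (simp add: hoelder4_def dinc_sample_path)

lemma gauss_weight_sample_path:
  "T \<ge> 0 \<Longrightarrow> gauss_weight T H (sample_path X \<omega>) = gauss_weight T H (\<lambda>t. X t \<omega>)"
  by (simp add: gauss_weight_def gauss_term_def dinc_sample_path)

lemma dinc_le_hoelder4:
  assumes h: "hoelder4 T v y = ennreal s" "s \<ge> 0" and v: "v > 0" and j: "j < 2 ^ k"
  shows "\<bar>dinc T y k j\<bar> \<le> sqrt (sqrt s) * v ^ k"
proof -
  have "ennreal ((\<bar>dinc T y k j\<bar> / v ^ k) ^ 4) \<le> hoelder4 T v y"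
    unfolding hoelder4_def using j by (intro SUP_upper2[of k] SUP_upper2[of j]) auto
  then have "(\<bar>dinc T y k j\<bar> / v ^ k) ^ 4 \<le> s" using h by (simp add: ennreal_le_iff)
  then have "((\<bar>dinc T y k j\<bar> / v ^ k)\<^sup>2)\<^sup>2 \<le> s" by (simp add: power_mult[symmetric])
  then have "(\<bar>dinc T y k j\<bar> / v ^ k)\<^sup>2 \<le> sqrt s" by (rule real_le_rsqrt)
  then have "\<bar>dinc T y k j\<bar> / v ^ k \<le> sqrt (sqrt s)" by (rule real_le_rsqrt)
  then show ?thesis using v by (simp add: pos_divide_le_eq)
qed

section \<open>Consequences of the hypotheses on coefficients and paths\<close>

lemma lipschitz_of_bounded_deriv:
  fixes f :: "real \<Rightarrow> real"
  assumes "\<forall>x. f differentiable at x" "bounded (range (deriv f))"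
  shows "\<exists>K\<ge>0. \<forall>x y. \<bar>f x - f y\<bar> \<le> K * \<bar>x - y\<bar>"
proof -
  obtain K where K: "\<And>x. norm (deriv f x) \<le> K" using assms(2) by (auto simp: bounded_iff)
  have D: "(f has_field_derivative deriv f x) (at x within UNIV)" for x
    using assms(1) by (simp add: DERIV_deriv_iff_real_differentiable)
  have "norm (f x - f y) \<le> K * norm (x - y)" for x y
    by (rule field_differentiable_bound[OF convex_UNIV D K]) auto
  moreover have "K \<ge> 0" using K[of 0] norm_ge_zero order_trans by blast
  ultimately show ?thesis by auto
qed

lemma holder_on_imp_dinc_bound:
  assumes h: "holder_on {0..T} \<alpha> x" and T: "T > 0"
  shows "\<exists>a. \<forall>k. \<forall>j<2 ^ k. \<bar>dinc T x k j\<bar> \<le> a * (2 powr (- \<alpha>)) ^ k"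
proof -
  obtain C where C: "\<And>s t. s \<in> {0..T} \<Longrightarrow> t \<in> {0..T} \<Longrightarrow> \<bar>x s - x t\<bar> \<le> C * \<bar>s - t\<bar> powr \<alpha>"
    using h unfolding holder_on_def by blast
  have "\<bar>dinc T x k j\<bar> \<le> C * T powr \<alpha> * (2 powr (- \<alpha>)) ^ k" if j: "j < 2 ^ k" for k j
  proof -
    have "\<bar>dinc T x k j\<bar> \<le> C * \<bar>dy T k (Suc j) - dy T k j\<bar> powr \<alpha>"
      unfolding dinc_def using j T by (intro C dy_in) auto
    also have "\<bar>dy T k (Suc j) - dy T k j\<bar> powr \<alpha> = T powr \<alpha> / (2 ^ k) powr \<alpha>"
      unfolding dy_diff using T by (simp add: powr_divide)
    also have "(2 ^ k) powr \<alpha> = (2 powr \<alpha>) ^ k"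
      by (simp add: powr_realpow[symmetric] powr_powr mult.commute)
    finally show ?thesis by (simp add: powr_minus power_inverse divide_inverse mult.assoc)
  qed
  then show ?thesis by blast
qed

lemma holder_on_imp_continuous_on:
  assumes "holder_on S \<alpha> x"
  shows "continuous_on S x"
proof -
  obtain C where C: "\<And>s t. s \<in> S \<Longrightarrow> t \<in> S \<Longrightarrow> \<bar>x s - x t\<bar> \<le> C * \<bar>s - t\<bar> powr \<alpha>" and \<alpha>: "\<alpha> > 0"
    using assms by (auto simp: holder_on_def)
  show ?thesis
    unfolding continuous_on
  proof
    fix t assume t: "t \<in> S"
    have "((\<lambda>s. C * \<bar>s - t\<bar> powr \<alpha>) \<longlongrightarrow> C * \<bar>t - t\<bar> powr \<alpha>) (at t within S)"
      using \<alpha> by (intro tendsto_intros tendsto_powr') auto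
    then have "((\<lambda>s. C * \<bar>s - t\<bar> powr \<alpha>) \<longlongrightarrow> 0) (at t within S)" using \<alpha> by simp
    then have "((\<lambda>s. x s - x t) \<longlongrightarrow> 0) (at t within S)"
      by (rule Lim_null_comparison[rotated]) (use C t in \<open>auto simp: eventually_at_filter\<close>)
    then show "(x \<longlongrightarrow> x t) (at t within S)" by (simp add: LIM_zero_iff)
  qed
qed

text \<open>Bounded coefficients are immediate; in the other case Lipschitz coefficients grow at
  most linearly, and the fourth moment of \<open>X0\<close> suffices.\<close>

lemma coefficient_fourth_moment:
  fixes \<sigma> b :: "real \<Rightarrow> real"
  assumes "prob_space M" and X0: "X0 \<in> borel_measurable M"
    and lip: "\<And>y z. \<bar>\<sigma> y - \<sigma> z\<bar> \<le> Lip * \<bar>y - z\<bar>" "\<And>y z. \<bar>b y - b z\<bar> \<le> Lip * \<bar>y - z\<bar>"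
    and meas: "\<sigma> \<in> borel_measurable borel" "b \<in> borel_measurable borel"
    and or: "(bounded (range \<sigma>) \<and> bounded (range b)) \<or> integrable M (\<lambda>\<omega>. \<bar>X0 \<omega>\<bar> ^ 4)"
  shows "(\<integral>\<^sup>+\<omega>. ennreal ((\<bar>\<sigma> (X0 \<omega>)\<bar> + \<bar>b (X0 \<omega>)\<bar>) ^ 4) \<partial>M) < \<infinity>"
proof -
  interpret prob_space M by fact
  note [measurable] = X0 meas
  have p4: "(a + c) ^ 4 \<le> 16 * a ^ 4 + 16 * c ^ 4" if "a \<ge> 0" "c \<ge> 0" for a c :: real
  proof -
    have "(a + c) ^ 4 \<le> (2 * max a c) ^ 4" using that by (intro power_mono) auto
    also have "\<dots> = 16 * max a c ^ 4" by (simp add: power_mult_distrib)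
    also have "\<dots> \<le> 16 * a ^ 4 + 16 * c ^ 4" using that by (auto simp: max_def)
    finally show ?thesis .
  qed
  have "integrable M (\<lambda>\<omega>. (\<bar>\<sigma> (X0 \<omega>)\<bar> + \<bar>b (X0 \<omega>)\<bar>) ^ 4)"
    using or
  proof
    assume "bounded (range \<sigma>) \<and> bounded (range b)"
    then obtain K K' where K: "\<And>x. \<bar>\<sigma> x\<bar> \<le> K" "\<And>x. \<bar>b x\<bar> \<le> K'" by (auto simp: bounded_iff)
    show ?thesis
      by (rule integrable_const_bound[of _ "(K + K') ^ 4"]) (auto intro!: power_mono add_mono K)
  next
    assume i: "integrable M (\<lambda>\<omega>. \<bar>X0 \<omega>\<bar> ^ 4)"
    let ?c = "\<bar>\<sigma> 0\<bar> + \<bar>b 0\<bar>"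
    have "integrable M (\<lambda>\<omega>. 16 * ?c ^ 4 + 16 * ((2 * \<bar>Lip\<bar>) ^ 4 * \<bar>X0 \<omega>\<bar> ^ 4))" using i by simp
    then show ?thesis
    proof (rule Bochner_Integration.integrable_bound)
      show "AE \<omega> in M. norm ((\<bar>\<sigma> (X0 \<omega>)\<bar> + \<bar>b (X0 \<omega>)\<bar>) ^ 4) \<le> norm (16 * ?c ^ 4 + 16 * ((2 * \<bar>Lip\<bar>) ^ 4 * \<bar>X0 \<omega>\<bar> ^ 4))"
      proof (rule AE_I2)
        fix \<omega>
        have "Lip * \<bar>X0 \<omega> - 0\<bar> \<le> \<bar>Lip\<bar> * \<bar>X0 \<omega>\<bar>" by (simp add: mult_right_mono)
        then have "\<bar>\<sigma> (X0 \<omega>)\<bar> + \<bar>b (X0 \<omega>)\<bar> \<le> ?c + 2 * \<bar>Lip\<bar> * \<bar>X0 \<omega>\<bar>"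
          using lip(1)[of "X0 \<omega>" 0] lip(2)[of "X0 \<omega>" 0] unfolding mult.assoc by linarith
        then have "(\<bar>\<sigma> (X0 \<omega>)\<bar> + \<bar>b (X0 \<omega>)\<bar>) ^ 4 \<le> (?c + 2 * \<bar>Lip\<bar> * \<bar>X0 \<omega>\<bar>) ^ 4" by (intro power_mono) auto
        also have "\<dots> \<le> 16 * ?c ^ 4 + 16 * (2 * \<bar>Lip\<bar> * \<bar>X0 \<omega>\<bar>) ^ 4" by (intro p4) auto
        finally show "norm ((\<bar>\<sigma> (X0 \<omega>)\<bar> + \<bar>b (X0 \<omega>)\<bar>) ^ 4) \<le> norm (16 * ?c ^ 4 + 16 * ((2 * \<bar>Lip\<bar>) ^ 4 * \<bar>X0 \<omega>\<bar> ^ 4))"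
          by (simp add: power_mult_distrib)
      qed
    qed measurable
  qed
  then show ?thesis
    by (subst nn_integral_eq_integral) auto
qed

text \<open>Pathwise, the seminorm is at most the size of the coefficients at \<open>X 0\<close>
  times an exponential in the squared Hoelder constant of \<open>B\<close>. Its fourth power is thus
  below a function of \<open>X 0\<close> times a multiple of \<open>gauss_weight\<close>, and
  independence splits the expectation into two finite factors.\<close>

theorem sde_hoelder4_moment:
  fixes M0 :: "'b measure"
  assumes M0: "prob_space M0" and H: "1 / 2 < H" "H < 1" and T: "T > 0"
    and B: "fractional_brownian_motion M0 H B"
    and X: "young_sde_solution M0 H \<sigma> b B X"
    and ind: "independent_variables M0 borel (X 0) path_space (sample_path B)"
    and diff: "\<forall>x. \<sigma> differentiable at x" "\<forall>x. b differentiable at x"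
    and bdd: "bounded (range (deriv \<sigma>))" "bounded (range (deriv b))"
    and or: "(bounded (range \<sigma>) \<and> bounded (range b)) \<or> integrable M0 (\<lambda>\<omega>. \<bar>X 0 \<omega>\<bar> ^ 4)"
  shows "\<exists>v. 0 < v \<and> v < 1 \<and> (\<integral>\<^sup>+\<omega>. hoelder4 T v (\<lambda>t. X t \<omega>) \<partial>M0) < \<infinity>"
proof -
  interpret prob_space M0 by fact
  \<comment> \<open>Midway: above \<open>1 / 2\<close> for Young's estimate, and below
    \<open>H\<close> so that \<open>gauss_weight\<close> controls the increments of
    \<open>B\<close>.\<close>
  define \<beta> where "\<beta> = (H + 1 / 2) / 2"
  have \<beta>: "1 / 2 < \<beta>" "\<beta> < H" "\<beta> < 1" using H by (auto simp: \<beta>_def)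
  define v where "v = 2 powr (- \<beta>)"
  have two: "(2::real) powr (-1) = 1 / 2" by (simp add: powr_minus_divide)
  have v: "1 / 2 \<le> v" "v < 1" "v > 0"
  proof -
    have "(2::real) powr (-1) \<le> 2 powr (- \<beta>)" using \<beta> by (intro powr_mono) auto
    then show "1 / 2 \<le> v" unfolding two v_def .
    have "(2::real) powr (- \<beta>) < 2 powr 0" using \<beta> by (intro powr_less_mono) auto
    then show "v < 1" by (simp add: v_def)
  qed (simp add: v_def)
  have vv: "2 * (v * v) < 1"
  proof -
    have "2 * (v * v) = 2 powr 1 * (2 powr (- \<beta>) * 2 powr (- \<beta>))" by (simp add: v_def)
    also have "\<dots> = 2 powr (1 - 2 * \<beta>)" unfolding powr_add[symmetric] by simp
    also have "\<dots> < 2 powr 0" using \<beta> by (intro powr_less_mono) auto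
    finally show ?thesis by simp
  qed
  have vH: "2 powr (- H) < v" unfolding v_def using \<beta> by (intro powr_less_mono) auto
  obtain K1 K2 where K: "K1 \<ge> 0" "\<And>x y. \<bar>\<sigma> x - \<sigma> y\<bar> \<le> K1 * \<bar>x - y\<bar>" "K2 \<ge> 0" "\<And>x y. \<bar>b x - b y\<bar> \<le> K2 * \<bar>x - y\<bar>"
    using lipschitz_of_bounded_deriv[OF diff(1) bdd(1)] lipschitz_of_bounded_deriv[OF diff(2) bdd(2)] by metis
  define Lip where "Lip = 1 + K1 + K2"
  have L: "Lip \<ge> 1" using K by (simp add: Lip_def)
  have lip: "\<bar>\<sigma> x - \<sigma> y\<bar> \<le> Lip * \<bar>x - y\<bar>" "\<bar>b x - b y\<bar> \<le> Lip * \<bar>x - y\<bar>" for x y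
  proof -
    have "K1 * \<bar>x - y\<bar> \<le> Lip * \<bar>x - y\<bar>" "K2 * \<bar>x - y\<bar> \<le> Lip * \<bar>x - y\<bar>"
      using K by (auto simp: Lip_def intro!: mult_right_mono)
    then show "\<bar>\<sigma> x - \<sigma> y\<bar> \<le> Lip * \<bar>x - y\<bar>" "\<bar>b x - b y\<bar> \<le> Lip * \<bar>x - y\<bar>"
      using K(2)[of x y] K(4)[of x y] by linarith+
  qed
  have cont: "continuous_on UNIV \<sigma>" "continuous_on UNIV b"
    using lip L by (auto intro!: lipschitz_on_continuous_on[of Lip] lipschitz_onI simp: dist_real_def)
  have meas[measurable]: "\<sigma> \<in> borel_measurable borel" "b \<in> borel_measurable borel"
    using cont by (auto intro: borel_measurable_continuous_onI)
  define P where "P = T powr H"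
  have P: "P > 0" using T by (simp add: P_def)
  \<comment> \<open>The Hoelder constant used for \<open>B\<close> has square
    \<open>4 * P\<^sup>2 * (ln s + c)\<close>; with this \<delta> the fourth power of
    \<open>exp (\<delta> * g\<^sup>2)\<close> is \<open>exp c * s\<close>, linear in the integrable
    weight.\<close>
  define \<delta> where "\<delta> = 1 / (16 * P\<^sup>2)"
  have \<delta>: "\<delta> > 0" using P by (simp add: \<delta>_def)
  obtain C where C: "C \<ge> 0" and young: "\<And>\<sigma> b x B g Q0 k j. young_solution T Lip \<sigma> b x B v g Q0 \<Longrightarrow> j < 2 ^ k \<Longrightarrow>
     \<bar>dinc T x k j\<bar> \<le> (\<bar>\<sigma> (x 0)\<bar> + \<bar>b (x 0)\<bar>) * (C * exp (\<delta> * g\<^sup>2)) * v ^ k"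
    using young_solution_dyadic_bound[OF T L v(1,2) vv \<delta>] by blast
  obtain c where c: "c \<ge> 0" and gw: "\<And>y s. gauss_weight T H y = ennreal s \<Longrightarrow> s \<ge> 0 \<Longrightarrow> s \<ge> 1 \<and>
    (\<forall>k. \<forall>j<2 ^ k. \<bar>dinc T y k j\<bar> \<le> sqrt (4 * P\<^sup>2 * (ln s + c)) * v ^ k)"
    using gauss_weight_dyadic_bound[OF T vH] unfolding P_def by blast
  let ?A = "\<lambda>x. \<bar>\<sigma> x\<bar> + \<bar>b x\<bar>"
  define f where "f x = ennreal (?A x ^ 4)" for x
  define g where "g y = ennreal (C ^ 4 * exp c) * gauss_weight T H y" for y
  have T0: "T \<ge> 0" using T by simp
  have g_meas: "g \<in> borel_measurable path_space"
    unfolding g_def using measurable_gauss_weight[OF T0] by measurable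
  have f_meas: "f \<in> borel_measurable borel" unfolding f_def by measurable
  have spB[measurable]: "sample_path B \<in> measurable M0 path_space" and X0: "X 0 \<in> borel_measurable M0"
    using ind by (auto simp: independent_variables_def)
  have gB: "(\<lambda>\<omega>. gauss_weight T H (sample_path B \<omega>)) \<in> borel_measurable M0"
    using measurable_compose[OF spB measurable_gauss_weight[OF T0]] .
  have EG: "(\<integral>\<^sup>+\<omega>. gauss_weight T H (sample_path B \<omega>) \<partial>M0) < \<infinity>"
    using gauss_weight_expectation_finite[OF B _ T] H by (simp add: gauss_weight_sample_path[OF T0])
  have "AE \<omega> in M0. gauss_weight T H (sample_path B \<omega>) \<noteq> \<infinity>"
    using gB EG by (intro nn_integral_PInf_AE) auto
  moreover have "AE \<omega> in M0. \<exists>\<alpha>>1 - H. \<forall>T\<ge>0. holder_on {0..T} \<alpha> (\<lambda>t. X t \<omega>)"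
    and "AE \<omega> in M0. \<forall>t\<ge>0. has_RS_integral (\<lambda>r. \<sigma> (X r \<omega>)) (\<lambda>r. B r \<omega>) 0 t (X t \<omega> - X 0 \<omega> - integral {0..t} (\<lambda>r. b (X r \<omega>)))"
    using X by (auto simp: young_sde_solution_def)
  ultimately have "AE \<omega> in M0. hoelder4 T v (\<lambda>t. X t \<omega>) \<le> f (X 0 \<omega>) * g (sample_path B \<omega>)"
  proof eventually_elim
    case (elim \<omega>)
    let ?x = "\<lambda>t. X t \<omega>" and ?B = "\<lambda>t. B t \<omega>"
    obtain s where s: "gauss_weight T H ?B = ennreal s" "s \<ge> 0"
      using elim(1) by (cases "gauss_weight T H ?B") (auto simp: gauss_weight_sample_path[OF T0])
    have s1: "s \<ge> 1" and Bv: "\<forall>k. \<forall>j<2 ^ k. \<bar>dinc T ?B k j\<bar> \<le> sqrt (4 * P\<^sup>2 * (ln s + c)) * v ^ k"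
      using gw[OF s] by (rule conjunct1, rule conjunct2)
    obtain \<alpha> where \<alpha>: "\<alpha> > 1 - H" and hol: "holder_on {0..T} \<alpha> ?x" using elim(2) T0 by blast
    have \<alpha>1: "\<alpha> \<le> 1" "\<alpha> > 0" using hol by (auto simp: holder_on_def)
    obtain a where a: "\<And>k j. j < 2 ^ k \<Longrightarrow> \<bar>dinc T ?x k j\<bar> \<le> a * (2 powr (- \<alpha>)) ^ k"
      using holder_on_imp_dinc_bound[OF hol T] by blast
    have contx: "continuous_on {0..T} ?x" by (rule holder_on_imp_continuous_on[OF hol])
    \<comment> \<open>The order \<alpha> of the path depends on \<omega> and may be below
      \<open>1 / 2\<close>. An order for \<open>B\<close> strictly between
      \<open>1 - \<alpha>\<close> and \<open>H\<close> satisfies Young's condition together with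
      \<alpha>, and \<open>gauss_weight\<close> bounds \<open>B\<close> at that order as
      well.\<close>
    define \<beta>' where "\<beta>' = (1 - \<alpha> + H) / 2"
    have \<beta>': "\<beta>' < H" "1 - \<alpha> < \<beta>'" using \<alpha> by (auto simp: \<beta>'_def)
    have "2 powr (- H) < 2 powr (- \<beta>')" using \<beta>' by (intro powr_less_mono) auto
    from gauss_weight_dyadic_bound[OF T this] s obtain g' where
      Bw: "\<And>k j. j < 2 ^ k \<Longrightarrow> \<bar>dinc T ?B k j\<bar> \<le> g' * (2 powr (- \<beta>')) ^ k" by blast
    have uw: "2 * (2 powr (- \<alpha>) * 2 powr (- \<beta>')) < 1"
    proof -
      have "2 * (2 powr (- \<alpha>) * 2 powr (- \<beta>')) = 2 powr 1 * (2 powr (- \<alpha>) * 2 powr (- \<beta>'))" by simp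
      also have "\<dots> = 2 powr (1 + (- \<alpha> + - \<beta>'))" by (simp only: powr_add)
      also have "\<dots> < 2 powr 0" using \<beta>' by (intro powr_less_mono) auto
      finally show ?thesis by simp
    qed
    have RS: "\<And>t. t \<in> {0..T} \<Longrightarrow> has_RS_integral (\<lambda>r. \<sigma> (?x r)) ?B 0 t (?x t - ?x 0 - integral {0..t} (\<lambda>r. b (?x r)))"
      using elim(3) by auto
    interpret rs_solution T Lip \<sigma> b ?x ?B
      by unfold_locales (use T L lip contx RS in auto)
    obtain Q where Q: "\<forall>k. \<forall>j<2 ^ k. \<bar>dinc T ?x k j\<bar> \<le> Q * v ^ k"
      using dyadic_regularity[OF powr_ge_zero powr_ge_zero uw v(1) a Bw Bv[rule_format]] by blast
    have "young_solution T Lip \<sigma> b ?x ?B v (sqrt (4 * P\<^sup>2 * (ln s + c))) Q"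
      by unfold_locales (use v vv Q Bv in auto)
    note young' = young[OF this]
    have lns: "0 \<le> ln s + c" using s1 c by simp
    have "\<delta> * (sqrt (4 * P\<^sup>2 * (ln s + c)))\<^sup>2 = (ln s + c) / 4"
      using lns P by (simp add: \<delta>_def)
    note bound = young'[unfolded this]
    have "hoelder4 T v ?x \<le> ennreal (?A (?x 0) ^ 4 * (C ^ 4 * exp c * s))"
      unfolding hoelder4_def
    proof (intro SUP_least ennreal_leI)
      fix k j assume "j \<in> {..<(2::nat) ^ k}"
      then have "\<bar>dinc T ?x k j\<bar> / v ^ k \<le> ?A (?x 0) * (C * exp ((ln s + c) / 4))"
        using bound v by (simp add: pos_divide_le_eq)
      then have "(\<bar>dinc T ?x k j\<bar> / v ^ k) ^ 4 \<le> (?A (?x 0) * (C * exp ((ln s + c) / 4))) ^ 4"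
        using v by (intro power_mono) auto
      also have "\<dots> = ?A (?x 0) ^ 4 * (C ^ 4 * exp ((ln s + c) / 4) ^ 4)" by (simp add: power_mult_distrib)
      also have "exp ((ln s + c) / 4) ^ 4 = exp (ln s + c)"
      proof -
        define r where "r = (ln s + c) / 4"
        have "exp (real 4 * r) = exp r ^ 4" by (rule exp_of_nat_mult)
        moreover have "real 4 * r = ln s + c" by (simp add: r_def)
        ultimately show ?thesis unfolding r_def by metis
      qed
      also have "exp (ln s + c) = exp c * s" using s1 by (simp add: exp_add)
      finally show "(\<bar>dinc T ?x k j\<bar> / v ^ k) ^ 4 \<le> ?A (?x 0) ^ 4 * (C ^ 4 * exp c * s)" by (simp add: mult.assoc)
    qed
    also have "\<dots> = f (X 0 \<omega>) * g (sample_path B \<omega>)"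
      unfolding f_def g_def gauss_weight_sample_path[OF T0] s(1) using s C
      by (simp add: ennreal_mult)
    finally show ?case .
  qed
  then have "(\<integral>\<^sup>+\<omega>. hoelder4 T v (\<lambda>t. X t \<omega>) \<partial>M0) \<le> (\<integral>\<^sup>+\<omega>. f (X 0 \<omega>) * g (sample_path B \<omega>) \<partial>M0)"
    by (rule nn_integral_mono_AE)
  also have "\<dots> = (\<integral>\<^sup>+\<omega>. f (X 0 \<omega>) \<partial>M0) * (\<integral>\<^sup>+\<omega>. g (sample_path B \<omega>) \<partial>M0)"
    by (rule independent_nn_integral_mult[OF M0 ind f_meas g_meas])
  also have "\<dots> < \<infinity>"
  proof -
    have "(\<integral>\<^sup>+\<omega>. f (X 0 \<omega>) \<partial>M0) < \<infinity>"
      unfolding f_def by (rule coefficient_fourth_moment[OF M0 X0 lip meas or])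
    moreover have "(\<integral>\<^sup>+\<omega>. g (sample_path B \<omega>) \<partial>M0) < \<infinity>"
      unfolding g_def using EG gB by (simp add: nn_integral_cmult ennreal_mult_less_top)
    ultimately show ?thesis by (simp add: ennreal_mult_less_top)
  qed
  finally show ?thesis using v by blast
qed

section \<open>Empirical spectral measures\<close>

text \<open>Only laws are transferred: \<open>hoelder4\<close> is a functional on
  \<open>path_space\<close>, so its expectation for the copies is that for \<open>X\<close>. The
  array \<open>V\<close> holds squared seminorms, whose second moment is the fourth moment of the
  seminorm.\<close>

theorem iid_copies_hoelder_bound:
  fixes XX :: "nat \<times> nat \<Rightarrow> real \<Rightarrow> 'a \<Rightarrow> real"
  assumes M: "prob_space M" and iid: "iid_copies M XX M0 X"
    and X: "sample_path X \<in> measurable M0 path_space" and T: "T > 0" and v: "v > 0"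
    and fin: "(\<integral>\<^sup>+\<omega>. hoelder4 T v (\<lambda>t. X t \<omega>) \<partial>M0) < \<infinity>"
  shows "AE \<omega> in M. \<exists>q R. (\<forall>k. 0 \<le> q k \<and> (\<forall>n. \<forall>j<2 ^ n. \<bar>dinc T (\<lambda>t. XX k t \<omega>) n j\<bar> \<le> q k * v ^ n)) \<and>
      (\<forall>N. (\<Sum>k\<in>tri N. (q k)\<^sup>2) \<le> R * (real N)\<^sup>2)"
proof -
  interpret prob_space M by fact
  have T0: "T \<ge> 0" using T by simp
  have indep: "indep_vars (\<lambda>_. path_space) (\<lambda>k. sample_path (XX k)) UNIV"
    and dist: "\<And>k. distr M path_space (sample_path (XX k)) = distr M0 path_space (sample_path X)"
    using iid by (auto simp: iid_copies_def)
  have XXm[measurable]: "sample_path (XX k) \<in> measurable M path_space" for k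
    using indep unfolding indep_vars_def by (cases k) simp
  let ?h = "hoelder4 T v"
  note h_meas[measurable] = measurable_hoelder4[OF T0, of v]
  define \<nu> where "\<nu> = distr M0 path_space (sample_path X)"
  have E: "(\<integral>\<^sup>+\<omega>. ?h (sample_path (XX k) \<omega>) \<partial>M) = (\<integral>\<^sup>+y. ?h y \<partial>\<nu>)" for k
    unfolding \<nu>_def dist[of k, symmetric] by (subst nn_integral_distr) auto
  have "(\<integral>\<^sup>+y. ?h y \<partial>\<nu>) = (\<integral>\<^sup>+\<omega>. ?h (sample_path X \<omega>) \<partial>M0)"
    unfolding \<nu>_def by (rule nn_integral_distr[OF X]) simp
  then have Efin: "(\<integral>\<^sup>+y. ?h y \<partial>\<nu>) < \<infinity>"
    using fin by (simp add: hoelder4_sample_path[OF T0])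
  have AEfin: "AE \<omega> in M. ?h (sample_path (XX k) \<omega>) \<noteq> \<infinity>" for k
    using E[of k] Efin by (intro nn_integral_PInf_AE) auto
  define V where "V k \<omega> = sqrt (enn2real (?h (sample_path (XX k) \<omega>)))" for k \<omega>
  have V[measurable]: "V k \<in> borel_measurable M" for k unfolding V_def by measurable
  have V2: "(V k \<omega>)\<^sup>2 = enn2real (?h (sample_path (XX k) \<omega>))" for k \<omega> by (simp add: V_def)
  have EV2: "(\<integral>\<^sup>+\<omega>. ennreal ((V k \<omega>)\<^sup>2) \<partial>M) = (\<integral>\<^sup>+y. ?h y \<partial>\<nu>)" for k
  proof -
    have "(\<integral>\<^sup>+\<omega>. ennreal ((V k \<omega>)\<^sup>2) \<partial>M) = (\<integral>\<^sup>+\<omega>. ?h (sample_path (XX k) \<omega>) \<partial>M)"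
      unfolding V2 using AEfin[of k] by (intro nn_integral_cong_AE) (auto simp: less_top)
    then show ?thesis using E by simp
  qed
  have sq: "integrable M (\<lambda>\<omega>. (V k \<omega>)\<^sup>2)" for k
    using EV2[of k] Efin by (intro integrableI_nonneg) auto
  have mean: "expectation (V k) = (\<integral>y. sqrt (enn2real (?h y)) \<partial>\<nu>)" for k
    unfolding \<nu>_def dist[of k, symmetric] V_def by (subst integral_distr) auto
  have q: "expectation (\<lambda>\<omega>. (V k \<omega>)\<^sup>2) \<le> enn2real (\<integral>\<^sup>+y. ?h y \<partial>\<nu>)" for k
    using EV2[of k] by (subst integral_eq_nn_integral) auto
  have Vind: "indep_vars (\<lambda>_. borel) V UNIV"
    unfolding V_def[abs_def] by (rule indep_vars_compose2[OF indep]) measurable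
  have "AE \<omega> in M. \<forall>k. ?h (sample_path (XX k) \<omega>) \<noteq> \<infinity>"
    using AEfin by (simp add: AE_all_countable)
  with triangular_array_sum_bounded[OF Vind sq mean q] show ?thesis
  proof eventually_elim
    case (elim \<omega>)
    obtain R where R: "\<And>N. (\<Sum>k\<in>tri N. V k \<omega>) \<le> R * (real N)\<^sup>2" using elim(1) by blast
    define q where "q k = sqrt (V k \<omega>)" for k
    have V0: "V k \<omega> \<ge> 0" for k by (simp add: V_def)
    have "\<bar>dinc T (\<lambda>t. XX k t \<omega>) n j\<bar> \<le> q k * v ^ n" if "j < 2 ^ n" for k n j
    proof -
      have "?h (\<lambda>t. XX k t \<omega>) = ennreal (enn2real (?h (sample_path (XX k) \<omega>)))"
        using elim(2)[rule_format, of k] by (simp add: hoelder4_sample_path[OF T0] less_top)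
      from dinc_le_hoelder4[OF this _ v that] show ?thesis by (simp add: q_def V_def)
    qed
    moreover have "q k \<ge> 0" for k using V0 by (simp add: q_def)
    moreover have "(\<Sum>k\<in>tri N. (q k)\<^sup>2) \<le> R * (real N)\<^sup>2" for N
      using R[of N] V0 by (simp add: q_def)
    ultimately show ?case by blast
  qed
qed

text \<open>The factor \<open>2\<close> on the diagonal, which is the square of the
  \<open>sqrt 2\<close> in \<open>Y_mat\<close>, matches the double occurrence of each off-diagonal
  entry, so no correction term appears.\<close>

lemma sum_symmetric_square:
  fixes h :: "nat \<times> nat \<Rightarrow> real"
  shows "(\<Sum>i<N. \<Sum>j<N. if i = j then 2 * h (i, i) else h (min i j, max i j)) = 2 * (\<Sum>k\<in>tri N. h k)"
proof (induction N)
  case (Suc N)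
  let ?g = "\<lambda>i j. if i = j then 2 * h (i, i) else h (min i j, max i j)"
  have set: "tri (Suc N) = tri N \<union> (\<lambda>i. (i, N)) ` {..N}"
    by (auto simp: tri_def less_Suc_eq)
  have fin: "finite (tri N)"
    by (rule finite_subset[of _ "{..<N} \<times> {..<N}"]) (auto simp: tri_def)
  have "(\<Sum>k\<in>tri (Suc N). h k) = (\<Sum>k\<in>tri N. h k) + (\<Sum>i\<le>N. h (i, N))"
    unfolding set using fin by (subst sum.union_disjoint) (auto simp: tri_def sum.reindex inj_on_def)
  moreover have "(\<Sum>i<Suc N. \<Sum>j<Suc N. ?g i j) = (\<Sum>i<N. \<Sum>j<N. ?g i j) + (\<Sum>i<N. ?g i N) + (\<Sum>j<N. ?g N j) + ?g N N"
    by (simp add: sum.distrib)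
  moreover have "(\<Sum>i<N. ?g i N) = (\<Sum>i<N. h (i, N))" "(\<Sum>j<N. ?g N j) = (\<Sum>i<N. h (i, N))"
    by (auto intro!: sum.cong simp: min_def max_def)
  moreover have "(\<Sum>i\<le>N. h (i, N)) = (\<Sum>i<N. h (i, N)) + h (N, N)" by (simp add: lessThan_Suc_atMost[symmetric])
  ultimately show ?case using Suc.IH by simp
qed (simp add: tri_def)

lemma frobenius_sq_Y_mat_diff:
  assumes N: "N \<ge> 1"
  shows "frobenius_sq (Y_mat XX N t \<omega> - Y_mat XX N s \<omega>)
    = 2 / real N * (\<Sum>k\<in>tri N. (XX k t \<omega> - XX k s \<omega>)\<^sup>2)"
proof -
  define h where "h k = (XX k t \<omega> - XX k s \<omega>)\<^sup>2 / real N" for k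
  have entry: "((Y_mat XX N t \<omega> - Y_mat XX N s \<omega>) $$ (i, j))\<^sup>2 = (if i = j then 2 * h (i, i) else h (min i j, max i j))"
    if "i < N" "j < N" for i j
    using that N unfolding Y_mat_def h_def
    by (simp add: right_diff_distrib[symmetric] diff_divide_distrib[symmetric] power_mult_distrib power_divide)
  have "frobenius_sq (Y_mat XX N t \<omega> - Y_mat XX N s \<omega>)
      = (\<Sum>i<N. \<Sum>j<N. if i = j then 2 * h (i, i) else h (min i j, max i j))"
    unfolding frobenius_sq_def using entry by (intro sum.cong) (auto simp: Y_mat_def)
  also have "\<dots> = 2 * (\<Sum>k\<in>tri N. h k)" by (rule sum_symmetric_square)
  finally show ?thesis by (simp add: h_def flip: sum_divide_distrib)
qed

lemma Y_mat_symmetric: "Y_mat XX N t \<omega> \<in> carrier_mat N N" "(Y_mat XX N t \<omega>)\<^sup>T = Y_mat XX N t \<omega>"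
  by (auto simp: Y_mat_def min.commute max.commute intro!: eq_matI)

lemma integral_L:
  assumes "f \<in> borel_measurable borel"
  shows "mean (L XX N t \<omega>) f = (\<Sum>i<N. f (eigenvalue_list (Y_mat XX N t \<omega>) ! i)) / real N"
  unfolding L_def integral_empirical_spectral_measure[OF assms] using Y_mat_symmetric(1)[of XX N t \<omega>] by simp

text \<open>All powers of \<open>N\<close> cancel: by \<open>R\<close> the Frobenius norm is of
  order \<open>sqrt N\<close>, the spectral estimate contributes another \<open>sqrt N\<close>, and
  the average divides by \<open>N\<close>. The bound is therefore uniform in
  \<open>N\<close>.\<close>

lemma L_lipschitz:
  assumes N: "N \<ge> 1" and f: "\<And>x y. \<bar>f x - f y\<bar> \<le> l * \<bar>x - y\<bar>" and l: "l \<ge> 0"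
    and q: "\<And>k. 0 \<le> q k \<and> \<bar>XX k t \<omega> - XX k s \<omega>\<bar> \<le> q k * r" and r: "r \<ge> 0"
    and R: "(\<Sum>k\<in>tri N. (q k)\<^sup>2) \<le> R * (real N)\<^sup>2"
  shows "\<bar>mean (L XX N t \<omega>) f - mean (L XX N s \<omega>) f\<bar> \<le> l * (sqrt (2 * R) * r)"
proof -
  have "continuous_on UNIV f"
    using f l by (intro lipschitz_on_continuous_on[of l] lipschitz_onI) (auto simp: dist_real_def)
  then have fm: "f \<in> borel_measurable borel" by (rule borel_measurable_continuous_onI)
  let ?F = "frobenius_sq (Y_mat XX N t \<omega> - Y_mat XX N s \<omega>)"
  have Npos: "real N > 0" using N by simp
  have "(\<Sum>k\<in>tri N. (XX k t \<omega> - XX k s \<omega>)\<^sup>2)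
      \<le> (\<Sum>k\<in>tri N. (q k)\<^sup>2 * r\<^sup>2)"
  proof (rule sum_mono)
    fix k
    have "\<bar>XX k t \<omega> - XX k s \<omega>\<bar>\<^sup>2 \<le> (q k * r)\<^sup>2" using q by (intro power_mono) auto
    then show "(XX k t \<omega> - XX k s \<omega>)\<^sup>2 \<le> (q k)\<^sup>2 * r\<^sup>2" by (simp add: power_mult_distrib)
  qed
  also have "\<dots> = (\<Sum>k\<in>tri N. (q k)\<^sup>2) * r\<^sup>2"
    by (simp add: sum_distrib_right)
  also have "\<dots> \<le> R * (real N)\<^sup>2 * r\<^sup>2" by (intro mult_right_mono R) simp
  finally have "?F \<le> 2 / real N * (R * (real N)\<^sup>2 * r\<^sup>2)"
    unfolding frobenius_sq_Y_mat_diff[OF N] by (intro mult_left_mono) auto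
  also have "\<dots> = real N * (2 * R * r\<^sup>2)" using Npos by (simp add: power2_eq_square)
  finally have "sqrt ?F \<le> sqrt (real N * (2 * R * r\<^sup>2))" by (rule real_sqrt_le_mono)
  also have "\<dots> = sqrt (real N) * (sqrt (2 * R) * r)" using r by (simp add: real_sqrt_mult)
  finally have F: "l * sqrt (real N) * sqrt ?F \<le> l * sqrt (real N) * (sqrt (real N) * (sqrt (2 * R) * r))"
    using l by (intro mult_left_mono) auto
  have "\<bar>mean (L XX N t \<omega>) f - mean (L XX N s \<omega>) f\<bar>
     = \<bar>(\<Sum>i<N. f (eigenvalue_list (Y_mat XX N t \<omega>) ! i)) - (\<Sum>i<N. f (eigenvalue_list (Y_mat XX N s \<omega>) ! i))\<bar> / real N"
    unfolding integral_L[OF fm] by (simp add: diff_divide_distrib[symmetric])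
  also have "\<dots> \<le> (l * sqrt (real N) * sqrt ?F) / real N"
    using eigenvalue_list_lipschitz_sum[OF Y_mat_symmetric Y_mat_symmetric f l] Npos
    by (intro divide_right_mono) auto
  also have "\<dots> \<le> (l * sqrt (real N) * (sqrt (real N) * (sqrt (2 * R) * r))) / real N"
    by (intro divide_right_mono F) simp
  also have "\<dots> = l * (sqrt (2 * R) * r) * ((sqrt (real N) * sqrt (real N)) / real N)" by (simp only: mult_ac times_divide_eq_right)
  also have "\<dots> = l * (sqrt (2 * R) * r)" using Npos by simp
  finally show ?thesis .
qed

lemma real_distribution_L:
  assumes "N \<ge> 1"
  shows "real_distribution (L XX N t \<omega>)"
proof -
  have "prob_space (uniform_count_measure {..<N})"
    using assms by (intro prob_space_uniform_count_measure) (auto simp: lessThan_empty_iff)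
  then have "prob_space (L XX N t \<omega>)"
    unfolding L_def empirical_spectral_measure_def using Y_mat_symmetric(1)[of XX N t \<omega>]
    by (auto intro!: prob_space.prob_space_distr)
  then show ?thesis
    by (auto simp: real_distribution_def real_distribution_axioms_def L_def empirical_spectral_measure_def)
qed

lemma nn_integral_L:
  assumes "N \<ge> 1" and f: "f \<in> borel_measurable borel" "\<And>x. f x \<ge> 0"
  shows "(\<integral>\<^sup>+x. ennreal (f x) \<partial>L XX N t \<omega>) = ennreal (mean (L XX N t \<omega>) f)"
proof (rule nn_integral_eq_integral)
  show "integrable (L XX N t \<omega>) f"
    unfolding L_def empirical_spectral_measure_def
    using f(1) by (subst integrable_distr_eq)
      (auto simp: uniform_count_measure_def intro!: integrable_point_measure_finite)
qed (use f in auto)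

theorem theorem3p1:
  fixes M0 :: "'b measure" and M :: "'a measure"
    and H \<epsilon> C0 T :: real
    and \<sigma> b \<phi> :: "real \<Rightarrow> real"
    and B X :: "real \<Rightarrow> 'b \<Rightarrow> real"
    and XX :: "nat \<times> nat \<Rightarrow> real \<Rightarrow> 'a \<Rightarrow> real"
  assumes "prob_space M0" and "prob_space M"
    and "1 / 2 < H" and "H < 1"
    and "fractional_brownian_motion M0 H B"
    and "young_sde_solution M0 H \<sigma> b B X"
    and "independent_variables M0 borel (X 0) path_space (sample_path B)"
    and "iid_copies M XX M0 X"
    and "0 < \<epsilon>" and "\<epsilon> < H - 1 / 2"
    and "\<forall>x. \<sigma> differentiable at x" and "\<forall>x. b differentiable at x"
    and "bounded (range (deriv \<sigma>))" and "bounded (range (deriv b))"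
    and "\<exists>\<gamma>>1 / (H - \<epsilon>) - 1. holder_on UNIV \<gamma> (deriv \<sigma>)"
    and "\<exists>\<gamma>>1 / (H - \<epsilon>) - 1. holder_on UNIV \<gamma> (deriv b)"
    and "(bounded (range \<sigma>) \<and> bounded (range b)) \<or>
         ((SUP x. \<bar>deriv \<sigma> x\<bar>) + (SUP x. \<bar>deriv b x\<bar>) > 0 \<and>
          integrable M0 (\<lambda>\<omega>. \<bar>X 0 \<omega>\<bar> ^ 4))"
    and "\<forall>x. \<phi> x > 0"
    and "\<forall>x. \<phi> differentiable at x" and "continuous_on UNIV (deriv \<phi>)"
    and "bounded (range (deriv \<phi>))"
    and "filterlim \<phi> at_top at_infinity"
    and "C0 > 0"
    and "AE \<omega> in M. (SUP N\<in>{1..}. ereal (\<integral>x. \<phi> x \<partial>L XX N 0 \<omega>)) \<le> ereal C0"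
    and "T > 0"
  shows "AE \<omega> in M. relatively_compact_in (uniform_topology T)
           {(\<lambda>t\<in>{0..T}. L XX N t \<omega>) | N. N \<ge> 1}"
proof -
  note T = \<open>T > 0\<close>
  have "(bounded (range \<sigma>) \<and> bounded (range b)) \<or> integrable M0 (\<lambda>\<omega>. \<bar>X 0 \<omega>\<bar> ^ 4)"
    using assms(17) by blast
  from sde_hoelder4_moment[OF assms(1,3,4) T assms(5-7,11-14) this]
  obtain v where v: "0 < v" "v < 1" and fin: "(\<integral>\<^sup>+\<omega>. hoelder4 T v (\<lambda>t. X t \<omega>) \<partial>M0) < \<infinity>"
    by blast
  have Xm: "sample_path X \<in> measurable M0 path_space"
    unfolding sample_path_def[abs_def]
    using assms(6) by (intro measurable_restrict) (auto simp: young_sde_solution_def)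
  obtain l where l: "l \<ge> 0" and \<phi>lip: "\<And>x y. \<bar>\<phi> x - \<phi> y\<bar> \<le> l * \<bar>x - y\<bar>"
    using lipschitz_of_bounded_deriv[OF assms(19,21)] by blast
  have \<phi>c: "continuous_on UNIV \<phi>"
    using \<phi>lip l by (intro lipschitz_on_continuous_on[of l] lipschitz_onI) (auto simp: dist_real_def)
  have \<phi>m: "\<phi> \<in> borel_measurable borel" by (rule borel_measurable_continuous_onI[OF \<phi>c])
  have \<phi>0: "\<phi> x \<ge> 0" for x using assms(18) by (simp add: less_imp_le)
  have "AE \<omega> in M. \<forall>k. continuous_on {0..} (\<lambda>t. XX k t \<omega>)"
    using assms(8) by (simp add: iid_copies_def AE_all_countable)
  \<comment> \<open>Everything random is settled on one almost sure event; from here on \<omega> is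
    fixed and the argument is deterministic.\<close>
  with iid_copies_hoelder_bound[OF assms(2,8) Xm T v(1) fin] assms(24) show ?thesis
  proof eventually_elim
    case (elim \<omega>)
    obtain q R where q: "\<And>k. 0 \<le> q k" "\<And>k n j. j < 2 ^ n \<Longrightarrow> \<bar>dinc T (\<lambda>t. XX k t \<omega>) n j\<bar> \<le> q k * v ^ n"
      and R: "\<And>N. (\<Sum>k\<in>tri N. (q k)\<^sup>2) \<le> R * (real N)\<^sup>2"
      using elim(1) by blast
    define r where "r m = 3 * v ^ m / (1 - v)" for m
    have r0: "r m \<ge> 0" for m using v by (simp add: r_def)
    define \<rho> where "\<rho> m = sqrt (2 * R) * r m" for m
    have \<rho>: "\<rho> \<longlonglongrightarrow> 0"
    proof -
      have "(\<lambda>m. sqrt (2 * R) * (3 * v ^ m / (1 - v))) \<longlonglongrightarrow> sqrt (2 * R) * (3 * 0 / (1 - v))"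
        using v by (intro tendsto_intros LIMSEQ_realpow_zero) auto
      then show ?thesis by (simp add: \<rho>_def[abs_def] r_def)
    qed
    \<comment> \<open>Here the continuity of the copies extends the dyadic bounds to all
      times.\<close>
    have mod: "\<bar>XX k t \<omega> - XX k s \<omega>\<bar> \<le> q k * r m"
      if "s \<in> {0..T}" "t \<in> {0..T}" "\<bar>s - t\<bar> \<le> T / 2 ^ m" for k s t m
    proof -
      have "continuous_on {0..T} (\<lambda>t. XX k t \<omega>)"
        using elim(3)[rule_format, of k] by (rule continuous_on_subset) auto
      from dyadic_modulus[OF T v q(1) this q(2) that(2,1)] that(3) show ?thesis
        by (simp add: r_def abs_minus_commute)
    qed
    \<comment> \<open>The Lipschitz constant is left free: \<open>c = 1\<close> serves the functions
      of \<open>BL1\<close>, and \<open>c = l\<close> serves \<phi>.\<close>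
    have lip: "\<bar>mean (L XX N t \<omega>) f - mean (L XX N s \<omega>) f\<bar> \<le> c * \<rho> m"
      if "N \<ge> 1" "\<And>x y. \<bar>f x - f y\<bar> \<le> c * \<bar>x - y\<bar>" "c \<ge> 0" "s \<in> {0..T}" "t \<in> {0..T}" "\<bar>s - t\<bar> \<le> T / 2 ^ m"
      for f c N s t m
      unfolding \<rho>_def using mod[OF that(4-6)] q(1) by (intro L_lipschitz[where q=q] that r0 R) auto
    \<comment> \<open>At \<open>m = 0\<close> the admissible distance is the whole length
      \<open>T\<close>, so \<open>l * \<rho> 0\<close> bounds the change of the mean of \<phi> since
      time \<open>0\<close>, where it is at most \<open>C0\<close>.\<close>
    have "(\<lambda>t\<in>{0..T}. L XX N t \<omega>) \<in> tight_paths T \<phi> (C0 + l * \<rho> 0) (\<lambda>m. T / 2 ^ m) \<rho>"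
      if N: "N \<ge> 1" for N
    proof -
      let ?\<mu> = "\<lambda>t\<in>{0..T}. L XX N t \<omega>"
      have eq: "\<bar>mean (?\<mu> s) f - mean (?\<mu> t) f\<bar> \<le> \<rho> m"
        if "f \<in> BL1" "s \<in> {0..T}" "t \<in> {0..T}" "\<bar>s - t\<bar> \<le> T / 2 ^ m" for f s t m
        using lip[OF N, of f 1 t s m] that BL1_lipschitz[OF that(1)] by (simp add: abs_minus_commute)
      have "?\<mu> \<in> measure_paths T"
      proof (rule measure_pathsI_BL1)
        show "?\<mu> \<in> extensional {0..T}" by simp
        show "real_distribution (?\<mu> t)" if "t \<in> {0..T}" for t using real_distribution_L[OF N] that by simp
        fix f assume f: "f \<in> BL1"
        show "continuous_on {0..T} (\<lambda>t. mean (?\<mu> t) f)"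
          unfolding continuous_on_iff
        proof (intro ballI allI impI)
          fix t e :: real assume t: "t \<in> {0..T}" and e: "e > 0"
          obtain m where m: "\<rho> m < e" using order_tendstoD(2)[OF \<rho> e] eventually_sequentially by auto
          show "\<exists>d>0. \<forall>t'\<in>{0..T}. dist t' t < d \<longrightarrow> dist (mean (?\<mu> t') f) (mean (?\<mu> t) f) < e"
          proof (intro exI[of _ "T / 2 ^ m"] conjI ballI impI)
            fix t' assume "t' \<in> {0..T}" "dist t' t < T / 2 ^ m"
            then show "dist (mean (?\<mu> t') f) (mean (?\<mu> t) f) < e"
              using eq[OF f _ t, of t' m] m unfolding dist_real_def by linarith
          qed (use T in simp)
        qed
      qed
      moreover have "(\<integral>\<^sup>+x. ennreal (\<phi> x) \<partial>?\<mu> t) \<le> ennreal (C0 + l * \<rho> 0)" if t: "t \<in> {0..T}" for t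
      proof -
        have "ereal (mean (L XX N 0 \<omega>) \<phi>) \<le> ereal C0"
          using N by (intro order_trans[OF SUP_upper elim(2)]) simp
        moreover have "\<bar>mean (L XX N t \<omega>) \<phi> - mean (L XX N 0 \<omega>) \<phi>\<bar> \<le> l * \<rho> 0"
          using t T by (intro lip[OF N \<phi>lip l]) auto
        ultimately have "mean (L XX N t \<omega>) \<phi> \<le> C0 + l * \<rho> 0" by simp
        then show ?thesis using t by (simp add: nn_integral_L[OF N \<phi>m \<phi>0] ennreal_leI)
      qed
      ultimately show ?thesis using eq unfolding tight_paths_def by blast
    qed
    then have "{(\<lambda>t\<in>{0..T}. L XX N t \<omega>) | N. N \<ge> 1}
        \<subseteq> tight_paths T \<phi> (C0 + l * \<rho> 0) (\<lambda>m. T / 2 ^ m) \<rho>" by blast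
    then show ?case
      using T by (intro relatively_compact_in_uniform_topology[OF _ \<phi>0 \<phi>c assms(22) _ \<rho>]) auto
  qed
qed

end
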